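(* Let $N\ge 3$ be an integer and let $p>1+\frac{4}{N-2}$; if $N\geq 4$, assume moreover that $p<1+\frac{4}{N-3}$. Then for every integer $n\ge 0$ there exist $\rho_n>1$ and a (real-)analytic positive function $u_n$ on $[0,\rho_n)$ which is a solution on $(0,\rho_n)$ of $$(1-\rho^{2})u''+\left(\frac{N-1}{\rho}-2(\alpha+1)\rho\right)u'-\alpha(\alpha+1)u+|u|^{p-1}u=0,$$ such that $u_n-u_\infty$ has exactly $n+1$ zeros on $(0,1)$. Moreover, $\lim_{n\to\infty}u_n(0)=+\infty$.
   Context: Notation: $\alpha=\frac{2}{p-1}$, $b_\infty=\left(\alpha(N-2-\alpha)\right)^{\alpha/2}$, and $u_\infty(\rho)=b_\infty\rho^{-\alpha}$ for $\rho>0$ (an explicit solution of the equation, singular at $\rho=0$). The prime denotes $d/d\rho$. *)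

theory Defs
  imports "HOL-Analysis.Analysis"
begin

definition alpha :: "real \<Rightarrow> real" where
  "alpha p = 2 / (p - 1)"

definition b_inf :: "nat \<Rightarrow> real \<Rightarrow> real" where
  "b_inf N p = (alpha p * (real N - 2 - alpha p)) powr (alpha p / 2)"

definition u_inf :: "nat \<Rightarrow> real \<Rightarrow> real \<Rightarrow> real" where
  "u_inf N p \<rho> = b_inf N p * \<rho> powr (- alpha p)"

(* The power series at x has to represent f only on S near x. At interior points of S this is
   the usual two-sided notion; at a closed end point of an interval it is one-sided, so the values
   of f outside S are irrelevant. *)
definition real_analytic_on :: "(real \<Rightarrow> real) \<Rightarrow> real set \<Rightarrow> bool" where
  "real_analytic_on f S \<longleftrightarrow>
     (\<forall>x\<in>S. \<exists>(a :: nat \<Rightarrow> real) r. r > 0 \<and>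
        (\<forall>y\<in>S. \<bar>y - x\<bar> < r \<longrightarrow> (\<lambda>k. a k * (y - x) ^ k) sums f y))"

(* Classical (pointwise, twice differentiable) solution on an open set S; u1 and u2 are the
   first and second derivatives of u on S. *)
definition is_solution_on :: "nat \<Rightarrow> real \<Rightarrow> (real \<Rightarrow> real) \<Rightarrow> real set \<Rightarrow> bool" where
  "is_solution_on N p u S \<longleftrightarrow>
     (\<exists>u1 u2. \<forall>\<rho>\<in>S.
        (u has_real_derivative u1 \<rho>) (at \<rho>) \<and>
        (u1 has_real_derivative u2 \<rho>) (at \<rho>) \<and>
        (1 - \<rho>\<^sup>2) * u2 \<rho>
          + ((real N - 1) / \<rho> - 2 * (alpha p + 1) * \<rho>) * u1 \<rho>
          - alpha p * (alpha p + 1) * u \<rho>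
          + \<bar>u \<rho>\<bar> powr (p - 1) * u \<rho> = 0)"

end

theory Submission
  imports Defs "HOL-Complex_Analysis.Complex_Analysis"
begin

text \<open>Shooting from \<open>\<rho> = 0\<close>: the solution \<open>U c\<close> with \<open>u(0) = c\<close>, \<open>c \<ge> c0\<close>, exists on \<open>[0, 1]\<close> and stays positive,
  because two energies decrease, one for \<open>u\<close> and one for \<open>w = \<rho>\<^sup>\<alpha> u\<close>. At the singular point \<open>\<rho> = 1\<close> the
  indices are \<open>0\<close> and \<open>1 - m\<close> with \<open>0 < m < 1/2\<close>, so \<open>u\<close> and the flux \<open>q = \<rho>\<^sup>N\<^sup>-\<^sup>1 (1 - \<rho>\<^sup>2)\<^sup>m u'\<close> extend
  continuously to \<open>\<rho> = 1\<close>, jointly in \<open>c\<close>, and \<open>U c\<close> is analytic there iff \<open>q(1) = 0\<close>. The difference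
  \<open>u - u\<^sub>\<infinity>\<close> and its flux never vanish together, so the number of zeros of \<open>U c - u\<^sub>\<infinity>\<close> in \<open>(0, 1)\<close> changes
  with \<open>c\<close> only when a zero passes through \<open>\<rho> = 1\<close>. This number is \<open>1\<close> for the constant solution \<open>c0\<close> and
  tends to infinity with \<open>c\<close>, since \<open>w\<close> oscillates around \<open>b\<^sub>\<infinity>\<close> in the variable \<open>ln \<rho>\<close>. On a maximal
  interval of parameters with exactly \<open>k + 1\<close> zeros, following values of \<open>c\<close> with \<open>k\<close> zeros, the sign of \<open>q(1)\<close>
  at the two ends is \<open>(-1)\<^sup>k\<close> and \<open>(-1)\<^sup>k\<^sup>+\<^sup>1\<close>; hence \<open>q(1) = 0\<close> in between.\<close>

section \<open>Volterra systems\<close>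

text \<open>The upper bound on \<open>p\<close> gives \<open>0 < m\<close> (automatic for
  \<open>N = 3\<close>). Then \<open>P2\<close>, at most \<open>(1 - x) powr (m - 1)\<close>, is
  integrable at \<open>1\<close>, which is why the flux has a limit there. The same inequality gives
  \<open>b_inf N p < c0\<close>, so the constant solution crosses \<open>u_inf\<close> inside
  \<open>(0, 1)\<close>. The lower bound gives \<open>m < 1/2\<close>, that is
  \<open>0 < \<delta>\<close>, the friction coefficient in the energy of \<open>w\<close>. The
  obstacle in counting is the end point \<open>1\<close>: a zero may enter there, and
  \<open>u\<close> need not be differentiable there. The number of zeros in \<open>(0, 1)\<close> is
  only lower semicontinuous in the parameter, the number in \<open>(0, 1]\<close> only upper
  semicontinuous. They differ by at most one, namely by a zero at \<open>1\<close>, and this is what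
  makes the count grow in controlled steps. At \<open>1\<close> an analytic solution is fixed by its
  value alone and has flux zero. Since value and flux at \<open>1\<close> determine a solution to
  the left, vanishing of the flux identifies the shooting solution with the analytic one, which also
  continues it beyond \<open>1\<close>. The central values diverge because each is chosen beyond all
  parameters with fewer zeros, while the count is bounded on bounded sets of parameters.\<close>

lemma abs_le_by_derivative:
  fixes f g :: "real \<Rightarrow> real"
  assumes "a \<le> b"
    and f: "continuous_on {a..b} f" and g: "continuous_on {a..b} g"
    and f': "\<And>x. a < x \<Longrightarrow> x < b \<Longrightarrow> (f has_real_derivative f' x) (at x)"
    and g': "\<And>x. a < x \<Longrightarrow> x < b \<Longrightarrow> (g has_real_derivative g' x) (at x)"
    and le: "\<And>x. a < x \<Longrightarrow> x < b \<Longrightarrow> \<bar>f' x\<bar> \<le> g' x"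
  shows "\<bar>f b - f a\<bar> \<le> g b - g a"
proof (cases "a = b")
  case False
  hence ab: "a < b" using assms(1) by simp
  have 1: "g a - f a \<le> g b - f b"
  proof (rule DERIV_nonneg_imp_increasing_open[of a b "\<lambda>x. g x - f x"])
    show "\<exists>y. ((\<lambda>x. g x - f x) has_real_derivative y) (at x) \<and> 0 \<le> y" if "a < x" "x < b" for x
      using f'[OF that] g'[OF that] le[OF that] by (intro exI[of _ "g' x - f' x"]) (auto intro!: derivative_intros)
  qed (use ab f g in \<open>auto intro!: continuous_intros\<close>)
  have 2: "g a + f a \<le> g b + f b"
  proof (rule DERIV_nonneg_imp_increasing_open[of a b "\<lambda>x. g x + f x"])
    show "\<exists>y. ((\<lambda>x. g x + f x) has_real_derivative y) (at x) \<and> 0 \<le> y" if "a < x" "x < b" for x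
      using f'[OF that] g'[OF that] le[OF that] by (intro exI[of _ "g' x + f' x"]) (auto intro!: derivative_intros)
  qed (use ab f g in \<open>auto intro!: continuous_intros\<close>)
  show ?thesis using 1 2 by linarith
qed auto

text \<open>One estimate serves Picard iteration, with \<open>h\<close> the difference of the
  previous iterates, and Gronwall's inequality, with \<open>h = d\<close>. The coefficient
  \<open>k1\<close> may blow up at \<open>a\<close>: only its product with the primitive
  \<open>K\<close> of \<open>k2\<close> has to be bounded. The exponential weight gains the factor
  \<open>1 / \<Lambda>\<close>.\<close>

lemma volterra_step:
  fixes d e K h :: "real \<Rightarrow> real"
  assumes pos: "0 < \<Lambda>" "0 \<le> L" "0 \<le> C" "0 \<le> S"
    and d: "continuous_on {a..b} d" and e: "continuous_on {a..b} e" and K: "continuous_on {a..b} K"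
    and d': "\<And>x. a < x \<Longrightarrow> x < b \<Longrightarrow> (d has_real_derivative k1 x * e x) (at x)"
    and e': "\<And>x. a < x \<Longrightarrow> x < b \<Longrightarrow> (e has_real_derivative e' x) (at x)"
    and K': "\<And>x. a < x \<Longrightarrow> x < b \<Longrightarrow> (K has_real_derivative k2 x) (at x)"
    and k2: "\<And>x. a < x \<Longrightarrow> x < b \<Longrightarrow> 0 \<le> k2 x"
    and le: "\<And>x. a < x \<Longrightarrow> x < b \<Longrightarrow> \<bar>e' x\<bar> \<le> L * k2 x * \<bar>h x\<bar>"
    and h: "\<And>x. a < x \<Longrightarrow> x < b \<Longrightarrow> \<bar>h x\<bar> \<le> S * exp (\<Lambda> * (x - a))"
    and kK: "\<And>x. a < x \<Longrightarrow> x < b \<Longrightarrow> \<bar>k1 x\<bar> * K x \<le> C"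
    and K0: "K a = 0" and e0: "e a = 0"
    and s: "a \<le> s" "s \<le> b"
  shows "\<bar>d s\<bar> \<le> \<bar>d a\<bar> + L * S * C / \<Lambda> * exp (\<Lambda> * (s - a))"
proof -
  \<comment> \<open>On \<open>{a..x}\<close> the growing weight is frozen at its value at
    \<open>x\<close>, so that \<open>e\<close> is compared with a constant multiple of
    \<open>K\<close>.\<close>
  have eb: "\<bar>e x\<bar> \<le> L * S * exp (\<Lambda> * (x - a)) * K x" if x: "a < x" "x < b" for x
  proof -
    let ?c = "L * S * exp (\<Lambda> * (x - a))"
    have "\<bar>e x - e a\<bar> \<le> ?c * K x - ?c * K a"
    proof (rule abs_le_by_derivative[where f' = e' and g' = "\<lambda>t. ?c * k2 t"])
      show "continuous_on {a..x} e" "continuous_on {a..x} (\<lambda>t. ?c * K t)"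
        using x by (auto intro!: continuous_intros continuous_on_subset[OF e] continuous_on_subset[OF K])
      fix t assume t: "a < t" "t < x"
      show "(e has_real_derivative e' t) (at t)" using e' t x by auto
      show "((\<lambda>t. ?c * K t) has_real_derivative ?c * k2 t) (at t)"
        using K'[of t] t x by (auto intro!: derivative_eq_intros)
      have "\<bar>h t\<bar> \<le> S * exp (\<Lambda> * (x - a))"
        using h[of t] t x pos by (smt (verit, best) exp_le_cancel_iff mult_left_mono)
      hence "L * k2 t * \<bar>h t\<bar> \<le> L * k2 t * (S * exp (\<Lambda> * (x - a)))"
        using k2[of t] t x pos by (intro mult_left_mono) auto
      thus "\<bar>e' t\<bar> \<le> ?c * k2 t" using le[of t] t x by (simp add: mult_ac)
    qed (use x in auto)
    thus ?thesis using K0 e0 by simp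
  qed
  let ?G = "\<lambda>t. L * S * C / \<Lambda> * exp (\<Lambda> * (t - a))"
  have "\<bar>d s - d a\<bar> \<le> ?G s - ?G a"
  proof (rule abs_le_by_derivative[where f' = "\<lambda>x. k1 x * e x" and g' = "\<lambda>t. L * S * C * exp (\<Lambda> * (t - a))"])
    show "continuous_on {a..s} d" "continuous_on {a..s} ?G"
      using s pos by (auto intro!: continuous_intros continuous_on_subset[OF d])
    fix t assume t: "a < t" "t < s"
    show "(d has_real_derivative k1 t * e t) (at t)" using d' t s by auto
    show "(?G has_real_derivative L * S * C * exp (\<Lambda> * (t - a))) (at t)"
      using pos by (auto intro!: derivative_eq_intros)
    have "\<bar>k1 t * e t\<bar> \<le> \<bar>k1 t\<bar> * (L * S * exp (\<Lambda> * (t - a)) * K t)"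
      unfolding abs_mult using eb[of t] t s by (intro mult_left_mono) auto
    also have "\<dots> = L * S * exp (\<Lambda> * (t - a)) * (\<bar>k1 t\<bar> * K t)" by (simp add: mult_ac)
    also have "\<dots> \<le> L * S * exp (\<Lambda> * (t - a)) * C"
      using kK[of t] t s pos by (intro mult_left_mono) auto
    finally show "\<bar>k1 t * e t\<bar> \<le> L * S * C * exp (\<Lambda> * (t - a))" by (simp add: mult_ac)
  qed (use s in auto)
  moreover have "0 \<le> ?G a" using pos by simp
  ultimately show ?thesis by linarith
qed

text \<open>Take \<open>h = d\<close> in \<open>volterra_step\<close>. With
  \<open>\<Lambda> = 2 * L * C\<close> the weighted supremum \<open>S\<close> of \<open>d\<close> is
  at most \<open>\<bar>d a\<bar> + S / 2\<close>, and the last term is absorbed. Uniqueness is the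
  case \<open>d a = 0\<close>.\<close>

lemma volterra_bound:
  fixes d e K :: "real \<Rightarrow> real"
  assumes pos: "0 < L" "0 < C"
    and d: "continuous_on {a..b} d" and e: "continuous_on {a..b} e" and K: "continuous_on {a..b} K"
    and d': "\<And>x. a < x \<Longrightarrow> x < b \<Longrightarrow> (d has_real_derivative k1 x * e x) (at x)"
    and e': "\<And>x. a < x \<Longrightarrow> x < b \<Longrightarrow> (e has_real_derivative e' x) (at x)"
    and K': "\<And>x. a < x \<Longrightarrow> x < b \<Longrightarrow> (K has_real_derivative k2 x) (at x)"
    and k2: "\<And>x. a < x \<Longrightarrow> x < b \<Longrightarrow> 0 \<le> k2 x"
    and le: "\<And>x. a < x \<Longrightarrow> x < b \<Longrightarrow> \<bar>e' x\<bar> \<le> L * k2 x * \<bar>d x\<bar>"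
    and kK: "\<And>x. a < x \<Longrightarrow> x < b \<Longrightarrow> \<bar>k1 x\<bar> * K x \<le> C"
    and K0: "K a = 0" and e0: "e a = 0"
    and s: "a \<le> s" "s \<le> b"
  shows "\<bar>d s\<bar> \<le> 2 * \<bar>d a\<bar> * exp (2 * L * C * (s - a))"
proof -
  define \<Lambda> where "\<Lambda> = 2 * L * C"
  have \<Lambda>: "\<Lambda> > 0" using pos by (simp add: \<Lambda>_def)
  let ?g = "\<lambda>x. \<bar>d x\<bar> * exp (- \<Lambda> * (x - a))"
  obtain x0 where x0: "x0 \<in> {a..b}" and mx: "\<forall>y\<in>{a..b}. ?g y \<le> ?g x0"
    using continuous_attains_sup[of "{a..b}" ?g] s d by (force intro!: continuous_intros)
  define S where "S = ?g x0"
  have S0: "S \<ge> 0" by (simp add: S_def)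
  have bd: "\<bar>d x\<bar> \<le> S * exp (\<Lambda> * (x - a))" if "x \<in> {a..b}" for x
  proof -
    have "\<bar>d x\<bar> = ?g x * exp (\<Lambda> * (x - a))" by (simp add: mult.assoc exp_add[symmetric])
    also have "\<dots> \<le> S * exp (\<Lambda> * (x - a))" using mx that by (intro mult_right_mono) (auto simp: S_def)
    finally show ?thesis .
  qed
  have "\<bar>d x0\<bar> \<le> \<bar>d a\<bar> + L * S * C / \<Lambda> * exp (\<Lambda> * (x0 - a))"
    by (rule volterra_step[OF \<Lambda> _ _ S0 d e K d' e' K' k2 le _ kK K0 e0]) (use pos bd x0 in auto)
  also have "L * S * C / \<Lambda> = S / 2" using pos by (simp add: \<Lambda>_def field_simps)
  finally have "\<bar>d x0\<bar> * exp (- \<Lambda> * (x0 - a)) \<le> (\<bar>d a\<bar> + S / 2 * exp (\<Lambda> * (x0 - a))) * exp (- \<Lambda> * (x0 - a))"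
    by (intro mult_right_mono) auto
  hence "S \<le> \<bar>d a\<bar> * exp (- \<Lambda> * (x0 - a)) + S / 2"
    by (simp add: S_def ring_distribs mult.assoc exp_add[symmetric])
  moreover have "\<bar>d a\<bar> * exp (- \<Lambda> * (x0 - a)) \<le> \<bar>d a\<bar> * 1"
    using x0 \<Lambda> by (intro mult_left_mono) auto
  ultimately have "S \<le> 2 * \<bar>d a\<bar>" by simp
  hence "S * exp (\<Lambda> * (s - a)) \<le> 2 * \<bar>d a\<bar> * exp (\<Lambda> * (s - a))" by (intro mult_right_mono) auto
  moreover have "\<bar>d s\<bar> \<le> S * exp (\<Lambda> * (s - a))" using bd s by simp
  ultimately have "\<bar>d s\<bar> \<le> 2 * \<bar>d a\<bar> * exp (\<Lambda> * (s - a))" by (rule order_trans[rotated])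
  thus ?thesis by (simp only: \<Lambda>_def)
qed

text \<open>Reflection of the previous bound; it yields uniqueness from data at the right end, in
  particular at the singular point \<open>1\<close>.\<close>

lemma volterra_bound_left:
  fixes d e K :: "real \<Rightarrow> real"
  assumes pos: "0 < L" "0 < C"
    and d: "continuous_on {a..b} d" and e: "continuous_on {a..b} e" and K: "continuous_on {a..b} K"
    and d': "\<And>x. a < x \<Longrightarrow> x < b \<Longrightarrow> (d has_real_derivative k1 x * e x) (at x)"
    and e': "\<And>x. a < x \<Longrightarrow> x < b \<Longrightarrow> (e has_real_derivative e' x) (at x)"
    and K': "\<And>x. a < x \<Longrightarrow> x < b \<Longrightarrow> (K has_real_derivative - k2 x) (at x)"
    and k2: "\<And>x. a < x \<Longrightarrow> x < b \<Longrightarrow> 0 \<le> k2 x"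
    and le: "\<And>x. a < x \<Longrightarrow> x < b \<Longrightarrow> \<bar>e' x\<bar> \<le> L * k2 x * \<bar>d x\<bar>"
    and kK: "\<And>x. a < x \<Longrightarrow> x < b \<Longrightarrow> \<bar>k1 x\<bar> * K x \<le> C"
    and K0: "K b = 0" and e0: "e b = 0"
    and s: "a \<le> s" "s \<le> b"
  shows "\<bar>d s\<bar> \<le> 2 * \<bar>d b\<bar> * exp (2 * L * C * (b - s))"
proof -
  have cont: "continuous_on {-b..-a} (\<lambda>x. f (-x))" if "continuous_on {a..b} f" for f :: "real \<Rightarrow> real"
    by (rule continuous_on_compose2[OF that]) (auto intro!: continuous_intros)
  have der: "((\<lambda>x. f (-x)) has_real_derivative - D) (at x)" if "(f has_real_derivative D) (at (-x))" for f D and x :: real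
    using DERIV_mirror[of f D x] that by blast
  have "\<bar>d (- (- s))\<bar> \<le> 2 * \<bar>d (- (- b))\<bar> * exp (2 * L * C * (- s - (- b)))"
  proof (rule volterra_bound[where d = "\<lambda>x. d (-x)" and e = "\<lambda>x. e (-x)" and K = "\<lambda>x. K (-x)" and b = "-a"
        and ?k1.0 = "\<lambda>x. - k1 (-x)" and e' = "\<lambda>x. - e' (-x)" and ?k2.0 = "\<lambda>x. k2 (-x)"])
    fix x assume x: "- b < x" "x < - a"
    show "((\<lambda>x. d (- x)) has_real_derivative - k1 (- x) * e (- x)) (at x)"
      using der[OF d'[of "-x"]] x by simp
    show "((\<lambda>x. e (- x)) has_real_derivative - e' (- x)) (at x)"
      using der[OF e'[of "-x"]] x by simp
    show "((\<lambda>x. K (- x)) has_real_derivative k2 (- x)) (at x)"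
      using der[OF K'[of "-x"]] x by simp
    show "0 \<le> k2 (-x)" "\<bar>- e' (- x)\<bar> \<le> L * k2 (- x) * \<bar>d (- x)\<bar>" "\<bar>- k1 (- x)\<bar> * K (- x) \<le> C"
      using k2[of "-x"] le[of "-x"] kK[of "-x"] x by auto
  qed (use pos cont d e K K0 e0 s in auto)
  thus ?thesis by simp
qed

lemma continuous_on_Icc_bounded:
  fixes g :: "real \<Rightarrow> real"
  assumes "continuous_on {a..b} g"
  obtains B where "0 < B" "\<And>t. t \<in> {a..b} \<Longrightarrow> \<bar>g t\<bar> \<le> B"
proof -
  have "bounded (g ` {a..b})"
    by (intro compact_imp_bounded compact_continuous_image assms) auto
  then obtain B where "\<forall>x\<in>g ` {a..b}. norm x \<le> B" unfolding bounded_iff by blast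
  thus thesis by (intro that[of "max 1 B"]) (auto simp: le_max_iff_disj)
qed

lemma uniform_limit_geometric:
  fixes F :: "nat \<Rightarrow> 'a \<Rightarrow> 'b::banach"
  assumes "\<And>n x. x \<in> X \<Longrightarrow> norm (F (Suc n) x - F n x) \<le> A * (1 / 2) ^ n"
  obtains f where "uniform_limit X F f sequentially"
proof -
  have "uniform_limit X (\<lambda>n x. \<Sum>i<n. F (Suc i) x - F i x) (\<lambda>x. \<Sum>i. F (Suc i) x - F i x) sequentially"
    using assms by (intro Weierstrass_m_test[where M = "\<lambda>n. A * (1 / 2) ^ n"] summable_mult summable_geometric) auto
  hence "uniform_limit X (\<lambda>n x. F 0 x + (\<Sum>i<n. F (Suc i) x - F i x)) (\<lambda>x. F 0 x + (\<Sum>i. F (Suc i) x - F i x)) sequentially"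
    by (intro uniform_limit_intros)
  thus thesis using that by (simp add: sum_lessThan_telescope[of "\<lambda>i. F i _"])
qed

text \<open>Picard iteration for the integrated system. The global Lipschitz bound and the weighted
  norm make it a contraction on all of \<open>{0..1}\<close>, without shrinking the interval. The
  factor \<open>s\<close> in the bound on \<open>k1\<close> makes the integrand \<open>J\<close>
  continuous at \<open>0\<close>.\<close>

lemma volterra_exists:
  fixes k1 k2 f :: "real \<Rightarrow> real"
  assumes k1: "continuous_on {0<..1} k1" and k2: "continuous_on {0..1} k2"
    and k2_nonneg: "\<And>x. x \<in> {0..1} \<Longrightarrow> 0 \<le> k2 x"
    and C: "0 < C" "\<And>s. 0 < s \<Longrightarrow> s \<le> 1 \<Longrightarrow> \<bar>k1 s\<bar> * integral {0..s} k2 \<le> C * s"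
    and L: "0 < L" "\<And>x y. \<bar>f x - f y\<bar> \<le> L * \<bar>x - y\<bar>"
  obtains u q where "continuous_on {0..1} u" "continuous_on {0..1} q" "u 0 = c" "q 0 = 0"
    "\<And>x. 0 < x \<Longrightarrow> x < 1 \<Longrightarrow> (u has_real_derivative k1 x * q x) (at x)"
    "\<And>x. 0 < x \<Longrightarrow> x < 1 \<Longrightarrow> (q has_real_derivative - (k2 x * f (u x))) (at x)"
proof -
  define K where "K s = integral {0..s} k2" for s
  define Q where "Q u s = - integral {0..s} (\<lambda>t. k2 t * f (u t))" for u s
  \<comment> \<open>\<open>k1\<close> is not controlled at \<open>0\<close>; the value
    \<open>0\<close> is the limit of \<open>J u\<close> there, by the bound \<open>Jb\<close>
    below.\<close>
  define J where "J u s = (if s = 0 then 0 else k1 s * Q u s)" for u s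
  define T where "T u s = c + integral {0..s} (J u)" for u s
  have contf: "continuous_on UNIV f"
  proof (rule continuous_on_iff[THEN iffD2], intro ballI allI impI)
    fix x e :: real assume "e > 0"
    show "\<exists>d>0. \<forall>x'\<in>UNIV. dist x' x < d \<longrightarrow> dist (f x') (f x) < e"
    proof (intro exI[of _ "e / L"] conjI ballI impI)
      fix y assume "dist y x < e / L"
      hence "L * \<bar>y - x\<bar> < e" using L(1) by (simp add: dist_real_def field_simps)
      thus "dist (f y) (f x) < e" using L(2)[of y x] by (simp add: dist_real_def)
    qed (use \<open>e > 0\<close> L in auto)
  qed
  have contfu: "continuous_on {0..1} (\<lambda>t. k2 t * f (u t))" if "continuous_on {0..1} u" for u
    by (intro continuous_intros k2 continuous_on_compose2[OF contf that]) auto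
  have contint: "continuous_on {0..1} (\<lambda>s. integral {0..s} g)" if "continuous_on {0..1} g" for g :: "real \<Rightarrow> real"
    by (intro indefinite_integral_continuous_1 integrable_continuous_real that)
  have derint: "((\<lambda>s. integral {0..s} g) has_real_derivative g x) (at x)"
    if "continuous_on {0..1} g" "0 < x" "x < 1" for g and x :: real
  proof -
    have "((\<lambda>s. integral {0..s} g) has_real_derivative g x) (at x within {0..1})"
      using integral_has_real_derivative[OF that(1), of x] that by simp
    thus ?thesis using that at_within_Icc_at[of 0 x 1] by simp
  qed
  have K: "continuous_on {0..1} K" unfolding K_def by (intro contint k2)
  have K': "(K has_real_derivative k2 x) (at x)" if "0 < x" "x < 1" for x
    unfolding K_def using derint[OF k2 that] .
  have K0: "K 0 = 0" by (simp add: K_def)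
  have Q: "continuous_on {0..1} (Q u)" if "continuous_on {0..1} u" for u
    unfolding Q_def by (intro continuous_intros contint contfu that)
  have Q': "(Q u has_real_derivative - (k2 x * f (u x))) (at x)"
    if "continuous_on {0..1} u" "0 < x" "x < 1" for u x
    unfolding Q_def[abs_def] using derint[OF contfu[OF that(1)] that(2,3)] by (rule DERIV_minus)
  have Q0: "Q u 0 = 0" for u by (simp add: Q_def)
  have J: "continuous_on {0..1} (J u)" if u: "continuous_on {0..1} u" for u
  proof -
    have "continuous_on {0..1} (\<lambda>t. f (u t))"
      by (intro continuous_on_compose2[OF contf u]) auto
    from continuous_on_Icc_bounded[OF this] obtain B
      where B: "\<And>t. t \<in> {0..1} \<Longrightarrow> \<bar>f (u t)\<bar> \<le> B" by blast
    have Qb: "\<bar>Q u s\<bar> \<le> B * K s" if s: "0 \<le> s" "s \<le> 1" for s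
    proof -
      have "\<bar>Q u s - Q u 0\<bar> \<le> B * K s - B * K 0"
      proof (rule abs_le_by_derivative[where f' = "\<lambda>x. - (k2 x * f (u x))" and g' = "\<lambda>x. B * k2 x"])
        show "continuous_on {0..s} (Q u)" "continuous_on {0..s} (\<lambda>s. B * K s)"
          using s by (auto intro!: continuous_intros continuous_on_subset[OF Q[OF u]] continuous_on_subset[OF K])
        fix x assume x: "0 < x" "x < s"
        show "\<bar>- (k2 x * f (u x))\<bar> \<le> B * k2 x"
          using mult_left_mono[OF B[of x] k2_nonneg[of x]] k2_nonneg[of x] x s by (simp add: abs_mult mult.commute)
      qed (use Q' u s K' in \<open>auto intro!: derivative_eq_intros\<close>)
      thus ?thesis by (simp add: Q0 K0)
    qed
    have B0: "B \<ge> 0" using B[of 0] by simp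
    have Jb: "\<bar>J u s\<bar> \<le> B * C * s" if s: "0 \<le> s" "s \<le> 1" for s
    proof (cases "s = 0")
      case False
      have "\<bar>J u s\<bar> = \<bar>k1 s\<bar> * \<bar>Q u s\<bar>" using False by (simp add: J_def abs_mult)
      also have "\<dots> \<le> \<bar>k1 s\<bar> * (B * K s)" using Qb s by (intro mult_left_mono) auto
      also have "\<dots> = B * (\<bar>k1 s\<bar> * K s)" by simp
      also have "\<dots> \<le> B * (C * s)" using C(2)[of s] s False B0 by (intro mult_left_mono) (auto simp: K_def)
      finally show ?thesis by simp
    qed (simp add: J_def)
    show ?thesis
    proof (rule continuous_on_eq_continuous_within[THEN iffD2], rule ballI)
      fix x :: real assume x: "x \<in> {0..1}"
      show "continuous (at x within {0..1}) (J u)"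
      proof (cases "x = 0")
        case True
        have "((J u) \<longlongrightarrow> 0) (at 0 within {0..1})"
        proof (rule Lim_null_comparison)
          show "\<forall>\<^sub>F s in at 0 within {0..1}. norm (J u s) \<le> B * C * s"
            using Jb by (auto simp: eventually_at intro!: exI[of _ 1])
          have "((\<lambda>s. B * C * s) \<longlongrightarrow> B * C * 0) (at 0 within {0..1})" by (intro tendsto_intros)
          thus "((\<lambda>s. B * C * s) \<longlongrightarrow> 0) (at 0 within {0..1})" by simp
        qed
        thus ?thesis using True by (simp add: continuous_within J_def)
      next
        case False
        have "continuous_on {0<..1} (\<lambda>s. k1 s * Q u s)"
          by (intro continuous_intros k1 continuous_on_subset[OF Q[OF u]]) auto
        hence "continuous_on {0<..1} (J u)" by (subst continuous_on_cong[OF refl]) (auto simp: J_def)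
        hence "continuous (at x within {0<..1}) (J u)" using x False by (auto simp: continuous_on_eq_continuous_within)
        moreover have "at x within {0..1} = at x within {0<..1}"
          using x False by (intro at_within_nhd[of x "{0<..}"]) auto
        ultimately show ?thesis by simp
      qed
    qed
  qed
  have T: "continuous_on {0..1} (T u)" if "continuous_on {0..1} u" for u
    unfolding T_def by (intro continuous_intros contint J that)
  have T': "(T u has_real_derivative k1 x * Q u x) (at x)"
    if "continuous_on {0..1} u" "0 < x" "x < 1" for u x
    using DERIV_add[OF DERIV_const[of c] derint[OF J[OF that(1)] that(2,3)]] that(2)
    by (simp add: T_def[abs_def] J_def)
  have T0: "T u 0 = c" for u by (simp add: T_def)
  \<comment> \<open>With this weight \<open>volterra_step\<close> contracts by the factor
    \<open>1/2\<close>.\<close>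
  define \<Lambda> where "\<Lambda> = 2 * L * C"
  have \<Lambda>: "\<Lambda> > 0" using L C by (simp add: \<Lambda>_def)
  have step: "\<bar>T u s - T v s\<bar> \<le> S / 2 * exp (\<Lambda> * s)"
    if u: "continuous_on {0..1} u" and v: "continuous_on {0..1} v" and S: "0 \<le> S"
      and uv: "\<And>s. 0 \<le> s \<Longrightarrow> s \<le> 1 \<Longrightarrow> \<bar>u s - v s\<bar> \<le> S * exp (\<Lambda> * s)" and s: "0 \<le> s" "s \<le> 1" for u v S s
  proof -
    have "\<bar>T u s - T v s\<bar> \<le> \<bar>T u 0 - T v 0\<bar> + L * S * C / \<Lambda> * exp (\<Lambda> * (s - 0))"
    proof (rule volterra_step[where d = "\<lambda>s. T u s - T v s" and e = "\<lambda>s. Q u s - Q v s" and K = K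
          and ?k1.0 = k1 and ?k2.0 = k2 and h = "\<lambda>s. u s - v s" and b = 1
          and e' = "\<lambda>x. - (k2 x * f (u x)) - - (k2 x * f (v x))"])
      show "continuous_on {0..1} (\<lambda>s. T u s - T v s)" "continuous_on {0..1} (\<lambda>s. Q u s - Q v s)"
        by (intro continuous_intros T Q u v)+
      fix x :: real assume x: "0 < x" "x < 1"
      show "((\<lambda>s. T u s - T v s) has_real_derivative k1 x * (Q u x - Q v x)) (at x)"
        using DERIV_diff[OF T'[OF u x] T'[OF v x]] by (simp add: algebra_simps)
      show "((\<lambda>s. Q u s - Q v s) has_real_derivative - (k2 x * f (u x)) - - (k2 x * f (v x))) (at x)"
        by (intro DERIV_diff Q' u v x)
      have "\<bar>- (k2 x * f (u x)) - - (k2 x * f (v x))\<bar> = k2 x * \<bar>f (u x) - f (v x)\<bar>"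
        using k2_nonneg[of x] x abs_mult[of "k2 x" "f (v x) - f (u x)"] by (simp add: algebra_simps abs_minus_commute)
      also have "\<dots> \<le> k2 x * (L * \<bar>u x - v x\<bar>)" using k2_nonneg[of x] x L by (intro mult_left_mono) auto
      finally show "\<bar>- (k2 x * f (u x)) - - (k2 x * f (v x))\<bar> \<le> L * k2 x * \<bar>u x - v x\<bar>" by (simp add: mult_ac)
      show "\<bar>k1 x\<bar> * K x \<le> C" using C(2)[of x] x mult_left_mono[of x 1 C] C(1) unfolding K_def by linarith
    qed (use \<Lambda> L C S K K' K0 k2_nonneg uv s Q0 in auto)
    thus ?thesis using L C by (simp add: T0 \<Lambda>_def)
  qed
  define U where "U n = (T ^^ n) (\<lambda>_. c)" for n
  have U: "continuous_on {0..1} (U n)" for n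
    by (induction n) (auto simp: U_def intro!: T)
  have USuc: "U (Suc n) = T (U n)" for n by (simp add: U_def)
  obtain A where A: "\<And>s. s \<in> {0..1} \<Longrightarrow> \<bar>U 1 s - U 0 s\<bar> \<le> A"
    using continuous_on_Icc_bounded[of 0 1 "\<lambda>s. U 1 s - U 0 s"] by (blast intro: continuous_intros U)
  have A0: "A \<ge> 0" using A[of 0] by simp
  have Ud: "\<bar>U (Suc n) s - U n s\<bar> \<le> A * (1/2) ^ n * exp (\<Lambda> * s)" if "0 \<le> s" "s \<le> 1" for n s
    using that
  proof (induction n arbitrary: s)
    case 0
    have "A * 1 \<le> A * exp (\<Lambda> * s)" using A0 0 \<Lambda> by (intro mult_left_mono) auto
    thus ?case using A[of s] 0 by simp
  next
    case (Suc n)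
    have "\<bar>T (U (Suc n)) s - T (U n) s\<bar> \<le> A * (1/2) ^ n / 2 * exp (\<Lambda> * s)"
      by (rule step[OF U U]) (use Suc A0 in auto)
    thus ?case by (simp add: USuc)
  qed
  have "norm (U (Suc n) s - U n s) \<le> A * exp \<Lambda> * (1 / 2) ^ n" if s: "s \<in> {0..1}" for n s
  proof -
    have "A * (1/2) ^ n * exp (\<Lambda> * s) \<le> A * (1/2) ^ n * exp \<Lambda>"
      using A0 \<Lambda> s by (intro mult_left_mono) auto
    thus ?thesis using Ud[of s n] s by (simp add: mult_ac)
  qed
  then obtain u where lim: "uniform_limit {0..1} U u sequentially"
    using uniform_limit_geometric[of "{0..1}" U "A * exp \<Lambda>"] by blast
  have u: "continuous_on {0..1} u" using lim U by (intro uniform_limit_theorem[OF _ lim]) auto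
  have fixp: "T u s = u s" if s: "0 \<le> s" "s \<le> 1" for s
  proof (rule LIMSEQ_unique)
    show "(\<lambda>n. U (Suc n) s) \<longlonglongrightarrow> u s"
      using tendsto_uniform_limitI[OF lim, of s] s by (intro LIMSEQ_Suc) auto
    show "(\<lambda>n. U (Suc n) s) \<longlonglongrightarrow> T u s"
    proof (rule tendstoI)
      fix e :: real assume e: "e > 0"
      have "\<forall>\<^sub>F n in sequentially. \<forall>x\<in>{0..1}. dist (U n x) (u x) < e / exp \<Lambda>"
        using uniform_limitD[OF lim, of "e / exp \<Lambda>"] e by simp
      thus "\<forall>\<^sub>F n in sequentially. dist (U (Suc n) s) (T u s) < e"
      proof eventually_elim
        case (elim n)
        have "\<bar>T (U n) s - T u s\<bar> \<le> e / exp \<Lambda> / 2 * exp (\<Lambda> * s)"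
        proof (rule step[OF U u])
          fix x :: real assume x: "0 \<le> x" "x \<le> 1"
          have "e / exp \<Lambda> * 1 \<le> e / exp \<Lambda> * exp (\<Lambda> * x)" using e \<Lambda> x by (intro mult_left_mono) auto
          thus "\<bar>U n x - u x\<bar> \<le> e / exp \<Lambda> * exp (\<Lambda> * x)" using elim x by (force simp: dist_real_def)
        qed (use e s in auto)
        also have "\<dots> \<le> e / exp \<Lambda> / 2 * exp \<Lambda>" using e \<Lambda> s by (intro mult_left_mono) auto
        also have "\<dots> = e / 2" by simp
        finally show ?case using e by (simp add: USuc dist_real_def)
      qed
    qed
  qed
  show thesis
  proof (rule that[of u "Q u"])
    show "u 0 = c" using fixp[of 0] T0 by simp
    fix x :: real assume x: "0 < x" "x < 1"
    show "(u has_real_derivative k1 x * Q u x) (at x)"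
      by (rule has_field_derivative_transform_within_open[OF T'[OF u x], of "{0<..<1}"]) (use x fixp in auto)
    show "(Q u has_real_derivative - (k2 x * f (u x))) (at x)" by (rule Q'[OF u x])
  qed (use u Q Q0 in auto)
qed

section \<open>Holomorphic solutions near a regular singular point\<close>

text \<open>The inverse of the operator taking \<open>h\<close> to
  \<open>\<kappa> * s * h' + h\<close>: the monomial \<open>s ^ n\<close> is divided by
  \<open>\<kappa> * n + 1\<close>. Because the interval of integration is fixed, holomorphy in
  \<open>s\<close> follows by differentiation under the integral.\<close>

definition avg :: "real \<Rightarrow> (complex \<Rightarrow> complex) \<Rightarrow> complex \<Rightarrow> complex" where
  "avg \<kappa> h s = integral {0..1} (\<lambda>t. h (of_real (t powr \<kappa>) * s))"

lemma continuous_on_powr_const: "0 < \<kappa> \<Longrightarrow> continuous_on {0..1} (\<lambda>t::real. t powr \<kappa>)"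
  by (intro continuous_on_powr') (auto intro!: continuous_intros)

lemma scaled_in_ball:
  assumes "(s::complex) \<in> ball 0 r" "0 \<le> t" "t \<le> 1" "0 < \<kappa>"
  shows "of_real (t powr \<kappa>) * s \<in> ball 0 r"
proof -
  have "t powr \<kappa> \<le> 1" using assms by (simp add: powr_le1)
  hence "norm (of_real (t powr \<kappa>) * s) \<le> 1 * norm s"
    unfolding norm_mult by (intro mult_right_mono) auto
  thus ?thesis using assms by simp
qed

context
  fixes \<kappa> r :: real and h :: "complex \<Rightarrow> complex"
  assumes \<kappa>: "0 < \<kappa>" and h: "continuous_on (ball 0 r) h"
begin

lemma avg_integrand_continuous:
  "s \<in> ball 0 r \<Longrightarrow> continuous_on {0..1} (\<lambda>t. h (of_real (t powr \<kappa>) * s))"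
  by (rule continuous_on_compose2[OF h])
     (auto intro!: continuous_intros continuous_on_powr_const \<kappa> scaled_in_ball[where r = r] simp del: mem_ball)

lemma norm_avg_le:
  assumes "s \<in> ball 0 r" "\<And>s. s \<in> ball 0 r \<Longrightarrow> norm (h s) \<le> S"
  shows "norm (avg \<kappa> h s) \<le> S"
proof -
  have "norm (avg \<kappa> h s) \<le> S * (1 - 0)" unfolding avg_def
    using assms \<kappa> by (intro integral_bound avg_integrand_continuous) (auto intro!: assms(2) scaled_in_ball simp del: mem_ball)
  thus ?thesis by simp
qed

end

lemma avg_diff:
  assumes "0 < \<kappa>" "continuous_on (ball 0 r) h" "continuous_on (ball 0 r) k" "s \<in> ball 0 r"
  shows "avg \<kappa> h s - avg \<kappa> k s = avg \<kappa> (\<lambda>s. h s - k s) s"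
  unfolding avg_def using assms
  by (intro integral_diff[symmetric] integrable_continuous_real avg_integrand_continuous[where r = r])

lemma avg_cnj:
  assumes "\<And>s. s \<in> ball 0 r \<Longrightarrow> h (cnj s) = cnj (h s)" "0 < \<kappa>" "s \<in> ball 0 r"
  shows "avg \<kappa> h (cnj s) = cnj (avg \<kappa> h s)"
  unfolding avg_def integral_cnj
proof (rule integral_cong)
  fix t :: real assume "t \<in> {0..1}"
  hence "of_real (t powr \<kappa>) * s \<in> ball 0 r" using assms by (intro scaled_in_ball) auto
  from assms(1)[OF this] show "h (of_real (t powr \<kappa>) * cnj s) = cnj (h (of_real (t powr \<kappa>) * s))" by simp
qed

text \<open>The identity comes from integrating the \<open>t\<close>-derivative of
  \<open>t * h (t powr \<kappa> * s)\<close> over \<open>{0..1}\<close>.\<close>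

lemma avg_ode:
  assumes \<kappa>: "0 < \<kappa>" and h: "h holomorphic_on ball 0 r"
  shows "avg \<kappa> h holomorphic_on ball 0 r"
    and "s \<in> ball 0 r \<Longrightarrow> of_real \<kappa> * s * deriv (avg \<kappa> h) s + avg \<kappa> h s = h s"
proof -
  define f where "f s t = h (of_real (t powr \<kappa>) * s)" for s t
  define fx where "fx s t = of_real (t powr \<kappa>) * deriv h (of_real (t powr \<kappa>) * s)" for s t
  note hc = holomorphic_on_imp_continuous_on[OF h]
  have h': "(h has_field_derivative deriv h s) (at s)" if "s \<in> ball 0 r" for s :: complex
    using h that by (simp add: holomorphic_derivI)
  have dhc: "continuous_on (ball 0 r) (deriv h)"
    by (intro holomorphic_on_imp_continuous_on holomorphic_deriv h) auto
  have int: "f s integrable_on cbox 0 1" if "s \<in> ball 0 r" for s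
    unfolding f_def[abs_def] cbox_interval by (intro integrable_continuous_real avg_integrand_continuous[OF \<kappa> hc] that)
  have D: "(avg \<kappa> h has_field_derivative integral (cbox 0 1) (fx s)) (at s)" if s: "s \<in> ball 0 r" for s
  proof -
    have "((\<lambda>s. integral (cbox 0 1) (f s)) has_field_derivative integral (cbox 0 1) (fx s)) (at s within ball 0 r)"
    proof (rule leibniz_rule_field_derivative[OF _ int])
      fix s :: complex and t :: real assume s: "s \<in> ball 0 r" and t: "t \<in> cbox 0 (1::real)"
      hence "of_real (t powr \<kappa>) * s \<in> ball 0 r" using \<kappa> by (intro scaled_in_ball) auto
      from DERIV_chain2[where f = h and g = "\<lambda>s. of_real (t powr \<kappa>) * s" and x = s, OF h'[OF this] DERIV_cmult_Id]
      have "((\<lambda>s. f s t) has_field_derivative fx s t) (at s)"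
        unfolding f_def fx_def by (simp add: mult.commute)
      thus "((\<lambda>s. f s t) has_field_derivative fx s t) (at s within ball 0 r)"
        by (rule has_field_derivative_at_within)
    next
      have c: "continuous_on (ball 0 r \<times> cbox 0 1) (\<lambda>x. complex_of_real (snd x powr \<kappa>) * fst x)"
        by (intro continuous_intros continuous_on_compose2[OF continuous_on_powr_const[OF \<kappa>]]) auto
      have c2: "continuous_on (ball 0 r \<times> cbox 0 1) (\<lambda>x. complex_of_real (snd x powr \<kappa>))"
        by (intro continuous_intros continuous_on_compose2[OF continuous_on_powr_const[OF \<kappa>]]) auto
      show "continuous_on (ball 0 r \<times> cbox 0 1) (\<lambda>(s, t). fx s t)"
        unfolding fx_def split_beta using \<kappa>
        by (intro continuous_on_mult c2 continuous_on_compose2[OF dhc c])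
           (auto intro!: scaled_in_ball simp del: mem_ball)
    qed (use s in auto)
    thus ?thesis using s at_within_open[of s "ball 0 r"]
      by (simp add: avg_def[abs_def] f_def[abs_def] cbox_interval)
  qed
  show "avg \<kappa> h holomorphic_on ball 0 r"
    using D by (subst holomorphic_on_open) blast+
  assume s: "s \<in> ball 0 r"
  have "((\<lambda>t. f s t + of_real \<kappa> * s * fx s t) has_integral (of_real 1 * f s 1 - of_real 0 * f s 0)) {0..1}"
  proof (rule fundamental_theorem_of_calculus_interior)
    show "continuous_on {0..1} (\<lambda>t. complex_of_real t * f s t)"
      unfolding f_def by (intro continuous_intros avg_integrand_continuous[OF \<kappa> hc s])
    fix t :: real assume t: "t \<in> {0<..<1}"
    have in_b: "of_real (t powr \<kappa>) * s \<in> ball 0 r" using t \<kappa> s by (intro scaled_in_ball) auto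
    have "((\<lambda>t. t powr \<kappa>) has_real_derivative \<kappa> * t powr (\<kappa> - 1)) (at t)"
      using t by (auto intro!: derivative_eq_intros)
    hence "((\<lambda>t. of_real (t powr \<kappa>) * s) has_vector_derivative of_real (\<kappa> * t powr (\<kappa> - 1)) * s) (at t)"
      by (intro has_vector_derivative_mult_left has_vector_derivative_of_real)
    from field_vector_diff_chain_at[where g = h and f = "\<lambda>t. of_real (t powr \<kappa>) * s" and x = t, OF this h'[OF in_b]]
    have "((\<lambda>t. f s t) has_vector_derivative of_real (\<kappa> * t powr (\<kappa> - 1)) * s * deriv h (of_real (t powr \<kappa>) * s)) (at t)"
      by (simp add: f_def[abs_def] o_def)
    from has_vector_derivative_mult[OF has_vector_derivative_of_real[OF DERIV_ident] this]
    have "((\<lambda>t. of_real t * f s t) has_vector_derivative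
       of_real t * (of_real (\<kappa> * t powr (\<kappa> - 1)) * s * deriv h (of_real (t powr \<kappa>) * s)) + f s t) (at t)"
      by simp
    also have "of_real t * (of_real (\<kappa> * t powr (\<kappa> - 1)) * s * deriv h (of_real (t powr \<kappa>) * s)) + f s t
       = f s t + of_real \<kappa> * s * fx s t"
      using t by (simp add: fx_def powr_diff field_simps)
    finally show "((\<lambda>t. of_real t * f s t) has_vector_derivative f s t + of_real \<kappa> * s * fx s t) (at t)" .
  qed auto
  hence "h s = integral {0..1} (\<lambda>t. f s t + of_real \<kappa> * s * fx s t)"
    by (simp add: f_def integral_unique)
  also have "\<dots> = avg \<kappa> h s + of_real \<kappa> * s * integral {0..1} (fx s)"
  proof -
    have "continuous_on {0..1} (fx s)" unfolding fx_def
      using \<kappa> by (intro continuous_intros continuous_on_powr_const avg_integrand_continuous[OF \<kappa> dhc s])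
    thus ?thesis unfolding avg_def
      using int[OF s] by (subst integral_add) (auto simp: f_def[abs_def] intro!: integrable_continuous_real continuous_intros)
  qed
  finally show "of_real \<kappa> * s * deriv (avg \<kappa> h) s + avg \<kappa> h s = h s"
    using DERIV_imp_deriv[OF D[OF s]] by (simp add: add.commute)
qed

lemma holomorphic_bounded_half_ball:
  fixes f :: "complex \<Rightarrow> complex"
  assumes "f holomorphic_on ball a r" "0 < r"
  obtains B where "1 \<le> B" "\<And>x. x \<in> cball a (r / 2) \<Longrightarrow> norm (f x) \<le> B"
proof -
  have "continuous_on (cball a (r / 2)) f"
    by (rule continuous_on_subset[OF holomorphic_on_imp_continuous_on[OF assms(1)]]) (use assms in auto)
  hence "bounded (f ` cball a (r / 2))"
    by (intro compact_imp_bounded compact_continuous_image) auto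
  then obtain B where "\<forall>x\<in>f ` cball a (r / 2). norm x \<le> B" unfolding bounded_iff by blast
  thus thesis by (intro that[of "max 1 B"]) (auto simp: le_max_iff_disj)
qed

text \<open>As \<open>0 < \<mu>\<close>, the operator \<open>s z' + \<mu> z\<close> is inverted by
  \<open>avg\<close> with \<open>\<kappa> = 1 / \<mu>\<close>, and the system becomes a contraction
  in the supremum norm on a small disc; the factor \<open>s\<close> beside \<open>D\<close> makes
  that term small. Conjugation symmetry is carried along to make the solution real on the real axis.
  The triple \<open>j\<close>, \<open>y0\<close>, \<open>\<mu>\<close> is \<open>1\<close>,
  \<open>0\<close>, \<open>N\<close> at the centre, \<open>1\<close>, arbitrary, \<open>1\<close> at
  a regular point, and \<open>0\<close>, \<open>0\<close>, \<open>m\<close> at the point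
  \<open>1\<close>.\<close>

lemma fuchs_local:
  fixes A B C D g :: "complex \<Rightarrow> complex" and u0 y0 :: complex and \<mu> r0 :: real and j :: nat
  assumes r0: "0 < r0" and \<mu>: "0 < \<mu>"
    and hol: "A holomorphic_on ball 0 r0" "B holomorphic_on ball 0 r0" "C holomorphic_on ball 0 r0"
      "D holomorphic_on ball 0 r0" "g holomorphic_on ball u0 r0"
    and sym: "\<And>s. s \<in> ball 0 r0 \<Longrightarrow> A (cnj s) = cnj (A s)" "\<And>s. s \<in> ball 0 r0 \<Longrightarrow> B (cnj s) = cnj (B s)"
      "\<And>s. s \<in> ball 0 r0 \<Longrightarrow> C (cnj s) = cnj (C s)" "\<And>s. s \<in> ball 0 r0 \<Longrightarrow> D (cnj s) = cnj (D s)"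
      "\<And>w. w \<in> ball u0 r0 \<Longrightarrow> g (cnj w) = cnj (g w)" "cnj u0 = u0" "cnj y0 = y0"
  obtains r u z where "0 < r" "r \<le> r0" "u holomorphic_on ball 0 r" "z holomorphic_on ball 0 r" "u 0 = u0"
    "\<And>s. s \<in> ball 0 r \<Longrightarrow> u s \<in> ball u0 r0"
    "\<And>s. s \<in> ball 0 r \<Longrightarrow> (u has_field_derivative y0 + s ^ j * z s) (at s)"
    "\<And>s. s \<in> ball 0 r \<Longrightarrow>
       s * deriv z s + of_real \<mu> * z s = A s * u s + B s * g (u s) + C s + D s * (s * z s)"
    "\<And>s. s \<in> ball 0 r \<Longrightarrow> u (cnj s) = cnj (u s)" "\<And>s. s \<in> ball 0 r \<Longrightarrow> z (cnj s) = cnj (z s)"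
proof -
  define R where "R = r0 / 2"
  have R: "0 < R" "R < r0" using r0 by (auto simp: R_def)
  have dg: "deriv g holomorphic_on ball u0 r0" by (intro holomorphic_deriv hol) auto
  obtain BA where BA: "1 \<le> BA" "\<And>x. x \<in> cball 0 R \<Longrightarrow> norm (A x) \<le> BA"
    using holomorphic_bounded_half_ball[OF hol(1) r0] unfolding R_def by blast
  obtain BB where BB: "1 \<le> BB" "\<And>x. x \<in> cball 0 R \<Longrightarrow> norm (B x) \<le> BB"
    using holomorphic_bounded_half_ball[OF hol(2) r0] unfolding R_def by blast
  obtain BC where BC: "1 \<le> BC" "\<And>x. x \<in> cball 0 R \<Longrightarrow> norm (C x) \<le> BC"
    using holomorphic_bounded_half_ball[OF hol(3) r0] unfolding R_def by blast
  obtain BD where BD: "1 \<le> BD" "\<And>x. x \<in> cball 0 R \<Longrightarrow> norm (D x) \<le> BD"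
    using holomorphic_bounded_half_ball[OF hol(4) r0] unfolding R_def by blast
  obtain Bg where Bg: "1 \<le> Bg" "\<And>x. x \<in> cball u0 R \<Longrightarrow> norm (g x) \<le> Bg"
    using holomorphic_bounded_half_ball[OF hol(5) r0] unfolding R_def by blast
  obtain Lg where Lg: "1 \<le> Lg" "\<And>x. x \<in> cball u0 R \<Longrightarrow> norm (deriv g x) \<le> Lg"
    using holomorphic_bounded_half_ball[OF dg r0] unfolding R_def by blast
  define \<kappa> where "\<kappa> = 1 / \<mu>"
  have \<kappa>: "0 < \<kappa>" using \<mu> by (simp add: \<kappa>_def)
  define U where "U = norm u0 + R"
  have U: "0 < U" using R by (simp add: U_def add_nonneg_pos)
  define M where "M = \<kappa> * (BA * U + BB * Bg + BC + BD)"
  have M: "0 < M" unfolding M_def using \<kappa> U BA(1) BB(1) BC(1) BD(1) Bg(1)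
    by (intro mult_pos_pos add_pos_pos) auto
  define Q where "Q = \<kappa> * (BA + BB * Lg + BD)"
  have Q: "0 < Q" unfolding Q_def using \<kappa> BA(1) BB(1) BD(1) Lg(1)
    by (intro mult_pos_pos add_pos_pos) auto
  \<comment> \<open>The entries ensure in turn that the bounds on the half disc apply, that
    \<open>s ^ j\<close> has norm at most \<open>1\<close>, that the \<open>D\<close> term is at
    most \<open>BD\<close>, that \<open>I z\<close> stays in \<open>cball u0 R\<close>, and that
    \<open>T\<close> contracts by \<open>1/2\<close>.\<close>
  define r where "r = Min {R, 1, 1 / M, R / (norm y0 + M), 1 / (2 * Q)}"
  have yM: "0 < norm y0 + M" using M by (simp add: add_nonneg_pos)
  have r: "0 < r" using R M Q yM by (simp add: r_def)
  have rb: "r \<le> R" "r \<le> 1" "r \<le> 1 / M" "r \<le> R / (norm y0 + M)" "r \<le> 1 / (2 * Q)"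
    unfolding r_def by (rule Min_le; simp)+
  have rM: "r * M \<le> 1" using rb(3) M by (simp add: field_simps)
  have ry: "r * (norm y0 + M) \<le> R" using rb(4) yM by (simp add: field_simps)
  have rQ: "r * Q \<le> 1 / 2" using rb(5) Q by (simp add: field_simps)
  have sub: "ball (0::complex) r \<subseteq> ball 0 r0" using rb(1) R by auto
  have cR: "s \<in> cball 0 R" if "s \<in> ball 0 r" for s :: complex using that rb(1) by auto
  have pj: "norm (s ^ j) \<le> 1" if "s \<in> ball 0 r" for s :: complex
    unfolding norm_power using that rb(2) by (intro power_le_one) auto
  \<comment> \<open>\<open>s * avg 1 h s\<close> is the primitive of \<open>h\<close> vanishing at
    \<open>0\<close>, so \<open>I z\<close> is the function \<open>u\<close> that belongs to
    \<open>z\<close>.\<close>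
  define I where "I z s = u0 + s * avg 1 (\<lambda>\<sigma>. y0 + \<sigma> ^ j * z \<sigma>) s" for z s
  define \<Phi> where "\<Phi> z s = A s * I z s + B s * g (I z s) + C s + D s * (s * z s)" for z s
  define T where "T z s = of_real \<kappa> * avg \<kappa> (\<Phi> z) s" for z s
  \<comment> \<open>The class is preserved by \<open>T\<close> and closed under uniform limits on
    the disc, so the fixed point lies in it.\<close>
  define G where "G z \<longleftrightarrow> z holomorphic_on ball 0 r \<and> (\<forall>s\<in>ball 0 r. norm (z s) \<le> M)
      \<and> (\<forall>s\<in>ball 0 r. z (cnj s) = cnj (z s))" for z
  have hI: "(\<lambda>\<sigma>. y0 + \<sigma> ^ j * z \<sigma>) holomorphic_on ball 0 r" if "G z" for z
    using that unfolding G_def by (auto intro!: holomorphic_intros)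
  have I': "(I z has_field_derivative y0 + s ^ j * z s) (at s)" if "G z" "s \<in> ball 0 r" for z s
  proof -
    note a = avg_ode[OF zero_less_one hI[OF that(1)]]
    have "(I z has_field_derivative (0 + (s * deriv (avg 1 (\<lambda>\<sigma>. y0 + \<sigma> ^ j * z \<sigma>)) s
        + 1 * avg 1 (\<lambda>\<sigma>. y0 + \<sigma> ^ j * z \<sigma>) s))) (at s)"
      unfolding I_def[abs_def] using a(1) that
      by (intro DERIV_add DERIV_const DERIV_mult' DERIV_ident holomorphic_derivI[of _ "ball 0 r"]) auto
    thus ?thesis using a(2)[OF that(2)] by simp
  qed
  have holI: "I z holomorphic_on ball 0 r" if "G z" for z
    using I'[OF that] by (subst holomorphic_on_open) blast+
  have I0: "I z 0 = u0" for z by (simp add: I_def)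
  have Ib: "I z s \<in> cball u0 R" if z: "G z" and s: "s \<in> ball 0 r" for z s
  proof -
    have "norm (avg 1 (\<lambda>\<sigma>. y0 + \<sigma> ^ j * z \<sigma>) s) \<le> norm y0 + M"
    proof (rule norm_avg_le[OF _ holomorphic_on_imp_continuous_on[OF hI[OF z]] s])
      fix s :: complex assume s: "s \<in> ball 0 r"
      have "norm (s ^ j * z s) \<le> 1 * M" unfolding norm_mult
        using s z pj[OF s] M by (intro mult_mono) (auto simp: G_def)
      thus "norm (y0 + s ^ j * z s) \<le> norm y0 + M" using norm_triangle_ineq[of y0 "s ^ j * z s"] by linarith
    qed simp
    hence "norm (s * avg 1 (\<lambda>\<sigma>. y0 + \<sigma> ^ j * z \<sigma>) s) \<le> r * (norm y0 + M)"
      unfolding norm_mult using s r by (intro mult_mono) auto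
    with ry show ?thesis by (simp add: I_def dist_norm)
  qed
  have Ib': "I z s \<in> ball u0 r0" if "G z" "s \<in> ball 0 r" for z s
    using Ib[OF that] R by auto
  have holg: "(\<lambda>s. g (I z s)) holomorphic_on ball 0 r" if z: "G z" for z
  proof -
    have "I z ` ball 0 r \<subseteq> ball u0 r0" using Ib'[OF z] by blast
    from holomorphic_on_compose_gen[OF holI[OF z] hol(5) this] show ?thesis by (simp add: o_def)
  qed
  have hol\<Phi>: "\<Phi> z holomorphic_on ball 0 r" if z: "G z" for z
    unfolding \<Phi>_def[abs_def] using z
    by (intro holomorphic_intros holomorphic_on_subset[OF hol(1) sub] holomorphic_on_subset[OF hol(2) sub]
      holomorphic_on_subset[OF hol(3) sub] holomorphic_on_subset[OF hol(4) sub] holI holg z) (simp add: G_def)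
  have T_ode: "s * deriv (T z) s + of_real \<mu> * T z s = \<Phi> z s" and holT: "T z holomorphic_on ball 0 r"
    if z: "G z" and s: "s \<in> ball 0 r" for z s
  proof -
    note a = avg_ode[OF \<kappa> hol\<Phi>[OF z]]
    show "T z holomorphic_on ball 0 r" unfolding T_def[abs_def] by (intro holomorphic_intros a(1))
    have "(avg \<kappa> (\<Phi> z) has_field_derivative deriv (avg \<kappa> (\<Phi> z)) s) (at s)"
      using a(1) s by (intro holomorphic_derivI[of _ "ball 0 r"]) auto
    hence d: "deriv (T z) s = of_real \<kappa> * deriv (avg \<kappa> (\<Phi> z)) s"
      unfolding T_def[abs_def] by (intro DERIV_imp_deriv DERIV_cmult)
    have e: "of_real \<mu> * T z s = avg \<kappa> (\<Phi> z) s" using \<mu> by (simp add: T_def \<kappa>_def)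
    show "s * deriv (T z) s + of_real \<mu> * T z s = \<Phi> z s"
      using a(2)[OF s] d e by (simp add: mult_ac)
  qed
  have \<Phi>b: "norm (\<Phi> z s) \<le> BA * U + BB * Bg + BC + BD" if z: "G z" and s: "s \<in> ball 0 r" for z s
  proof -
    have "norm (I z s) \<le> U"
      using Ib[OF z s] norm_triangle_ineq2[of "I z s" u0] by (simp add: U_def dist_norm norm_minus_commute)
    hence 1: "norm (A s * I z s) \<le> BA * U"
      unfolding norm_mult using BA cR[OF s] U by (intro mult_mono) auto
    have 2: "norm (B s * g (I z s)) \<le> BB * Bg"
      unfolding norm_mult using BB Bg cR[OF s] Ib[OF z s] by (intro mult_mono) auto
    have "norm (s * z s) \<le> r * M" unfolding norm_mult using s z r by (intro mult_mono) (auto simp: G_def)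
    hence 3: "norm (D s * (s * z s)) \<le> BD * 1"
      using rM BD cR[OF s] by (subst norm_mult, intro mult_mono) (auto intro: order_trans)
    show ?thesis unfolding \<Phi>_def
      by (intro norm_triangle_mono 1 2 BC(2) cR s) (use 3 in simp)
  qed
  have GT: "G (T z)" if z: "G z" for z
    unfolding G_def
  proof (intro conjI ballI)
    show "T z holomorphic_on ball 0 r" using holT[OF z, of 0] r by simp
    fix s :: complex assume s: "s \<in> ball 0 r"
    have "norm (avg \<kappa> (\<Phi> z) s) \<le> BA * U + BB * Bg + BC + BD"
      by (rule norm_avg_le[OF \<kappa> holomorphic_on_imp_continuous_on[OF hol\<Phi>[OF z]] s]) (use \<Phi>b[OF z] in auto)
    thus "norm (T z s) \<le> M" unfolding T_def M_def norm_mult using \<kappa> by (intro mult_mono) auto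
    have zs: "z (cnj s) = cnj (z s)" if "s \<in> ball 0 r" for s using z that by (simp add: G_def)
    have Is: "I z (cnj s) = cnj (I z s)" if "s \<in> ball 0 r" for s
      using avg_cnj[of r "\<lambda>\<sigma>. y0 + \<sigma> ^ j * z \<sigma>" 1 s] that zs by (simp add: I_def sym)
    have "\<Phi> z (cnj s) = cnj (\<Phi> z s)" if s: "s \<in> ball 0 r" for s
      using sym(1-4)[of s] sym(5)[OF Ib'[OF z s]] zs[OF s] Is[OF s] subsetD[OF sub s] by (simp add: \<Phi>_def)
    from avg_cnj[of r "\<Phi> z" \<kappa> s, OF this \<kappa> s] show "T z (cnj s) = cnj (T z s)" by (simp add: T_def)
  qed
  have contr: "norm (T z s - T w s) \<le> S / 2"
    if z: "G z" and w: "G w" and zw: "\<And>s. s \<in> ball 0 r \<Longrightarrow> norm (z s - w s) \<le> S"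
      and s: "s \<in> ball 0 r" for z w S s
  proof -
    have S0: "0 \<le> S" using zw[OF s] by (rule order_trans[OF norm_ge_zero])
    have Id: "norm (I z s - I w s) \<le> r * S" if s: "s \<in> ball 0 r" for s
    proof -
      have "norm (avg 1 (\<lambda>s. (y0 + s ^ j * z s) - (y0 + s ^ j * w s)) s) \<le> S"
      proof (rule norm_avg_le[OF _ _ s])
        show "continuous_on (ball 0 r) (\<lambda>s. y0 + s ^ j * z s - (y0 + s ^ j * w s))"
          by (intro holomorphic_on_imp_continuous_on holomorphic_on_diff hI z w)
        fix s :: complex assume s: "s \<in> ball 0 r"
        have "norm (s ^ j * (z s - w s)) \<le> 1 * S"
          unfolding norm_mult using s pj[OF s] zw[OF s] by (intro mult_mono) auto
        thus "norm (y0 + s ^ j * z s - (y0 + s ^ j * w s)) \<le> S" by (simp add: algebra_simps)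
      qed simp
      also have "avg 1 (\<lambda>s. (y0 + s ^ j * z s) - (y0 + s ^ j * w s)) s
         = avg 1 (\<lambda>s. y0 + s ^ j * z s) s - avg 1 (\<lambda>s. y0 + s ^ j * w s) s"
        by (intro avg_diff[symmetric, where r = r] holomorphic_on_imp_continuous_on hI z w s) simp
      finally have "norm (s * (avg 1 (\<lambda>s. y0 + s ^ j * z s) s - avg 1 (\<lambda>s. y0 + s ^ j * w s) s)) \<le> r * S"
        unfolding norm_mult using s r by (intro mult_mono) auto
      thus ?thesis by (simp add: I_def algebra_simps)
    qed
    have gd: "norm (g (I z s) - g (I w s)) \<le> Lg * (r * S)" if s: "s \<in> ball 0 r" for s
    proof -
      have "norm (g (I z s) - g (I w s)) \<le> Lg * norm (I z s - I w s)"
      proof (rule field_differentiable_bound[OF convex_cball[of u0 R]])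
        fix x assume x: "x \<in> cball u0 R"
        hence "x \<in> ball u0 r0" using R by simp
        thus "(g has_field_derivative deriv g x) (at x within cball u0 R)"
          by (rule holomorphic_derivI[OF hol(5) open_ball])
        show "norm (deriv g x) \<le> Lg" by (rule Lg(2)[OF x])
      qed (rule Ib[OF z s] Ib[OF w s])+
      also have "\<dots> \<le> Lg * (r * S)" using Id[OF s] Lg by (intro mult_left_mono) auto
      finally show ?thesis .
    qed
    have \<Phi>d: "norm (\<Phi> z s - \<Phi> w s) \<le> (BA + BB * Lg + BD) * (r * S)" if s: "s \<in> ball 0 r" for s
    proof -
      have 1: "norm (A s * (I z s - I w s)) \<le> BA * (r * S)"
        unfolding norm_mult using BA cR[OF s] Id[OF s] by (intro mult_mono) auto
      have 2: "norm (B s * (g (I z s) - g (I w s))) \<le> BB * (Lg * (r * S))"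
        unfolding norm_mult using BB cR[OF s] gd[OF s] by (intro mult_mono) auto
      have "norm (s * (z s - w s)) \<le> r * S"
        unfolding norm_mult using s zw[OF s] r by (intro mult_mono) auto
      hence 3: "norm (D s * (s * (z s - w s))) \<le> BD * (r * S)"
        using BD cR[OF s] by (subst norm_mult, intro mult_mono) auto
      have "\<Phi> z s - \<Phi> w s = A s * (I z s - I w s) + B s * (g (I z s) - g (I w s)) + D s * (s * (z s - w s))"
        by (simp add: \<Phi>_def algebra_simps)
      also have "norm \<dots> \<le> BA * (r * S) + BB * (Lg * (r * S)) + BD * (r * S)"
        by (intro norm_triangle_mono 1 2 3)
      finally show ?thesis by (simp add: algebra_simps)
    qed
    have "norm (avg \<kappa> (\<lambda>s. \<Phi> z s - \<Phi> w s) s) \<le> (BA + BB * Lg + BD) * (r * S)"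
      by (rule norm_avg_le[OF \<kappa> _ s]) (use \<Phi>d in \<open>auto intro!: holomorphic_on_imp_continuous_on holomorphic_intros hol\<Phi> z w\<close>)
    also have "avg \<kappa> (\<lambda>s. \<Phi> z s - \<Phi> w s) s = avg \<kappa> (\<Phi> z) s - avg \<kappa> (\<Phi> w) s"
      by (intro avg_diff[symmetric, where r = r] \<kappa> holomorphic_on_imp_continuous_on hol\<Phi> z w s)
    finally have "norm (of_real \<kappa> * (avg \<kappa> (\<Phi> z) s - avg \<kappa> (\<Phi> w) s)) \<le> \<kappa> * ((BA + BB * Lg + BD) * (r * S))"
      unfolding norm_mult using \<kappa> by (intro mult_mono) auto
    also have "\<dots> = (r * Q) * S" by (simp add: Q_def)
    also have "\<dots> \<le> 1 / 2 * S" using rQ S0 by (intro mult_right_mono)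
    finally show ?thesis by (simp add: T_def algebra_simps)
  qed
  define Z where "Z n = (T ^^ n) (\<lambda>_. 0)" for n
  have GZ: "G (Z n)" for n
    by (induction n) (use M GT in \<open>auto simp: Z_def G_def[of "\<lambda>_. 0"]\<close>)
  have ZSuc: "Z (Suc n) = T (Z n)" for n by (simp add: Z_def)
  have Zd: "norm (Z (Suc n) s - Z n s) \<le> M * (1 / 2) ^ n" if "s \<in> ball 0 r" for n s
    using that
  proof (induction n arbitrary: s)
    case 0
    thus ?case using GZ[of 1] by (simp add: G_def Z_def)
  next
    case (Suc n)
    have "norm (T (Z (Suc n)) s - T (Z n) s) \<le> M * (1 / 2) ^ n / 2"
      by (rule contr[OF GZ GZ]) (use Suc in auto)
    thus ?case by (simp add: ZSuc)
  qed
  obtain z where lim: "uniform_limit (ball 0 r) Z z sequentially"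
    using uniform_limit_geometric[of "ball 0 r" Z M] Zd by blast
  have limp: "(\<lambda>n. Z n s) \<longlonglongrightarrow> z s" if "s \<in> ball 0 r" for s
    by (rule tendsto_uniform_limitI[OF lim that])
  have Gz: "G z"
    unfolding G_def
  proof (intro conjI ballI)
    show "z holomorphic_on ball 0 r"
    proof (rule holomorphic_uniform_sequence)
      fix x :: complex assume "x \<in> ball 0 r"
      then obtain d where "d > 0" "cball x d \<subseteq> ball 0 r" using open_contains_cball_eq[OF open_ball, of 0 r] by blast
      thus "\<exists>d>0. cball x d \<subseteq> ball 0 r \<and> uniform_limit (cball x d) Z z sequentially"
        using uniform_limit_on_subset[OF lim] by blast
    qed (use GZ in \<open>auto simp: G_def\<close>)
    fix s :: complex assume s: "s \<in> ball 0 r"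
    show "norm (z s) \<le> M"
      by (rule Lim_bounded[OF tendsto_norm[OF limp[OF s]], of 0]) (use GZ s in \<open>auto simp: G_def\<close>)
    have "(\<lambda>n. cnj (Z n s)) \<longlonglongrightarrow> z (cnj s)"
      using limp[of "cnj s"] GZ s by (simp add: G_def)
    thus "z (cnj s) = cnj (z s)" using LIMSEQ_unique tendsto_cnj[OF limp[OF s]] by blast
  qed
  have fixp: "T z s = z s" if s: "s \<in> ball 0 r" for s
  proof (rule LIMSEQ_unique)
    show "(\<lambda>n. Z (Suc n) s) \<longlonglongrightarrow> z s" by (rule LIMSEQ_Suc[OF limp[OF s]])
    show "(\<lambda>n. Z (Suc n) s) \<longlonglongrightarrow> T z s"
    proof (rule tendstoI)
      fix e :: real assume e: "e > 0"
      have "\<forall>\<^sub>F n in sequentially. \<forall>x\<in>ball 0 r. dist (Z n x) (z x) < e"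
        using uniform_limitD[OF lim e] .
      thus "\<forall>\<^sub>F n in sequentially. dist (Z (Suc n) s) (T z s) < e"
      proof eventually_elim
        case (elim n)
        have "norm (T (Z n) s - T z s) \<le> e / 2"
          by (rule contr[OF GZ Gz _ s]) (use elim in \<open>auto simp: dist_norm intro: less_imp_le\<close>)
        thus ?case using e by (simp add: ZSuc dist_norm)
      qed
    qed
  qed
  show thesis
  proof (rule that[of r "I z" z])
    fix s :: complex assume s: "s \<in> ball 0 r"
    have "deriv (T z) s = deriv z s"
      using s fixp by (intro deriv_cong_ev) (auto intro!: eventually_nhds[THEN iffD2] exI[of _ "ball 0 r"])
    thus "s * deriv z s + of_real \<mu> * z s = A s * I z s + B s * g (I z s) + C s + D s * (s * z s)"
      using T_ode[OF Gz s] fixp[OF s] by (simp add: \<Phi>_def)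
    show "I z s \<in> ball u0 r0" by (rule Ib'[OF Gz s])
    show "(I z has_field_derivative y0 + s ^ j * z s) (at s)" by (rule I'[OF Gz s])
    show "z (cnj s) = cnj (z s)" using Gz s by (simp add: G_def)
    show "I z (cnj s) = cnj (I z s)"
      using avg_cnj[of r "\<lambda>\<sigma>. y0 + \<sigma> ^ j * z \<sigma>" 1 s] Gz s by (simp add: I_def sym G_def)
  qed (use r rb R holI Gz I0 in \<open>auto simp: G_def\<close>)
qed

section \<open>The equation on the unit interval\<close>

locale wave =
  fixes N :: nat and p :: real
  assumes N: "N \<ge> 3"
    and p_lower: "p > 1 + 4 / (real N - 2)"
    and p_upper: "N \<ge> 4 \<Longrightarrow> p < 1 + 4 / (real N - 3)"
begin

abbreviation \<alpha> :: real where "\<alpha> \<equiv> alpha p"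

definition m :: real where "m = \<alpha> + 1 - (real N - 1) / 2"
text \<open>Equal to \<open>1 - 2 * m\<close>; the friction coefficient in the equation for
  \<open>w\<close>.\<close>

definition \<delta> :: real where "\<delta> = real N - 2 - 2 * \<alpha>"
definition lam :: real where "lam = \<alpha> * (\<alpha> + 1)"
text \<open>Equal to \<open>b_inf N p powr (p - 1)\<close>; the linear coefficient in the equation
  for \<open>w\<close>.\<close>

definition \<beta> :: real where "\<beta> = \<alpha> * (real N - 2 - \<alpha>)"
text \<open>\<open>P1\<close> is the integrating factor that brings the equation, divided by
  \<open>1 - x\<^sup>2\<close>, to the divergence form
  \<open>(P1 u')' + P2 (u powr p - lam u) = 0\<close>.\<close>

definition P1 :: "real \<Rightarrow> real" where "P1 x = x ^ (N - 1) * (1 - x\<^sup>2) powr m"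
definition P2 :: "real \<Rightarrow> real" where "P2 x = x ^ (N - 1) * (1 - x\<^sup>2) powr (m - 1)"

lemma p_gt_1: "1 < p"
proof -
  have "0 < 4 / (real N - 2)" using N by simp
  thus ?thesis using p_lower by linarith
qed

lemma alpha_pos: "0 < \<alpha>" using p_gt_1 by (simp add: alpha_def)

lemma alpha_p: "\<alpha> * (p - 1) = 2" using p_gt_1 by (simp add: alpha_def field_simps)

lemma alpha_upper: "2 * \<alpha> < real N - 2"
proof -
  have "4 < (p - 1) * (real N - 2)" using p_lower N by (simp add: field_simps)
  hence "\<alpha> * 4 < \<alpha> * ((p - 1) * (real N - 2))" using alpha_pos by (intro mult_strict_left_mono)
  also have "\<dots> = 2 * (real N - 2)" using alpha_p by (simp add: mult.assoc[symmetric])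
  finally show ?thesis by simp
qed

lemma alpha_lower: "real N - 3 < 2 * \<alpha>"
proof (cases "N \<ge> 4")
  case True
  have "(p - 1) * (real N - 3) < 4" using p_upper True by (simp add: field_simps)
  hence "\<alpha> * ((p - 1) * (real N - 3)) < \<alpha> * 4" using alpha_pos by (intro mult_strict_left_mono)
  moreover have "\<alpha> * ((p - 1) * (real N - 3)) = 2 * (real N - 3)" using alpha_p by (simp add: mult.assoc[symmetric])
  ultimately show ?thesis by simp
next
  \<comment> \<open>Now \<open>N = 3\<close>, and the claim reduces to
    \<open>0 < \<alpha>\<close>.\<close>
  case False
  thus ?thesis using N alpha_pos by simp
qed

lemma m_bounds: "0 < m" "m < 1 / 2"
  using alpha_lower alpha_upper by (simp_all add: m_def field_simps)

lemma delta_eq: "\<delta> = 1 - 2 * m" by (simp add: \<delta>_def m_def field_simps)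

lemma delta_bounds: "0 < \<delta>" "\<delta> < 1" using m_bounds by (simp_all add: delta_eq)

lemma beta_pos: "0 < \<beta>"
  unfolding \<beta>_def using alpha_pos alpha_upper by (intro mult_pos_pos) auto

lemma lam_pos: "0 < lam" unfolding lam_def using alpha_pos by simp

lemma one_minus_square_pos: "0 \<le> x \<Longrightarrow> x < 1 \<Longrightarrow> 0 < 1 - (x::real)\<^sup>2"
  using power_strict_mono[of x 1 2] by simp

lemma P1_pos: "0 < x \<Longrightarrow> x < 1 \<Longrightarrow> 0 < P1 x"
  unfolding P1_def using one_minus_square_pos[of x] by (intro mult_pos_pos) auto

lemma P2_nonneg: "0 \<le> x \<Longrightarrow> 0 \<le> P2 x"
  by (simp add: P2_def)

lemma P2_eq: "0 < x \<Longrightarrow> x < 1 \<Longrightarrow> P2 x = P1 x / (1 - x\<^sup>2)"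
  using one_minus_square_pos[of x] by (simp add: P1_def P2_def powr_diff)

lemma powr_le_1_nonpos: "1 \<le> x \<Longrightarrow> a \<le> 0 \<Longrightarrow> x powr a \<le> (1::real)"
  using powr_mono[of a 0 x] by simp

lemma P2_le: assumes "0 \<le> x" "x < 1" shows "P2 x \<le> x ^ (N - 1) * (1 - x) powr (m - 1)"
proof -
  have "1 - x \<le> 1 - x\<^sup>2" using assms by (simp add: power2_eq_square mult_left_le)
  hence "(1 - x\<^sup>2) powr (m - 1) \<le> (1 - x) powr (m - 1)"
    using assms m_bounds by (intro powr_mono2') auto
  thus ?thesis unfolding P2_def using assms by (intro mult_left_mono) auto
qed

lemma P2_le': assumes "0 \<le> x" "x < 1" shows "P2 x \<le> (1 - x) powr (m - 1)"
proof -
  have "x ^ (N - 1) * (1 - x) powr (m - 1) \<le> 1 * (1 - x) powr (m - 1)"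
    using assms by (intro mult_right_mono power_le_one) auto
  thus ?thesis using P2_le[OF assms] by simp
qed

text \<open>In the variable \<open>tau \<rho>\<close> the coefficients \<open>1 / P1\<close> and \<open>P2\<close> turn into \<open>k1\<close> and \<open>k2\<close>, which are
  continuous up to \<open>\<rho> = 1\<close>; this is where \<open>m < 1/2\<close> enters.\<close>

definition tau :: "real \<Rightarrow> real" where "tau x = 1 - (1 - x) powr m"
definition rho :: "real \<Rightarrow> real" where "rho s = 1 - (1 - s) powr (1 / m)"

lemma rho_tau: "x \<le> 1 \<Longrightarrow> rho (tau x) = x"
  using m_bounds by (simp add: rho_def tau_def powr_powr)

lemma tau_bounds: assumes "0 \<le> x" "x \<le> 1" shows "0 \<le> tau x" "tau x \<le> 1"
  unfolding tau_def using assms m_bounds by (auto simp: powr_le1)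

lemma tau_strict: assumes "0 < x" "x < 1" shows "0 < tau x" "tau x < 1"
  unfolding tau_def using assms m_bounds powr_less_mono2[of m "1 - x" 1] by auto

lemma rho_strict: assumes "0 < x" "x < 1" shows "0 < rho x" "rho x < 1"
  unfolding rho_def using assms m_bounds powr_less_mono2[of "1 / m" "1 - x" 1] by auto

lemma rho_bounds: assumes "0 \<le> x" "x \<le> 1" shows "0 \<le> rho x" "rho x \<le> 1"
  unfolding rho_def using assms m_bounds by (auto simp: powr_le1)

lemma tau_01 [simp]: "tau 0 = 0" "tau 1 = 1" "rho 0 = 0" "rho 1 = 1"
  by (simp_all add: tau_def rho_def)

lemma rho_mono: "s \<le> t \<Longrightarrow> t \<le> 1 \<Longrightarrow> rho s \<le> rho t"
  unfolding rho_def using m_bounds by (simp add: powr_mono2)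

lemma tau_cont: "continuous_on {..1} tau"
  unfolding tau_def[abs_def] using m_bounds by (intro continuous_intros continuous_on_powr') auto

lemma rho_cont: "continuous_on {..1} rho"
  unfolding rho_def[abs_def] using m_bounds by (intro continuous_intros continuous_on_powr') auto

lemma tau_deriv: "x < 1 \<Longrightarrow> (tau has_real_derivative m * (1 - x) powr (m - 1)) (at x)"
  unfolding tau_def[abs_def] by (auto intro!: derivative_eq_intros)

lemma rho_deriv: assumes "s < 1" shows "(rho has_real_derivative (1 - rho s) powr (1 - m) / m) (at s)"
proof -
  have "(rho has_real_derivative (1 / m) * (1 - s) powr (1 / m - 1)) (at s)"
    unfolding rho_def[abs_def] using assms by (auto intro!: derivative_eq_intros)
  also have "(1 - s) powr (1 / m - 1) = (1 - rho s) powr (1 - m)"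
    using m_bounds by (simp add: rho_def powr_powr field_simps)
  finally show ?thesis by simp
qed

definition solves :: "(real \<Rightarrow> real) \<Rightarrow> real \<Rightarrow> real \<Rightarrow> (real \<Rightarrow> real) \<Rightarrow> (real \<Rightarrow> real) \<Rightarrow> bool" where
  "solves f a b u q \<longleftrightarrow> continuous_on {a..b} u \<and> continuous_on {a..b} q \<and>
     (\<forall>x\<in>{a<..<b}. (u has_real_derivative q x / P1 x) (at x) \<and>
        (q has_real_derivative - (P2 x * f (u x))) (at x))"

lemma solvesD:
  assumes "solves f a b u q"
  shows "continuous_on {a..b} u" "continuous_on {a..b} q"
    "a < x \<Longrightarrow> x < b \<Longrightarrow> (u has_real_derivative q x / P1 x) (at x)"
    "a < x \<Longrightarrow> x < b \<Longrightarrow> (q has_real_derivative - (P2 x * f (u x))) (at x)"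
  using assms by (auto simp: solves_def)

definition k1 :: "real \<Rightarrow> real" where
  "k1 s = (1 + rho s) powr (- m) * (1 - rho s) powr (1 - 2 * m) / (m * rho s ^ (N - 1))"
definition k2 :: "real \<Rightarrow> real" where
  "k2 s = rho s ^ (N - 1) * (1 + rho s) powr (m - 1) / m"

lemma k2_cont: "continuous_on {0..1} k2"
proof -
  have c: "continuous_on {0..1} rho" by (rule continuous_on_subset[OF rho_cont]) auto
  have "\<forall>s\<in>{0..1}. 1 + rho s \<noteq> 0" using rho_bounds by (fastforce simp: add_eq_0_iff)
  hence "continuous_on {0..1} (\<lambda>s. (1 + rho s) powr (m - 1))"
    by (intro continuous_on_powr continuous_on_add continuous_on_const c)
  thus ?thesis unfolding k2_def[abs_def] using m_bounds
    by (intro continuous_on_divide continuous_on_mult continuous_on_power continuous_on_const c) auto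
qed

lemma k1_cont: "continuous_on {0<..1} k1"
proof -
  have c: "continuous_on {0<..1} rho" by (rule continuous_on_subset[OF rho_cont]) auto
  have a: "0 < rho s" "rho s \<le> 1" if "s \<in> {0<..1}" for s
    using rho_strict[of s] that by (cases "s = 1"; force)+
  have "\<forall>s\<in>{0<..1}. 1 + rho s \<noteq> 0" using a by (fastforce simp: add_eq_0_iff)
  hence 1: "continuous_on {0<..1} (\<lambda>s. (1 + rho s) powr (- m))"
    by (intro continuous_on_powr continuous_on_add continuous_on_const c)
  have 2: "continuous_on {0<..1} (\<lambda>s. (1 - rho s) powr (1 - 2 * m))"
    by (intro continuous_on_powr' continuous_on_diff continuous_on_const c) (use a m_bounds in auto)
  have "\<forall>s\<in>{0<..1}. m * rho s ^ (N - 1) \<noteq> 0" using a m_bounds by fastforce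
  thus ?thesis unfolding k1_def[abs_def]
    by (intro continuous_on_divide continuous_on_mult continuous_on_power continuous_on_const 1 2 c)
qed

lemma k2_nonneg: "s \<in> {0..1} \<Longrightarrow> 0 \<le> k2 s"
  unfolding k2_def using rho_bounds[of s] m_bounds by auto

text \<open>By monotonicity of \<open>rho\<close> the factor \<open>rho t ^ (N - 1)\<close> in
  \<open>k2\<close> is at most its value at \<open>s\<close>, which cancels the singular denominator
  of \<open>k1\<close>; the length of the interval supplies the factor \<open>s\<close>.\<close>

lemma k1_k2_bound: assumes s: "0 < s" "s \<le> 1" shows "\<bar>k1 s\<bar> * integral {0..s} k2 \<le> 1 / m\<^sup>2 * s"
proof -
  have r: "0 < rho s" "rho s \<le> 1" using rho_strict[of s] s by (cases "s = 1"; force)+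
  have "integral {0..s} k2 \<le> integral {0..s} (\<lambda>_. rho s ^ (N - 1) / m)"
  proof (rule integral_le)
    show "k2 integrable_on {0..s}"
      using s by (intro integrable_continuous_real continuous_on_subset[OF k2_cont]) auto
    fix t assume t: "t \<in> {0..s}"
    have rt: "0 \<le> rho t" "rho t \<le> rho s" using t s rho_bounds[of t] rho_mono[of t s] by auto
    have "rho t ^ (N - 1) * (1 + rho t) powr (m - 1) \<le> rho s ^ (N - 1) * 1"
      using rt m_bounds by (intro mult_mono power_mono powr_le_1_nonpos) auto
    thus "k2 t \<le> rho s ^ (N - 1) / m" unfolding k2_def using m_bounds by (intro divide_right_mono) auto
  qed auto
  hence 1: "integral {0..s} k2 \<le> s * rho s ^ (N - 1) / m" using s by simp
  have 2: "k1 s \<le> 1 / (m * rho s ^ (N - 1))"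
  proof -
    have "(1 + rho s) powr (- m) * (1 - rho s) powr (1 - 2 * m) \<le> 1 * 1"
      using r m_bounds by (intro mult_mono powr_le_1_nonpos powr_le1) auto
    thus ?thesis unfolding k1_def using r m_bounds by (intro divide_right_mono) auto
  qed
  have "0 \<le> k1 s" unfolding k1_def using r m_bounds by auto
  hence k: "\<bar>k1 s\<bar> \<le> 1 / (m * rho s ^ (N - 1))" using 2 by simp
  have i: "0 \<le> integral {0..s} k2"
  proof (rule integral_nonneg)
    show "k2 integrable_on {0..s}"
      using s by (intro integrable_continuous_real continuous_on_subset[OF k2_cont]) auto
  qed (use s k2_nonneg in auto)
  have "\<bar>k1 s\<bar> * integral {0..s} k2 \<le> 1 / (m * rho s ^ (N - 1)) * (s * rho s ^ (N - 1) / m)"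
    by (rule mult_mono[OF k 1 _ i]) (use r m_bounds in auto)
  also have "\<dots> = 1 / m\<^sup>2 * s" using r m_bounds by (simp add: field_simps power2_eq_square)
  finally show ?thesis .
qed

text \<open>The common factor is the derivative of \<open>rho\<close>. Its power
  \<open>1 - m\<close> cancels the power \<open>m - 1\<close> of \<open>1 - rho s\<close> in
  \<open>P2\<close>; against \<open>1 / P1\<close> it leaves the exponent \<open>1 - 2 * m\<close>,
  which is positive.\<close>

lemma k1_identity: assumes "0 < s" "s < 1"
  shows "k1 s = (1 - rho s) powr (1 - m) / m / P1 (rho s)"
    and "k2 s = (1 - rho s) powr (1 - m) / m * P2 (rho s)"
proof -
  note r = rho_strict[OF assms]
  have e: "1 - (rho s)\<^sup>2 = (1 - rho s) * (1 + rho s)" by (simp add: power2_eq_square algebra_simps)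
  have "(1 - rho s) powr (1 - 2 * m) = (1 - rho s) powr (1 - m) / (1 - rho s) powr m"
    "(1 + rho s) powr (- m) = 1 / (1 + rho s) powr m"
    using r by (simp_all add: powr_minus_divide flip: powr_diff)
  thus "k1 s = (1 - rho s) powr (1 - m) / m / P1 (rho s)"
    unfolding k1_def P1_def e using r by (simp add: powr_mult)
  have "(1 - rho s) powr (1 - m) * (1 - rho s) powr (m - 1) = 1"
    using r by (simp flip: powr_add)
  thus "k2 s = (1 - rho s) powr (1 - m) / m * P2 (rho s)"
    unfolding k2_def P2_def e using r by (simp add: powr_mult)
qed

lemma solves_exists:
  assumes "0 < L" "\<And>x y. \<bar>f x - f y\<bar> \<le> L * \<bar>x - y\<bar>"
  obtains u q where "solves f 0 1 u q" "u 0 = c" "q 0 = 0"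
proof -
  have C: "0 < 1 / m\<^sup>2" using m_bounds by simp
  obtain u q where u: "continuous_on {0..1} u" "continuous_on {0..1} q" "u 0 = c" "q 0 = 0"
    "\<And>x. 0 < x \<Longrightarrow> x < 1 \<Longrightarrow> (u has_real_derivative k1 x * q x) (at x)"
    "\<And>x. 0 < x \<Longrightarrow> x < 1 \<Longrightarrow> (q has_real_derivative - (k2 x * f (u x))) (at x)"
    by (rule volterra_exists[OF k1_cont k2_cont k2_nonneg C k1_k2_bound assms, of c]) (blast | rule that)+
  show thesis
  proof (rule that[of "\<lambda>x. u (tau x)" "\<lambda>x. q (tau x)"])
    show "solves f 0 1 (\<lambda>x. u (tau x)) (\<lambda>x. q (tau x))"
      unfolding solves_def
    proof (intro conjI ballI)
      have "continuous_on {0..1} tau" by (rule continuous_on_subset[OF tau_cont]) auto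
      moreover have "tau ` {0..1} \<subseteq> {0..1}" using tau_bounds by auto
      ultimately show "continuous_on {0..1} (\<lambda>x. u (tau x))" "continuous_on {0..1} (\<lambda>x. q (tau x))"
        using continuous_on_compose2[OF u(1)] continuous_on_compose2[OF u(2)] by blast+
      fix x :: real assume x: "x \<in> {0<..<1}"
      hence t: "0 < tau x" "tau x < 1" using tau_strict[of x] by auto
      have rt: "rho (tau x) = x" using x rho_tau by auto
      have pw: "(1 - x) powr (1 - m) * (1 - x) powr (m - 1) = 1" using x by (simp flip: powr_add)
      have "((\<lambda>x. u (tau x)) has_real_derivative k1 (tau x) * q (tau x) * (m * (1 - x) powr (m - 1))) (at x)"
        by (rule DERIV_chain2[OF u(5)[OF t] tau_deriv]) (use x in auto)
      thus "((\<lambda>x. u (tau x)) has_real_derivative q (tau x) / P1 x) (at x)"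
        using pw m_bounds P1_pos[of x] x by (simp add: k1_identity[OF t] rt field_simps)
      have "((\<lambda>x. q (tau x)) has_real_derivative - (k2 (tau x) * f (u (tau x))) * (m * (1 - x) powr (m - 1))) (at x)"
        by (rule DERIV_chain2[OF u(6)[OF t] tau_deriv]) (use x in auto)
      also have "- (k2 (tau x) * f (u (tau x))) * (m * (1 - x) powr (m - 1))
        = - (P2 x * f (u (tau x))) * ((1 - x) powr (1 - m) * (1 - x) powr (m - 1))"
        using m_bounds by (simp add: k1_identity[OF t] rt)
      finally show "((\<lambda>x. q (tau x)) has_real_derivative - (P2 x * f (u (tau x)))) (at x)"
        unfolding pw by simp
    qed
  qed (use u in auto)
qed

text \<open>Gronwall's inequality in the variable \<open>tau\<close>, uniform up to
  \<open>x = 1\<close>. The Lipschitz condition is asked for only along the two solutions, so it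
  applies to \<open>phi\<close> itself, which is not globally Lipschitz.\<close>

lemma solves_diff_bound:
  assumes u: "solves f 0 1 u q" "q 0 = 0" and v: "solves f 0 1 v r" "r 0 = 0"
    and L: "0 < L" "\<And>x. 0 < x \<Longrightarrow> x < 1 \<Longrightarrow> \<bar>f (u x) - f (v x)\<bar> \<le> L * \<bar>u x - v x\<bar>"
    and x: "0 \<le> x" "x \<le> 1"
  shows "\<bar>u x - v x\<bar> \<le> 2 * \<bar>u 0 - v 0\<bar> * exp (2 * L / m\<^sup>2)"
    and "\<bar>q x - r x\<bar> \<le> L / m * (2 * \<bar>u 0 - v 0\<bar> * exp (2 * L / m\<^sup>2))"
proof -
  note [continuous_intros] = continuous_on_compose2[OF solvesD(1)[OF u(1)]] continuous_on_compose2[OF solvesD(2)[OF u(1)]]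
    continuous_on_compose2[OF solvesD(1)[OF v(1)]] continuous_on_compose2[OF solvesD(2)[OF v(1)]] continuous_on_subset[OF rho_cont]
  have main: "\<bar>u x - v x\<bar> \<le> 2 * \<bar>u 0 - v 0\<bar> * exp (2 * L / m\<^sup>2)" if x: "0 \<le> x" "x \<le> 1" for x
  proof -
    have "\<bar>u (rho (tau x)) - v (rho (tau x))\<bar> \<le> 2 * \<bar>u (rho 0) - v (rho 0)\<bar> * exp (2 * L * (1 / m\<^sup>2) * (tau x - 0))"
    proof (rule volterra_bound[where d = "\<lambda>s. u (rho s) - v (rho s)" and e = "\<lambda>s. q (rho s) - r (rho s)" and a = 0 and b = 1
          and ?k1.0 = k1 and ?k2.0 = k2 and K = "\<lambda>s. integral {0..s} k2"
          and e' = "\<lambda>s. - (k2 s * (f (u (rho s)) - f (v (rho s))))"])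
      show "continuous_on {0..1} (\<lambda>s. u (rho s) - v (rho s))" "continuous_on {0..1} (\<lambda>s. q (rho s) - r (rho s))"
        by (intro continuous_intros; use rho_bounds in auto)+
      show "continuous_on {0..1} (\<lambda>s. integral {0..s} k2)"
        by (intro indefinite_integral_continuous_1 integrable_continuous_real k2_cont)
      fix s :: real assume s: "0 < s" "s < 1"
      note rs = rho_strict[OF s]
      have "((\<lambda>s. integral {0..s} k2) has_real_derivative k2 s) (at s within {0..1})"
        using integral_has_real_derivative[OF k2_cont, of s] s by simp
      thus "((\<lambda>s. integral {0..s} k2) has_real_derivative k2 s) (at s)"
        using s at_within_Icc_at[of 0 s 1] by simp
      show "0 \<le> k2 s" using k2_nonneg s by simp
      have "1 / m\<^sup>2 * s \<le> 1 / m\<^sup>2 * 1" using s by (intro mult_left_mono) auto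
      thus "\<bar>k1 s\<bar> * integral {0..s} k2 \<le> 1 / m\<^sup>2" using k1_k2_bound[of s] s by simp
      have "k2 s * \<bar>f (u (rho s)) - f (v (rho s))\<bar> \<le> k2 s * (L * \<bar>u (rho s) - v (rho s)\<bar>)"
        using L(2)[of "rho s"] rs k2_nonneg[of s] s by (intro mult_left_mono) auto
      thus "\<bar>- (k2 s * (f (u (rho s)) - f (v (rho s))))\<bar> \<le> L * k2 s * \<bar>u (rho s) - v (rho s)\<bar>"
        using k2_nonneg[of s] s by (simp add: abs_mult mult_ac)
      have r': "(rho has_real_derivative (1 - rho s) powr (1 - m) / m) (at s)" using s by (intro rho_deriv)
      have "((\<lambda>s. u (rho s) - v (rho s)) has_real_derivative
          q (rho s) / P1 (rho s) * ((1 - rho s) powr (1 - m) / m) - r (rho s) / P1 (rho s) * ((1 - rho s) powr (1 - m) / m)) (at s)"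
        by (intro DERIV_diff DERIV_chain2[OF solvesD(3)[OF u(1)] r'] DERIV_chain2[OF solvesD(3)[OF v(1)] r'] rs)
      thus "((\<lambda>s. u (rho s) - v (rho s)) has_real_derivative k1 s * (q (rho s) - r (rho s))) (at s)"
        by (simp add: k1_identity[OF s] ring_distribs diff_divide_distrib mult_ac)
      have "((\<lambda>s. q (rho s) - r (rho s)) has_real_derivative
          - (P2 (rho s) * f (u (rho s))) * ((1 - rho s) powr (1 - m) / m) - - (P2 (rho s) * f (v (rho s))) * ((1 - rho s) powr (1 - m) / m)) (at s)"
        by (intro DERIV_diff DERIV_chain2[OF solvesD(4)[OF u(1)] r'] DERIV_chain2[OF solvesD(4)[OF v(1)] r'] rs)
      thus "((\<lambda>s. q (rho s) - r (rho s)) has_real_derivative - (k2 s * (f (u (rho s)) - f (v (rho s))))) (at s)"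
        by (simp add: k1_identity[OF s] ring_distribs diff_divide_distrib mult_ac)
    qed (use L u v m_bounds tau_bounds x in auto)
    also have "\<dots> \<le> 2 * \<bar>u (rho 0) - v (rho 0)\<bar> * exp (2 * L / m\<^sup>2)"
    proof -
      have "2 * L * (1 / m\<^sup>2) * (tau x - 0) \<le> 2 * L * (1 / m\<^sup>2) * 1"
        using L m_bounds tau_bounds x by (intro mult_left_mono) auto
      thus ?thesis by (intro mult_left_mono) auto
    qed
    finally show ?thesis using x by (simp add: rho_tau)
  qed
  show "\<bar>u x - v x\<bar> \<le> 2 * \<bar>u 0 - v 0\<bar> * exp (2 * L / m\<^sup>2)" by (rule main[OF x])
  define S where "S = 2 * \<bar>u 0 - v 0\<bar> * exp (2 * L / m\<^sup>2)"
  have S: "0 \<le> S" by (simp add: S_def)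
  \<comment> \<open>\<open>P2\<close> is dominated by the derivative of \<open>tau / m\<close>, so
    \<open>tau\<close>, which is at most \<open>1\<close>, serves as comparison function.\<close>
  have "\<bar>(q x - r x) - (q 0 - r 0)\<bar> \<le> L * S / m * tau x - L * S / m * tau 0"
  proof (rule abs_le_by_derivative[where f' = "\<lambda>x. - (P2 x * f (u x)) - - (P2 x * f (v x))"
        and g' = "\<lambda>x. L * S / m * (m * (1 - x) powr (m - 1))" and f = "\<lambda>x. q x - r x" and g = "\<lambda>x. L * S / m * tau x"])
    show "continuous_on {0..x} (\<lambda>x. q x - r x)" "continuous_on {0..x} (\<lambda>x. L * S / m * tau x)"
      using x m_bounds by (auto intro!: continuous_intros continuous_on_subset[OF tau_cont])
    fix s assume s: "0 < s" "s < x"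
    hence s1: "s < 1" using x by simp
    show "((\<lambda>x. q x - r x) has_real_derivative - (P2 s * f (u s)) - - (P2 s * f (v s))) (at s)"
      by (intro DERIV_diff solvesD(4)[OF u(1)] solvesD(4)[OF v(1)] s s1)
    show "((\<lambda>x. L * S / m * tau x) has_real_derivative L * S / m * (m * (1 - s) powr (m - 1))) (at s)"
      by (intro DERIV_cmult tau_deriv s1)
    have "- (P2 s * f (u s)) - - (P2 s * f (v s)) = - P2 s * (f (u s) - f (v s))" by (simp add: algebra_simps)
    hence "\<bar>- (P2 s * f (u s)) - - (P2 s * f (v s))\<bar> = P2 s * \<bar>f (u s) - f (v s)\<bar>"
      using P2_nonneg[of s] s by (simp add: abs_mult)
    also have "\<dots> \<le> (1 - s) powr (m - 1) * (L * S)"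
    proof (intro mult_mono P2_le')
      have "\<bar>f (u s) - f (v s)\<bar> \<le> L * \<bar>u s - v s\<bar>" using L(2) s s1 by auto
      also have "\<dots> \<le> L * S" using main[of s] s s1 L by (intro mult_left_mono) (auto simp: S_def)
      finally show "\<bar>f (u s) - f (v s)\<bar> \<le> L * S" .
    qed (use s s1 in auto)
    finally show "\<bar>- (P2 s * f (u s)) - - (P2 s * f (v s))\<bar> \<le> L * S / m * (m * (1 - s) powr (m - 1))"
      using m_bounds by (simp add: mult_ac)
  qed (use x in auto)
  also have "L * S / m * tau x \<le> L * S / m * 1" using L S m_bounds tau_bounds[OF x] by (intro mult_left_mono) auto
  finally show "\<bar>q x - r x\<bar> \<le> L / m * (2 * \<bar>u 0 - v 0\<bar> * exp (2 * L / m\<^sup>2))"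
    using u v by (simp add: S_def)
qed

end

text \<open>For energies at the centre, where \<open>P1\<close> vanishes and only a one-sided limit
  is available.\<close>

lemma DERIV_nonpos_le_limit:
  fixes f :: "real \<Rightarrow> real"
  assumes "a < x" and "\<And>t. a < t \<Longrightarrow> t \<le> x \<Longrightarrow> (f has_real_derivative f' t) (at t)"
    and "\<And>t. a < t \<Longrightarrow> t \<le> x \<Longrightarrow> f' t \<le> 0" and "(f \<longlongrightarrow> l) (at_right a)"
  shows "f x \<le> l"
proof (rule tendsto_lowerbound[OF assms(4)])
  have "f x \<le> f t" if "a < t" "t < x" for t
  proof (rule DERIV_nonpos_imp_nonincreasing[of t x f])
    fix s assume "t \<le> s" "s \<le> x"
    thus "\<exists>y. (f has_real_derivative y) (at s) \<and> y \<le> 0" using assms(2,3)[of s] that by force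
  qed (use that in simp)
  thus "\<forall>\<^sub>F t in at_right a. f x \<le> f t"
    using assms(1) by (auto simp: eventually_at_right_field)
qed simp

context wave begin

section \<open>Regular solutions and their energies\<close>

definition phi :: "real \<Rightarrow> real" where "phi u = u powr p - lam * u"
definition Phi :: "real \<Rightarrow> real" where "Phi u = u powr (p + 1) / (p + 1) - lam * u\<^sup>2 / 2"
text \<open>The positive zero of \<open>phi\<close>, hence the constant solution; from here on
  \<open>Phi\<close> increases.\<close>

definition c0 :: real where "c0 = lam powr (1 / (p - 1))"

lemma c0_pos: "0 < c0" unfolding c0_def using lam_pos by simp

lemma c0_powr: "c0 powr (p - 1) = lam"
  unfolding c0_def using lam_pos p_gt_1 by (simp add: powr_powr)

lemma b_inf_pos: "0 < b_inf N p"
  unfolding b_inf_def \<beta>_def[symmetric] using beta_pos by simp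

lemma b_inf_powr: "b_inf N p powr (p - 1) = \<beta>"
proof -
  have "b_inf N p powr (p - 1) = \<beta> powr (\<alpha> * (p - 1) / 2)"
    by (simp add: b_inf_def \<beta>_def powr_powr)
  thus ?thesis using alpha_p beta_pos by simp
qed

lemma powr_p_eq: "0 \<le> u \<Longrightarrow> u powr p = u powr (p - 1) * u"
  by (cases "u = 0") (auto simp: powr_diff)

lemma powr_antideriv: "0 < u \<Longrightarrow> ((\<lambda>u. u powr (p + 1) / (p + 1)) has_real_derivative u powr p) (at u)"
  using DERIV_cdivide[OF has_real_derivative_powr[of u "p + 1"], of "p + 1"] p_gt_1 by simp

lemma scaled_flux: "S \<noteq> 0 \<Longrightarrow> S * (- F / S - v * (a - k / S)) = - F - v * (a * S - k)" for S F v a k :: real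
  by (simp add: field_simps)

lemma Phi_deriv: "0 < u \<Longrightarrow> (Phi has_real_derivative phi u) (at u)"
  unfolding Phi_def[abs_def] phi_def
  by (rule derivative_eq_intros powr_antideriv refl | assumption | simp)+

lemma phi_lipschitz:
  assumes "0 < M" "x \<in> {0..M}" "y \<in> {0..M}"
  shows "\<bar>phi x - phi y\<bar> \<le> (p * M powr (p - 1) + lam) * \<bar>x - y\<bar>"
proof -
  have *: "\<bar>phi y - phi x\<bar> \<le> (p * M powr (p - 1) + lam) * y - (p * M powr (p - 1) + lam) * x"
    if xy: "0 \<le> x" "x \<le> y" "y \<le> M" for x y
  proof (rule abs_le_by_derivative[OF xy(2), where f' = "\<lambda>u. p * u powr (p - 1) - lam"
        and g' = "\<lambda>_. p * M powr (p - 1) + lam"])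
    show "continuous_on {x..y} phi"
      unfolding phi_def[abs_def] using p_gt_1 xy by (intro continuous_intros continuous_on_powr') auto
    fix u assume u: "x < u" "u < y"
    show "(phi has_real_derivative p * u powr (p - 1) - lam) (at u)"
      unfolding phi_def[abs_def] using u xy by (auto intro!: derivative_eq_intros)
    have "u powr (p - 1) \<le> M powr (p - 1)" using u xy p_gt_1 by (intro powr_mono2) auto
    hence "p * u powr (p - 1) \<le> p * M powr (p - 1)" using p_gt_1 by simp
    moreover have "0 \<le> p * u powr (p - 1)" using p_gt_1 by simp
    ultimately show "\<bar>p * u powr (p - 1) - lam\<bar> \<le> p * M powr (p - 1) + lam" using lam_pos by linarith
  qed (auto intro!: continuous_intros derivative_eq_intros)
  show ?thesis
    using *[of x y] *[of y x] assms
    by (cases "x \<le> y") (auto simp: abs_minus_commute right_diff_distrib)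
qed

lemma phi_bound:
  assumes "c0 \<le> c" "0 \<le> u" "u \<le> c" shows "\<bar>phi u\<bar> \<le> c powr p"
proof -
  have c: "0 < c" using assms c0_pos by simp
  have "u powr p \<le> c powr p" using assms p_gt_1 by (intro powr_mono2) auto
  moreover have "lam \<le> c powr (p - 1)"
    using powr_mono2[of "p - 1" c0 c] assms p_gt_1 c0_pos by (simp add: c0_powr)
  hence "lam * u \<le> c powr (p - 1) * c" using assms lam_pos by (intro mult_mono) auto
  hence "lam * u \<le> c powr p" using powr_p_eq[of c] c by simp
  moreover have "0 \<le> lam * u" "0 \<le> u powr p" using lam_pos assms by auto
  ultimately show ?thesis unfolding phi_def by linarith
qed

text \<open>Turns the energy inequality \<open>Phi (u x) \<le> Phi c\<close> into
  \<open>u x \<le> c\<close>; on \<open>(0, c0)\<close> the function \<open>Phi\<close>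
  decreases.\<close>

lemma Phi_strict_mono:
  assumes "c0 \<le> c" "c < u" shows "Phi c < Phi u"
proof (rule DERIV_pos_imp_increasing_open[OF assms(2)])
  fix x assume x: "c < x" "x < u"
  hence x0: "0 < x" "c0 < x" using assms c0_pos by auto
  have "lam < x powr (p - 1)"
    using powr_less_mono2[of "p - 1" c0 x] x0 p_gt_1 c0_pos by (simp add: c0_powr)
  hence "0 < phi x" unfolding phi_def using powr_p_eq[of x] x0 by simp
  thus "\<exists>y. (Phi has_real_derivative y) (at x) \<and> 0 < y" using Phi_deriv[OF x0(1)] by blast
next
  show "continuous_on {c..u} Phi"
    by (rule DERIV_continuous_on[where D = phi], rule has_field_derivative_at_within[OF Phi_deriv]) (use assms c0_pos in auto)
qed

lemma P1_deriv:
  assumes "0 < x" "x < 1"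
  shows "(P1 has_real_derivative P1 x * ((real N - 1) / x - 2 * m * x / (1 - x\<^sup>2))) (at x)"
proof -
  have s: "0 < 1 - x\<^sup>2" using one_minus_square_pos[of x] assms by simp
  obtain k where k: "N - 1 = Suc k" "real N - 1 = real (Suc k)" using N by (cases "N - 1") auto
  have "(P1 has_real_derivative (real (N - 1) * x ^ (N - 1 - 1)) * (1 - x\<^sup>2) powr m
      + x ^ (N - 1) * (m * (1 - x\<^sup>2) powr (m - 1) * (- (2 * x)))) (at x)"
    unfolding P1_def[abs_def] using s by (auto intro!: derivative_eq_intros)
  also have "(real (N - 1) * x ^ (N - 1 - 1)) * (1 - x\<^sup>2) powr m
      + x ^ (N - 1) * (m * (1 - x\<^sup>2) powr (m - 1) * (- (2 * x)))
      = P1 x * ((real N - 1) / x - 2 * m * x / (1 - x\<^sup>2))"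
    unfolding P1_def k using s assms by (simp add: powr_diff field_simps)
  finally show ?thesis .
qed

lemma u1_deriv:
  assumes "0 < x" "x < 1" and "(q has_real_derivative - (P2 x * F)) (at x)"
  shows "((\<lambda>x. q x / P1 x) has_real_derivative
     - F / (1 - x\<^sup>2) - (q x / P1 x) * ((real N - 1) / x - 2 * m * x / (1 - x\<^sup>2))) (at x)"
proof -
  have P: "0 < P1 x" using assms by (intro P1_pos)
  have "((\<lambda>x. q x / P1 x) has_real_derivative
     (- (P2 x * F) * P1 x - q x * (P1 x * ((real N - 1) / x - 2 * m * x / (1 - x\<^sup>2)))) / (P1 x * P1 x)) (at x)"
    using P by (intro DERIV_divide assms(3) P1_deriv assms(1,2)) auto
  also have "(- (P2 x * F) * P1 x - q x * (P1 x * ((real N - 1) / x - 2 * m * x / (1 - x\<^sup>2)))) / (P1 x * P1 x)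
     = - F / (1 - x\<^sup>2) - (q x / P1 x) * ((real N - 1) / x - 2 * m * x / (1 - x\<^sup>2))"
    unfolding P2_eq[OF assms(1,2)] using P one_minus_square_pos[of x] assms(1,2)
    by (simp add: diff_divide_distrib)
  finally show ?thesis .
qed

text \<open>The end \<open>T\<close> is variable for the sake of a continuation argument. Positivity
  is demanded only before \<open>T\<close>, so that positivity at \<open>T\<close> can be derived
  rather than assumed.\<close>

definition reg :: "real \<Rightarrow> real \<Rightarrow> (real \<Rightarrow> real) \<Rightarrow> (real \<Rightarrow> real) \<Rightarrow> bool" where
  "reg T c u q \<longleftrightarrow> 0 < T \<and> T \<le> 1 \<and> solves phi 0 T u q \<and> u 0 = c \<and> q 0 = 0 \<and> (\<forall>x\<in>{0..<T}. 0 < u x)"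

definition En :: "(real \<Rightarrow> real) \<Rightarrow> (real \<Rightarrow> real) \<Rightarrow> real \<Rightarrow> real" where
  "En u q x = (1 - x\<^sup>2) * (q x / P1 x)\<^sup>2 / 2 + Phi (u x)"
definition ww :: "(real \<Rightarrow> real) \<Rightarrow> real \<Rightarrow> real" where
  "ww u x = x powr \<alpha> * u x"
text \<open>The derivative of \<open>ww u\<close> with respect to \<open>ln x\<close>. In these
  Emden-Fowler variables \<open>u_inf\<close> is the rest point with \<open>ww\<close> equal to
  \<open>b_inf N p\<close> and \<open>WW\<close> equal to \<open>0\<close>.\<close>

definition WW :: "(real \<Rightarrow> real) \<Rightarrow> (real \<Rightarrow> real) \<Rightarrow> real \<Rightarrow> real" where
  "WW u q x = x powr \<alpha> * (x * (q x / P1 x) + \<alpha> * u x)"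
definition HH :: "(real \<Rightarrow> real) \<Rightarrow> (real \<Rightarrow> real) \<Rightarrow> real \<Rightarrow> real" where
  "HH u q x = (1 - x\<^sup>2) * (WW u q x)\<^sup>2 / 2 + ww u x powr (p + 1) / (p + 1) - \<beta> * (ww u x)\<^sup>2 / 2"

lemma P_near_0:
  assumes "0 < x" "x \<le> 1 / 2"
  shows "P2 x \<le> 2 * x ^ (N - 1)" "x ^ (N - 1) / 2 \<le> P1 x"
proof -
  have x2: "x\<^sup>2 \<le> 1 / 2" using assms power_mono[of x "1/2" 2] by (simp add: power2_eq_square)
  have "(1 - x\<^sup>2) powr (m - 1) \<le> (1 - x\<^sup>2) powr (- 1)"
    using m_bounds x2 assms by (intro powr_mono') auto
  also have "\<dots> = 1 / (1 - x\<^sup>2)" using x2 by (simp add: powr_minus_divide)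
  also have "\<dots> \<le> 2" using x2 by (simp add: field_simps)
  finally show "P2 x \<le> 2 * x ^ (N - 1)" unfolding P2_def using assms by (simp add: mult.commute)
  have "1 / 2 \<le> (1 - x\<^sup>2) powr 1" using x2 by simp
  also have "\<dots> \<le> (1 - x\<^sup>2) powr m" using m_bounds x2 assms by (intro powr_mono') auto
  finally have "x ^ (N - 1) * (1 / 2) \<le> x ^ (N - 1) * (1 - x\<^sup>2) powr m"
    using assms by (intro mult_left_mono) auto
  thus "x ^ (N - 1) / 2 \<le> P1 x" unfolding P1_def by simp
qed

text \<open>Integrating the flux gives \<open>2 * B / N * x ^ N\<close>, and \<open>P1\<close> is at
  least \<open>x ^ (N - 1) / 2\<close>; the quotient has the constant \<open>4 / N\<close>, which is
  at most \<open>2\<close>.\<close>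

lemma reg_u1_bound:
  assumes r: "reg T c u q" and x: "0 < x" "x < T" "x \<le> 1 / 2" and B: "\<And>t. 0 < t \<Longrightarrow> t < x \<Longrightarrow> \<bar>phi (u t)\<bar> \<le> B"
  shows "\<bar>q x / P1 x\<bar> \<le> 2 * B * x"
proof -
  have s: "solves phi 0 T u q" and q0: "q 0 = 0" using r by (auto simp: reg_def)
  have B0: "0 \<le> B" using B[of "x / 2"] x by linarith
  have "\<bar>q x - q 0\<bar> \<le> 2 * B / real N * x ^ N - 2 * B / real N * 0 ^ N"
  proof (rule abs_le_by_derivative[where f' = "\<lambda>t. - (P2 t * phi (u t))" and g' = "\<lambda>t. 2 * B * t ^ (N - 1)"
        and g = "\<lambda>t. 2 * B / real N * t ^ N"])
    show "continuous_on {0..x} q" using solvesD(2)[OF s] by (rule continuous_on_subset) (use x in auto)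
    fix t assume t: "0 < t" "t < x"
    show "(q has_real_derivative - (P2 t * phi (u t))) (at t)" using solvesD(4)[OF s] t x by auto
    show "((\<lambda>t. 2 * B / real N * t ^ N) has_real_derivative 2 * B * t ^ (N - 1)) (at t)"
      using N by (auto intro!: derivative_eq_intros)
    have "P2 t * \<bar>phi (u t)\<bar> \<le> (2 * t ^ (N - 1)) * B"
      using P_near_0(1)[of t] B[of t] t x by (intro mult_mono) auto
    thus "\<bar>- (P2 t * phi (u t))\<bar> \<le> 2 * B * t ^ (N - 1)"
      using P2_nonneg[of t] t by (simp add: abs_mult mult_ac)
  qed (use x N in \<open>auto intro!: continuous_intros\<close>)
  hence q: "\<bar>q x\<bar> \<le> 2 * B / real N * x ^ N" using q0 N by (simp add: power_0_left)
  have xN: "x ^ N = x * x ^ (N - 1)" using N by (cases N) auto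
  have "\<bar>q x / P1 x\<bar> \<le> (2 * B / real N * x ^ N) / (x ^ (N - 1) / 2)"
    unfolding abs_divide using q P_near_0(2)[of x] P1_pos[of x] x B0 by (intro frac_le) auto
  also have "\<dots> = (4 / real N) * (B * x)" unfolding xN using x by (simp add: field_simps)
  also have "\<dots> \<le> 2 * (B * x)" using N x B0 by (intro mult_right_mono) (auto simp: field_simps)
  finally show ?thesis by simp
qed

lemma reg_u1_tendsto:
  assumes r: "reg T c u q"
  shows "((\<lambda>x. q x / P1 x) \<longlongrightarrow> 0) (at_right 0)" "(u \<longlongrightarrow> c) (at_right 0)"
proof -
  have s: "solves phi 0 T u q" and u0: "u 0 = c" and T: "0 < T" using r by (auto simp: reg_def)
  have "continuous_on {0..T/2} (\<lambda>t. phi (u t))"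
  proof -
    have u: "continuous_on {0..T/2} u" by (rule continuous_on_subset[OF solvesD(1)[OF s]]) (use T in auto)
    have "\<forall>t\<in>{0..T/2}. 0 < u t" using r T by (auto simp: reg_def)
    hence "\<forall>t\<in>{0..T/2}. 0 \<le> u t \<and> (u t = 0 \<longrightarrow> 0 < p)" by (auto simp: less_le)
    thus ?thesis unfolding phi_def by (intro continuous_on_diff continuous_on_mult continuous_on_const continuous_on_powr' u)
  qed
  from continuous_on_Icc_bounded[OF this] obtain B where B: "\<And>t. t \<in> {0..T/2} \<Longrightarrow> \<bar>phi (u t)\<bar> \<le> B"
    by blast
  show "((\<lambda>x. q x / P1 x) \<longlongrightarrow> 0) (at_right 0)"
  proof (rule Lim_null_comparison)
    show "\<forall>\<^sub>F x in at_right 0. norm (q x / P1 x) \<le> 2 * B * x"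
      unfolding eventually_at_right_field
    proof (intro exI[of _ "min (1/2) (T/2)"] conjI allI impI)
      fix x assume "0 < x" "x < min (1/2) (T/2)"
      thus "norm (q x / P1 x) \<le> 2 * B * x"
        unfolding real_norm_def by (intro reg_u1_bound[OF r] B) auto
    qed (use T in auto)
    have "((\<lambda>x. 2 * B * x) \<longlongrightarrow> 2 * B * 0) (at_right 0)" by (intro tendsto_intros)
    thus "((\<lambda>x. 2 * B * x) \<longlongrightarrow> 0) (at_right 0)" by simp
  qed
  have "(u \<longlongrightarrow> u 0) (at 0 within {0..T})"
    using solvesD(1)[OF s] T by (simp add: continuous_on)
  thus "(u \<longlongrightarrow> c) (at_right 0)"
    using T u0 by (simp add: at_within_Icc_at_right)
qed

text \<open>The friction coefficient in the result is positive on \<open>(0, 1)\<close>, because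
  \<open>2 * \<alpha> + 1 < N - 1\<close>.\<close>

lemma En_deriv:
  assumes x: "0 < x" "x < 1" and u: "0 < u x" and d: "(u has_real_derivative q x / P1 x) (at x)"
    and dq: "(q has_real_derivative - (P2 x * phi (u x))) (at x)"
  shows "(En u q has_real_derivative - ((q x / P1 x)\<^sup>2 * ((real N - 1) / x - (2 * \<alpha> + 1) * x))) (at x)"
proof -
  define v where "v = q x / P1 x"
  define D where "D = - phi (u x) / (1 - x\<^sup>2) - v * ((real N - 1) / x - 2 * m * x / (1 - x\<^sup>2))"
  have s: "0 < 1 - x\<^sup>2" using x one_minus_square_pos[of x] by simp
  define V where "V = (\<lambda>x. q x / P1 x)"
  have V: "V x = v" by (simp add: V_def v_def)
  have V': "(V has_real_derivative D) (at x)" unfolding V_def D_def v_def by (rule u1_deriv[OF x dq])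
  have P': "((\<lambda>x. Phi (u x)) has_real_derivative phi (u x) * v) (at x)"
    unfolding v_def by (rule DERIV_chain2[OF Phi_deriv[OF u] d])
  have "((\<lambda>x. (1 - x\<^sup>2) * (V x)\<^sup>2 / 2 + Phi (u x)) has_real_derivative
      (- (2 * x) * v\<^sup>2 + (1 - x\<^sup>2) * (2 * v * D)) / 2 + phi (u x) * v) (at x)"
    by (rule derivative_eq_intros refl V' P' | simp add: V)+
  hence "(En u q has_real_derivative (- (2 * x) * v\<^sup>2 + (1 - x\<^sup>2) * (2 * v * D)) / 2 + phi (u x) * v) (at x)"
    by (simp add: En_def[abs_def] V_def)
  also have "(1 - x\<^sup>2) * (2 * v * D) = 2 * v * ((1 - x\<^sup>2) * D)" by simp
  also have "(1 - x\<^sup>2) * D = - phi (u x) - v * ((real N - 1) / x * (1 - x\<^sup>2) - 2 * m * x)"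
    unfolding D_def using s scaled_flux[of "1 - x\<^sup>2"] by simp
  also have "(- (2 * x) * v\<^sup>2 + 2 * v * (- phi (u x) - v * ((real N - 1) / x * (1 - x\<^sup>2) - 2 * m * x))) / 2 + phi (u x) * v
     = - (v\<^sup>2 * ((real N - 1) / x - (2 * \<alpha> + 1) * x))"
    using x by (simp add: m_def field_simps power2_eq_square)
  finally show ?thesis by (simp add: v_def)
qed

lemma ww_deriv:
  assumes x: "0 < x" "x < 1" and d: "(u has_real_derivative q x / P1 x) (at x)"
  shows "(ww u has_real_derivative WW u q x / x) (at x)"
proof -
  have "(ww u has_real_derivative (\<alpha> * x powr (\<alpha> - 1)) * u x + (q x / P1 x) * x powr \<alpha>) (at x)"
    unfolding ww_def[abs_def] using x d by (auto intro!: derivative_eq_intros)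
  also have "(\<alpha> * x powr (\<alpha> - 1)) * u x + (q x / P1 x) * x powr \<alpha> = WW u q x / x"
    unfolding WW_def using x by (simp add: powr_diff field_simps)
  finally show ?thesis .
qed

lemma ww_powr:
  assumes "0 < x" "0 < u x" shows "ww u x powr p = x\<^sup>2 * x powr \<alpha> * u x powr p"
proof -
  have "\<alpha> * p = \<alpha> + 2" using alpha_p by (simp add: algebra_simps)
  hence "(x powr \<alpha>) powr p = x powr \<alpha> * x powr 2" by (simp add: powr_powr powr_add)
  thus ?thesis unfolding ww_def using assms by (simp add: powr_mult)
qed

text \<open>Since \<open>\<alpha> * p = \<alpha> + 2\<close>, the scaling by
  \<open>x powr \<alpha>\<close> makes the nonlinear term \<open>w powr p\<close> free of
  \<open>x\<close>, and the linear terms combine to \<open>\<beta> * w\<close>. Apart from the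
  factor \<open>x\<close> that belongs to \<open>ln x\<close>, the variable remains only in
  \<open>1 - x\<^sup>2\<close> and \<open>\<delta> - x\<^sup>2\<close>.\<close>

lemma WW_deriv:
  assumes x: "0 < x" "x < 1" and u: "0 < u x" and d: "(u has_real_derivative q x / P1 x) (at x)"
    and dq: "(q has_real_derivative - (P2 x * phi (u x))) (at x)"
  shows "(WW u q has_real_derivative
     (- ((\<delta> - x\<^sup>2) * WW u q x) - (ww u x powr p - \<beta> * ww u x)) / (x * (1 - x\<^sup>2))) (at x)"
proof -
  define v where "v = q x / P1 x"
  define D where "D = - phi (u x) / (1 - x\<^sup>2) - v * ((real N - 1) / x - 2 * m * x / (1 - x\<^sup>2))"
  have s: "0 < 1 - x\<^sup>2" using x one_minus_square_pos[of x] by simp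
  define V where "V = (\<lambda>x. q x / P1 x)"
  have V: "V x = v" by (simp add: V_def v_def)
  have V': "(V has_real_derivative D) (at x)" unfolding V_def D_def v_def by (rule u1_deriv[OF x dq])
  have d': "(u has_real_derivative v) (at x)" using d by (simp add: v_def)
  have "((\<lambda>x. x powr \<alpha> * (x * V x + \<alpha> * u x)) has_real_derivative (\<alpha> * x powr (\<alpha> - 1)) * (x * v + \<alpha> * u x)
      + ((1 * v + D * x) + \<alpha> * v) * x powr \<alpha>) (at x)"
    using x by (auto intro!: derivative_eq_intros V' d' simp: V)
  hence "(WW u q has_real_derivative (\<alpha> * x powr (\<alpha> - 1)) * (x * v + \<alpha> * u x)
      + ((1 * v + D * x) + \<alpha> * v) * x powr \<alpha>) (at x)"
    by (simp add: WW_def[abs_def] V_def)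
  also have "(\<alpha> * x powr (\<alpha> - 1)) * (x * v + \<alpha> * u x) + ((1 * v + D * x) + \<alpha> * v) * x powr \<alpha>
     = x powr \<alpha> * (\<alpha> * (x * v + \<alpha> * u x) * (1 - x\<^sup>2) + (v + \<alpha> * v) * x * (1 - x\<^sup>2) + x\<^sup>2 * ((1 - x\<^sup>2) * D)) / (x * (1 - x\<^sup>2))"
  proof -
    have "(\<alpha> * x powr (\<alpha> - 1)) * (x * v + \<alpha> * u x) + ((1 * v + D * x) + \<alpha> * v) * x powr \<alpha>
      = x powr \<alpha> * (\<alpha> * (x * v + \<alpha> * u x) + (v + \<alpha> * v) * x + x\<^sup>2 * D) / x"
      using x by (simp add: powr_diff field_simps power2_eq_square)
    also have "\<dots> = x powr \<alpha> * (\<alpha> * (x * v + \<alpha> * u x) + (v + \<alpha> * v) * x + x\<^sup>2 * D) * (1 - x\<^sup>2) / (x * (1 - x\<^sup>2))"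
      using s by simp
    finally show ?thesis by (simp add: algebra_simps)
  qed
  also have "x\<^sup>2 * ((1 - x\<^sup>2) * D) = - x\<^sup>2 * phi (u x) - v * x * ((real N - 1) * (1 - x\<^sup>2) - 2 * m * x\<^sup>2)"
  proof -
    have sD: "(1 - x\<^sup>2) * D = - phi (u x) - v * ((real N - 1) / x * (1 - x\<^sup>2) - 2 * m * x)"
      unfolding D_def using s scaled_flux[of "1 - x\<^sup>2"] by simp
    show ?thesis unfolding sD using x by (simp add: field_simps power2_eq_square)
  qed
  also have "x powr \<alpha> * (\<alpha> * (x * v + \<alpha> * u x) * (1 - x\<^sup>2) + (v + \<alpha> * v) * x * (1 - x\<^sup>2) +
       (- x\<^sup>2 * phi (u x) - v * x * ((real N - 1) * (1 - x\<^sup>2) - 2 * m * x\<^sup>2)))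
     = - ((\<delta> - x\<^sup>2) * WW u q x) - (ww u x powr p - \<beta> * ww u x)"
    unfolding ww_powr[of x u, OF x(1) u] unfolding WW_def ww_def phi_def v_def[symmetric]
    by (simp add: \<delta>_def m_def lam_def \<beta>_def power2_eq_square) (simp add: field_simps)
  finally show ?thesis .
qed

text \<open>Differentiating the weight \<open>1 - x\<^sup>2\<close> in \<open>HH\<close> cancels the
  part \<open>x\<^sup>2 * WW\<close> of the damping, which has the wrong sign; only the friction
  \<open>\<delta>\<close> survives.\<close>

lemma HH_deriv:
  assumes x: "0 < x" "x < 1" and u: "0 < u x" and d: "(u has_real_derivative q x / P1 x) (at x)"
    and dq: "(q has_real_derivative - (P2 x * phi (u x))) (at x)"
  shows "(HH u q has_real_derivative - (\<delta> * (WW u q x)\<^sup>2 / x)) (at x)"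
proof -
  have s: "0 < 1 - x\<^sup>2" using x one_minus_square_pos[of x] by simp
  have w: "0 < ww u x" unfolding ww_def using x u by simp
  define A where "A = ww u x powr p - \<beta> * ww u x"
  define D where "D = (- ((\<delta> - x\<^sup>2) * WW u q x) - A) / (x * (1 - x\<^sup>2))"
  have D: "(WW u q has_real_derivative D) (at x)" unfolding D_def A_def by (rule WW_deriv[of x u q, OF x u d dq])
  note w' = ww_deriv[of x u q, OF x d]
  have "(HH u q has_real_derivative ((- (2 * x)) * (WW u q x)\<^sup>2 + (1 - x\<^sup>2) * (2 * WW u q x * D)) / 2
      + ww u x powr p * (WW u q x / x) - \<beta> * (2 * ww u x * (WW u q x / x)) / 2) (at x)"
  proof -
    define G where "G = (\<lambda>x. ww u x powr (p + 1) / (p + 1))"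
    have "(G has_real_derivative ww u x powr p * (WW u q x / x)) (at x)"
      unfolding G_def by (rule DERIV_chain2[OF powr_antideriv[OF w] w'])
    hence "((\<lambda>x. (1 - x\<^sup>2) * (WW u q x)\<^sup>2 / 2 + G x - \<beta> * (ww u x)\<^sup>2 / 2) has_real_derivative
      ((- (2 * x)) * (WW u q x)\<^sup>2 + (1 - x\<^sup>2) * (2 * WW u q x * D)) / 2
      + ww u x powr p * (WW u q x / x) - \<beta> * (2 * ww u x * (WW u q x / x)) / 2) (at x)"
      using D w' by (auto intro!: derivative_eq_intros simp: algebra_simps add_divide_distrib diff_divide_distrib)
    thus ?thesis unfolding G_def HH_def[abs_def] .
  qed
  also have "((- (2 * x)) * (WW u q x)\<^sup>2 + (1 - x\<^sup>2) * (2 * WW u q x * D)) / 2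
      + ww u x powr p * (WW u q x / x) - \<beta> * (2 * ww u x * (WW u q x / x)) / 2
      = - x * (WW u q x)\<^sup>2 + WW u q x * ((1 - x\<^sup>2) * D) + A * (WW u q x / x)"
    by (simp add: A_def algebra_simps add_divide_distrib diff_divide_distrib)
  also have "(1 - x\<^sup>2) * D = (- ((\<delta> - x\<^sup>2) * WW u q x) - A) / x"
    unfolding D_def using s by simp
  also have "- x * (WW u q x)\<^sup>2 + WW u q x * ((- ((\<delta> - x\<^sup>2) * WW u q x) - A) / x) + A * (WW u q x / x) = - (\<delta> * (WW u q x)\<^sup>2 / x)"
    using x by (simp add: field_simps power2_eq_square)
  finally show ?thesis .
qed

end

lemma powr_tendsto_0_at_right: "0 < a \<Longrightarrow> ((\<lambda>x. x powr a) \<longlongrightarrow> 0) (at_right (0::real))"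
  using tendsto_powr'[OF tendsto_ident_at[of 0 "{0<..}"] tendsto_const[of a]] eventually_at_right_less[of "0::real"]
  by (auto dest: eventually_mono[OF _ less_imp_le])

context wave begin

section \<open>Consequences of the energies: bounds, behaviour near the centre, existence up to
  \<open>x = 1\<close>\<close>

lemma regD:
  assumes "reg T c u q"
  shows "0 < T" "T \<le> 1" "solves phi 0 T u q" "u 0 = c" "q 0 = 0" "0 \<le> x \<Longrightarrow> x < T \<Longrightarrow> 0 < u x"
    "0 < x \<Longrightarrow> x < T \<Longrightarrow> (u has_real_derivative q x / P1 x) (at x)"
    "0 < x \<Longrightarrow> x < T \<Longrightarrow> (q has_real_derivative - (P2 x * phi (u x))) (at x)"
  using assms by (auto simp: reg_def solves_def)

text \<open>The energy \<open>En\<close> decreases from its limit \<open>Phi c\<close> at the centre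
  and dominates \<open>Phi (u x)\<close>.\<close>

lemma reg_le:
  assumes r: "reg T c u q" and c: "c0 \<le> c" and x: "0 \<le> x" "x < T"
  shows "u x \<le> c"
proof (cases "x = 0")
  case False
  hence x0: "0 < x" using x by simp
  have "En u q x \<le> Phi c"
  proof (rule DERIV_nonpos_le_limit[OF x0])
    fix t assume t: "0 < t" "t \<le> x"
    hence t1: "t < T" "t < 1" using x regD(2)[OF r] by auto
    show "(En u q has_real_derivative - ((q t / P1 t)\<^sup>2 * ((real N - 1) / t - (2 * \<alpha> + 1) * t))) (at t)"
      using t t1 regD[OF r] by (intro En_deriv) auto
    have "(2 * \<alpha> + 1) * t \<le> (real N - 1) * 1" using t t1 alpha_upper alpha_pos by (intro mult_mono) auto
    also have "\<dots> \<le> (real N - 1) / t" using t t1 N by (simp add: le_divide_eq mult_left_le)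
    finally show "- ((q t / P1 t)\<^sup>2 * ((real N - 1) / t - (2 * \<alpha> + 1) * t)) \<le> 0" by simp
  next
    have c: "0 < c" using c c0_pos by simp
    have "isCont Phi c" using DERIV_isCont[OF Phi_deriv[OF c]] .
    hence "((\<lambda>x. Phi (u x)) \<longlongrightarrow> Phi c) (at_right 0)"
      by (rule isCont_tendsto_compose[OF _ reg_u1_tendsto(2)[OF r]])
    hence "((\<lambda>x. (1 - x\<^sup>2) * (q x / P1 x)\<^sup>2 / 2 + Phi (u x)) \<longlongrightarrow> (1 - 0\<^sup>2) * 0\<^sup>2 / 2 + Phi c) (at_right 0)"
      by (intro tendsto_intros reg_u1_tendsto(1)[OF r]) auto
    thus "(En u q \<longlongrightarrow> Phi c) (at_right 0)" by (simp add: En_def[abs_def])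
  qed
  moreover have "Phi (u x) \<le> En u q x"
    unfolding En_def using one_minus_square_pos[of x] x regD(2)[OF r] by auto
  ultimately have "Phi (u x) \<le> Phi c" by simp
  thus ?thesis using Phi_strict_mono[OF c, of "u x"] by (meson not_le)
qed (use regD(4)[OF r] in simp)

text \<open>The first entry keeps \<open>u\<close> within \<open>c / 8\<close> of \<open>c\<close>,
  the second keeps \<open>x * u'\<close> below \<open>\<alpha> * c / 4\<close>; together they leave
  \<open>WW\<close> with half of its leading term.\<close>

definition eps :: real where "eps = min (1 / 8) (\<alpha> / 8)"

lemma eps_pos: "0 < eps" using alpha_pos by (simp add: eps_def)

text \<open>The condition on \<open>c powr (p - 1) * x\<^sup>2\<close> describes the inner region of
  the natural scaling of the equation, in which \<open>u\<close> has not yet moved far from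
  \<open>c\<close>. The lower bound on \<open>WW\<close> makes the loss of \<open>HH\<close>
  quantitative.\<close>

lemma reg_near_0:
  assumes r: "reg T c u q" and c: "c0 \<le> c" and x: "0 < x" "x < T" "x \<le> 1 / 2" and sc: "c powr (p - 1) * x\<^sup>2 \<le> eps"
  shows "c / 2 \<le> u x" "\<bar>x * (q x / P1 x)\<bar> \<le> \<alpha> * c / 4" "x powr \<alpha> * (\<alpha> * c / 4) \<le> WW u q x"
proof -
  have c_pos: "0 < c" using c c0_pos by simp
  have scp: "c powr p * x\<^sup>2 \<le> eps * c"
    using mult_right_mono[OF sc, of c] c_pos powr_p_eq[of c] by (simp add: mult_ac)
  have u1: "\<bar>q t / P1 t\<bar> \<le> 2 * c powr p * t" if t: "0 < t" "t \<le> x" for t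
  proof (rule reg_u1_bound[OF r])
    fix s assume "0 < s" "s < t"
    thus "\<bar>phi (u s)\<bar> \<le> c powr p"
      using t x regD(6)[OF r, of s] by (intro phi_bound c reg_le[OF r c]) auto
  qed (use t x in auto)
  have "\<bar>u x - u 0\<bar> \<le> c powr p * x\<^sup>2 - c powr p * 0\<^sup>2"
  proof (rule abs_le_by_derivative[where f' = "\<lambda>t. q t / P1 t" and g' = "\<lambda>t. 2 * c powr p * t"])
    show "continuous_on {0..x} u" using solvesD(1)[OF regD(3)[OF r]] by (rule continuous_on_subset) (use x in auto)
    fix t assume t: "0 < t" "t < x"
    show "(u has_real_derivative q t / P1 t) (at t)" using regD(7)[OF r] t x by auto
    show "((\<lambda>t. c powr p * t\<^sup>2) has_real_derivative 2 * c powr p * t) (at t)"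
      by (auto intro!: derivative_eq_intros)
    show "\<bar>q t / P1 t\<bar> \<le> 2 * c powr p * t" using u1 t by auto
  qed (use x in \<open>auto intro!: continuous_intros\<close>)
  hence "\<bar>u x - c\<bar> \<le> eps * c" using scp regD(4)[OF r] by simp
  moreover have "eps * c \<le> 1 / 8 * c" using c_pos by (intro mult_right_mono) (auto simp: eps_def)
  ultimately show uc: "c / 2 \<le> u x" using c_pos by linarith
  have "\<bar>x * (q x / P1 x)\<bar> = x * \<bar>q x / P1 x\<bar>" using x by (simp add: abs_mult)
  also have "\<dots> \<le> x * (2 * c powr p * x)" using u1[of x] x by (intro mult_left_mono) auto
  also have "\<dots> = 2 * (c powr p * x\<^sup>2)" by (simp add: power2_eq_square)
  also have "\<dots> \<le> 2 * (eps * c)" using scp by simp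
  also have "\<dots> \<le> 2 * (\<alpha> / 8 * c)" using c_pos by (intro mult_left_mono mult_right_mono) (auto simp: eps_def)
  finally show xb: "\<bar>x * (q x / P1 x)\<bar> \<le> \<alpha> * c / 4" by (simp add: mult_ac)
  have "\<alpha> * (c / 2) \<le> \<alpha> * u x" using uc alpha_pos by (intro mult_left_mono) auto
  moreover have "\<alpha> * (c / 2) = \<alpha> * c / 4 + \<alpha> * c / 4" by simp
  moreover have "v + w \<ge> a" if "\<bar>v\<bar> \<le> a" "z \<le> w" "z = a + a" for v w a z :: real
    using that by linarith
  ultimately have "\<alpha> * c / 4 \<le> x * (q x / P1 x) + \<alpha> * u x" using xb by blast
  thus "x powr \<alpha> * (\<alpha> * c / 4) \<le> WW u q x" unfolding WW_def by (intro mult_left_mono) auto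
qed

lemma reg_HH_tendsto:
  assumes r: "reg T c u q" shows "(HH u q \<longlongrightarrow> 0) (at_right 0)"
proof -
  note u = reg_u1_tendsto[OF r]
  note xa = powr_tendsto_0_at_right[OF alpha_pos]
  have w: "(ww u \<longlongrightarrow> 0) (at_right 0)"
    using tendsto_mult[OF xa u(2)] by (simp add: ww_def[abs_def])
  have "(WW u q \<longlongrightarrow> 0 * (0 * 0 + \<alpha> * c)) (at_right 0)"
    unfolding WW_def[abs_def] by (intro tendsto_intros xa u)
  hence W: "(WW u q \<longlongrightarrow> 0) (at_right 0)" by simp
  have "0 < x powr \<alpha> * u x" if "0 < x" "x < T" for x
    using that regD(6)[OF r, of x] by simp
  hence "\<forall>\<^sub>F x in at_right 0. 0 \<le> ww u x"
    unfolding ww_def eventually_at_right_field using regD(1)[OF r] by (auto intro!: exI[of _ T] less_imp_le)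
  hence wp: "((\<lambda>x. ww u x powr (p + 1)) \<longlongrightarrow> 0) (at_right 0)"
    using tendsto_powr'[OF w, of "\<lambda>_. p + 1" "p + 1"] p_gt_1 by simp
  have "(HH u q \<longlongrightarrow> (1 - 0\<^sup>2) * 0\<^sup>2 / 2 + 0 / (p + 1) - \<beta> * 0\<^sup>2 / 2) (at_right 0)"
    unfolding HH_def[abs_def] using p_gt_1 by (intro tendsto_intros W w wp) auto
  thus ?thesis by simp
qed

text \<open>Inserting the lower bound on \<open>WW\<close> into the derivative of \<open>HH\<close>
  and integrating \<open>t powr (2 * \<alpha> - 1)\<close> from the centre, where \<open>HH\<close>
  tends to \<open>0\<close>, produces the constant \<open>1/32\<close> as \<open>1/16\<close> times
  \<open>1/2\<close>.\<close>

lemma reg_HH_quant: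
  assumes r: "reg T c u q" and c: "c0 \<le> c" and x: "0 < x" "x < T" "x \<le> 1 / 2" and sc: "c powr (p - 1) * x\<^sup>2 \<le> eps"
  shows "HH u q x \<le> - (\<delta> * \<alpha> * c\<^sup>2 / 32 * x powr (2 * \<alpha>))"
proof -
  have c_pos: "0 < c" using c c0_pos by simp
  define k where "k = \<delta> * \<alpha> * c\<^sup>2 / 32"
  have "HH u q x + k * x powr (2 * \<alpha>) \<le> 0"
  proof (rule DERIV_nonpos_le_limit[OF x(1), of "\<lambda>x. HH u q x + k * x powr (2 * \<alpha>)"
        "\<lambda>t. - (\<delta> * (WW u q t)\<^sup>2 / t) + k * (2 * \<alpha> * t powr (2 * \<alpha> - 1))"])
    fix t assume t: "0 < t" "t \<le> x"
    hence t1: "t < T" "t < 1" using x regD(2)[OF r] by auto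
    have "(HH u q has_real_derivative - (\<delta> * (WW u q t)\<^sup>2 / t)) (at t)"
      using t t1 regD[OF r] by (intro HH_deriv) auto
    thus "((\<lambda>x. HH u q x + k * x powr (2 * \<alpha>)) has_real_derivative
        - (\<delta> * (WW u q t)\<^sup>2 / t) + k * (2 * \<alpha> * t powr (2 * \<alpha> - 1))) (at t)"
      using t by (auto intro!: derivative_eq_intros)
    have "t\<^sup>2 \<le> x\<^sup>2" using t by (intro power_mono) auto
    hence "c powr (p - 1) * t\<^sup>2 \<le> eps" using sc mult_left_mono[of "t\<^sup>2" "x\<^sup>2" "c powr (p - 1)"] by simp
    from reg_near_0(3)[OF r c t(1) t1(1) _ this] t x
    have "t powr \<alpha> * (\<alpha> * c / 4) \<le> WW u q t" by simp
    hence "(t powr \<alpha> * (\<alpha> * c / 4))\<^sup>2 \<le> (WW u q t)\<^sup>2"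
      using alpha_pos c_pos t by (intro power_mono) auto
    hence "\<delta> * (t powr \<alpha> * (\<alpha> * c / 4))\<^sup>2 / t \<le> \<delta> * (WW u q t)\<^sup>2 / t"
      using t delta_bounds by (intro divide_right_mono mult_left_mono) auto
    moreover have "(t powr \<alpha>)\<^sup>2 = t powr (2 * \<alpha>)" using t by (simp add: power2_eq_square flip: powr_add)
    hence "\<delta> * (t powr \<alpha> * (\<alpha> * c / 4))\<^sup>2 / t = k * (2 * \<alpha> * t powr (2 * \<alpha> - 1))"
      using t by (simp add: k_def power_mult_distrib powr_diff power2_eq_square)
    ultimately show "- (\<delta> * (WW u q t)\<^sup>2 / t) + k * (2 * \<alpha> * t powr (2 * \<alpha> - 1)) \<le> 0" by simp
  next
    have "((\<lambda>x. x powr (2 * \<alpha>)) \<longlongrightarrow> 0) (at_right (0::real))"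
      using alpha_pos by (intro powr_tendsto_0_at_right) simp
    hence "((\<lambda>x. HH u q x + k * x powr (2 * \<alpha>)) \<longlongrightarrow> 0 + k * 0) (at_right 0)"
      by (intro tendsto_intros reg_HH_tendsto[OF r])
    thus "((\<lambda>x. HH u q x + k * x powr (2 * \<alpha>)) \<longlongrightarrow> 0) (at_right 0)" by simp
  qed
  thus ?thesis by (simp add: k_def)
qed

lemma reg_HH_antimono:
  assumes r: "reg T c u q" and x: "0 < x" "x \<le> y" "y < T"
  shows "HH u q y \<le> HH u q x"
proof (rule DERIV_nonpos_imp_nonincreasing[OF x(2)])
  fix t assume t: "x \<le> t" "t \<le> y"
  have "(HH u q has_real_derivative - (\<delta> * (WW u q t)\<^sup>2 / t)) (at t)"
    using t x regD[OF r] by (intro HH_deriv) auto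
  moreover have "- (\<delta> * (WW u q t)\<^sup>2 / t) \<le> 0" using t x delta_bounds by auto
  ultimately show "\<exists>y. (HH u q has_real_derivative y) (at t) \<and> y \<le> 0" by blast
qed

text \<open>The term with \<open>\<beta>\<close> is the only negative one in \<open>HH\<close>, so
  it must compensate \<open>h\<close>.\<close>

lemma ww_lower_bound:
  assumes x: "0 < x" "x < 1" and u: "0 < u x" and H: "HH u q x \<le> - h" and h: "0 < h"
  shows "sqrt (2 * h / \<beta>) \<le> ww u x"
proof -
  have w: "0 < ww u x" unfolding ww_def using x u by simp
  have "0 \<le> (1 - x\<^sup>2) * (WW u q x)\<^sup>2 / 2" using one_minus_square_pos[of x] x by simp
  moreover have "0 \<le> ww u x powr (p + 1) / (p + 1)" using p_gt_1 by simp
  ultimately have "h \<le> \<beta> * (ww u x)\<^sup>2 / 2" using H unfolding HH_def by linarith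
  hence "2 * h / \<beta> \<le> (ww u x)\<^sup>2" using beta_pos by (simp add: field_simps)
  thus ?thesis using w by (intro real_le_lsqrt) auto
qed

text \<open>Positivity at \<open>T\<close>: by friction \<open>HH\<close> stays below a negative
  constant once away from the centre, which keeps \<open>ww\<close> and hence \<open>u\<close> away
  from \<open>0\<close> up to and including \<open>T\<close>.\<close>

lemma reg_bounds:
  assumes r: "reg T c u q" and c: "c0 \<le> c" and x: "0 \<le> x" "x \<le> T"
  shows "0 < u x" "u x \<le> c"
proof -
  note T = regD(1,2)[OF r]
  have c_pos: "0 < c" using c c0_pos by simp
  note uc = solvesD(1)[OF regD(3)[OF r]]
  have "{0..<T} \<noteq> {}" "closure {0..<T} = {0..T}" using T by auto
  have lim: "(u \<longlongrightarrow> u T) (at_left T)"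
    using uc T by (auto simp: continuous_on at_within_Icc_at_left dest!: bspec[of _ _ T])
  have ev: "\<forall>\<^sub>F t in at_left T. 0 < t \<and> t < T" using T by (auto simp: eventually_at_left_field)
  show "u x \<le> c"
  proof (cases "x = T")
    case True
    have "u T \<le> c"
      by (rule tendsto_upperbound[OF lim]) (use ev in \<open>auto elim!: eventually_mono intro!: reg_le[OF r c]\<close>)
    thus ?thesis using True by simp
  qed (use x reg_le[OF r c] in auto)
  show "0 < u x"
  proof (cases "x = T")
    case True
    \<comment> \<open>A point inside the region of \<open>reg_near_0\<close>, so that
      \<open>HH\<close> is already strictly negative at \<open>y\<close>.\<close>
    define y where "y = min (T / 2) (min (1 / 2) (sqrt (eps / c powr (p - 1))))"
    have y: "0 < y" "y < T" "y \<le> 1 / 2" using T eps_pos c_pos by (auto simp: y_def)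
    have "y\<^sup>2 \<le> (sqrt (eps / c powr (p - 1)))\<^sup>2" using y by (intro power_mono) (auto simp: y_def)
    hence "c powr (p - 1) * y\<^sup>2 \<le> eps" using eps_pos c_pos by (simp add: field_simps)
    from reg_HH_quant[OF r c y this]
    have Hy: "HH u q y \<le> - (\<delta> * \<alpha> * c\<^sup>2 / 32 * y powr (2 * \<alpha>))" .
    define h where "h = \<delta> * \<alpha> * c\<^sup>2 / 32 * y powr (2 * \<alpha>)"
    have h: "0 < h" unfolding h_def using delta_bounds alpha_pos c_pos y by simp
    have low: "sqrt (2 * h / \<beta>) \<le> ww u t" if t: "y < t" "t < T" for t
    proof (rule ww_lower_bound[OF _ _ _ _ h])
      show "HH u q t \<le> - h" using reg_HH_antimono[OF r y(1), of t] t Hy by (simp add: h_def)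
    qed (use t y T regD(6)[OF r] in auto)
    have "(ww u \<longlongrightarrow> T powr \<alpha> * u T) (at_left T)"
      unfolding ww_def[abs_def] using T by (intro tendsto_intros lim) auto
    hence "sqrt (2 * h / \<beta>) \<le> T powr \<alpha> * u T"
      by (rule tendsto_lowerbound) (use low y in \<open>auto simp: eventually_at_left_field\<close>)
    moreover have "0 < sqrt (2 * h / \<beta>)" using h beta_pos by simp
    ultimately have "0 < T powr \<alpha> * u T" by linarith
    thus ?thesis using True T by (simp add: zero_less_mult_iff)
  qed (use x regD(6)[OF r] in auto)
qed

text \<open>The truncation of \<open>phi\<close> to \<open>{0..c + 1}\<close> is globally Lipschitz,
  so the truncated problem is solvable on the whole interval. Up to the first exit from
  \<open>(0, c + 1)\<close> its solution solves the true equation, and \<open>reg_bounds\<close>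
  then rules out an exit.\<close>

lemma regular_solution_exists:
  assumes c: "c0 \<le> c" obtains u q where "reg 1 c u q"
proof -
  have c_pos: "0 < c" using c c0_pos by simp
  define L where "L = p * (c + 1) powr (p - 1) + lam"
  have L: "0 < L" unfolding L_def using p_gt_1 lam_pos by (intro add_nonneg_pos) auto
  define f where "f x = phi (max 0 (min (c + 1) x))" for x
  have fl: "\<bar>f x - f y\<bar> \<le> L * \<bar>x - y\<bar>" for x y
  proof -
    have "\<bar>f x - f y\<bar> \<le> L * \<bar>max 0 (min (c + 1) x) - max 0 (min (c + 1) y)\<bar>"
      unfolding f_def L_def using c_pos by (intro phi_lipschitz) auto
    also have "\<dots> \<le> L * \<bar>x - y\<bar>" using L by (intro mult_left_mono) auto
    finally show ?thesis .
  qed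
  obtain u q where s: "solves f 0 1 u q" "u 0 = c" "q 0 = 0"
    using solves_exists[OF L fl] by blast
  have reg: "reg T c u q" if T: "0 < T" "T \<le> 1" and b: "\<And>x. 0 \<le> x \<Longrightarrow> x < T \<Longrightarrow> 0 < u x \<and> u x < c + 1" for T
  proof -
    have fe: "f (u x) = phi (u x)" if "0 \<le> x" "x < T" for x using b[OF that] by (simp add: f_def)
    have "(q has_real_derivative - (P2 x * phi (u x))) (at x)" if "0 < x" "x < T" for x
      using solvesD(4)[OF s(1), of x] that T fe[of x] by simp
    moreover have "continuous_on {0..T} u" "continuous_on {0..T} q"
      by (rule continuous_on_subset[OF solvesD(1)[OF s(1)]] continuous_on_subset[OF solvesD(2)[OF s(1)]]; use T in simp)+
    moreover have "(u has_real_derivative q x / P1 x) (at x)" if "0 < x" "x < T" for x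
      using solvesD(3)[OF s(1), of x] that T by simp
    ultimately have "solves phi 0 T u q" unfolding solves_def by simp
    thus ?thesis unfolding reg_def using s T b by simp
  qed
  \<comment> \<open>The exit times; the set is closed, so if it were nonempty it would contain a
    first one.\<close>
  define Bd where "Bd = {x\<in>{0..1}. u x \<in> {..0} \<union> {c+1..}}"
  have "Bd = {}"
  proof (rule ccontr)
    assume ne: "Bd \<noteq> {}"
    have "Bd = {0..1} \<inter> u -` ({..0} \<union> {c+1..})" by (auto simp: Bd_def)
    hence cl: "closed Bd"
      using continuous_closed_preimage[OF solvesD(1)[OF s(1)], of "{..0} \<union> {c+1..}"] by (simp add: closed_Un)
    have bb: "bdd_below Bd" unfolding Bd_def by (auto intro!: bdd_belowI[of _ 0])
    define T where "T = Inf Bd"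
    have TB: "T \<in> Bd" unfolding T_def by (rule closed_contains_Inf[OF ne bb cl])
    have T0: "T \<noteq> 0" using TB s(2) c_pos by (auto simp: Bd_def)
    have low: "0 < u x \<and> u x < c + 1" if "0 \<le> x" "x < T" for x
    proof -
      have "x \<notin> Bd" using that cInf_lower[OF _ bb, of x] by (auto simp: T_def)
      thus ?thesis using that TB by (auto simp: Bd_def not_le)
    qed
    have T: "0 < T" "T \<le> 1" using TB T0 by (auto simp: Bd_def)
    from reg_bounds[OF reg[OF T low] c, of T] T have "0 < u T" "u T \<le> c" by auto
    thus False using TB by (auto simp: Bd_def)
  qed
  hence "0 < u x \<and> u x < c + 1" if "0 \<le> x" "x < 1" for x
  proof -
    have "x \<notin> Bd" using \<open>Bd = {}\<close> by simp
    thus ?thesis using that by (simp add: Bd_def not_le)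
  qed
  thus thesis using that reg[of 1] by auto
qed

section \<open>Uniqueness from value and flux, including the singular end points\<close>

lemma solves_subset:
  assumes s: "solves f a y u q" and "a \<le> a'" "y' \<le> y"
  shows "solves f a' y' u q"
proof -
  have sub: "{a'..y'} \<subseteq> {a..y}" using assms by auto
  show ?thesis unfolding solves_def
    using solvesD(3,4)[OF s] assms
      continuous_on_subset[OF solvesD(1)[OF s] sub] continuous_on_subset[OF solvesD(2)[OF s] sub]
    by simp
qed

lemma P1_lower: assumes "0 < a" "a \<le> x" "x < 1" shows "a ^ (N - 1) * (1 - x) powr m \<le> P1 x"
proof -
  have "1 - x \<le> 1 - x\<^sup>2" using assms by (simp add: power2_eq_square mult_left_le)
  hence "(1 - x) powr m \<le> (1 - x\<^sup>2) powr m" using assms m_bounds by (intro powr_mono2) auto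
  thus ?thesis unfolding P1_def using assms by (intro mult_mono power_mono) auto
qed

context
  fixes a y M :: real and u q v r :: "real \<Rightarrow> real"
  assumes u: "solves phi a y u q" and v: "solves phi a y v r" and M: "0 < M"
    and bu: "\<And>x. a < x \<Longrightarrow> x < y \<Longrightarrow> u x \<in> {0..M}" and bv: "\<And>x. a < x \<Longrightarrow> x < y \<Longrightarrow> v x \<in> {0..M}"
begin

definition LL :: real where "LL = p * M powr (p - 1) + lam"

lemma LL_pos: "0 < LL" unfolding LL_def using p_gt_1 lam_pos by (intro add_nonneg_pos) auto

lemma diff_solves:
  shows "continuous_on {a..y} (\<lambda>x. u x - v x)" "continuous_on {a..y} (\<lambda>x. q x - r x)"
    "a < x \<Longrightarrow> x < y \<Longrightarrow> ((\<lambda>x. u x - v x) has_real_derivative 1 / P1 x * (q x - r x)) (at x)"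
    "a < x \<Longrightarrow> x < y \<Longrightarrow> ((\<lambda>x. q x - r x) has_real_derivative - (P2 x * (phi (u x) - phi (v x)))) (at x)"
    "a < x \<Longrightarrow> x < y \<Longrightarrow> 0 \<le> x \<Longrightarrow> P2 x \<le> k \<Longrightarrow> \<bar>- (P2 x * (phi (u x) - phi (v x)))\<bar> \<le> LL * k * \<bar>u x - v x\<bar>"
proof -
  show "continuous_on {a..y} (\<lambda>x. u x - v x)" "continuous_on {a..y} (\<lambda>x. q x - r x)"
    by (intro continuous_intros solvesD[OF u] solvesD[OF v])+
  assume x: "a < x" "x < y"
  show "((\<lambda>x. u x - v x) has_real_derivative 1 / P1 x * (q x - r x)) (at x)"
    using DERIV_diff[OF solvesD(3)[OF u x] solvesD(3)[OF v x]] by (simp add: diff_divide_distrib)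
  show "((\<lambda>x. q x - r x) has_real_derivative - (P2 x * (phi (u x) - phi (v x)))) (at x)"
    using DERIV_diff[OF solvesD(4)[OF u x] solvesD(4)[OF v x]] by (simp add: algebra_simps)
  assume "0 \<le> x" and k: "P2 x \<le> k"
  hence "P2 x * \<bar>phi (u x) - phi (v x)\<bar> \<le> k * (LL * \<bar>u x - v x\<bar>)"
    using phi_lipschitz[OF M bu[OF x] bv[OF x]] P2_nonneg[of x] by (intro mult_mono) (auto simp: LL_def)
  thus "\<bar>- (P2 x * (phi (u x) - phi (v x)))\<bar> \<le> LL * k * \<bar>u x - v x\<bar>"
    using P2_nonneg[of x] \<open>0 \<le> x\<close> by (simp add: abs_mult mult_ac)
qed

text \<open>The case \<open>y = 1\<close> is included. Here \<open>K\<close> is the integral of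
  \<open>(1 - t) powr (m - 1)\<close> from \<open>x\<close> to \<open>y\<close>, at most
  \<open>(1 - x) powr m / m\<close>, which offsets the growth of \<open>1 / P1\<close> at
  \<open>1\<close>.\<close>

lemma backward_unique:
  assumes a: "0 < a" "y \<le> 1" and eq: "u y = v y" "q y = r y" and x: "a \<le> x" "x \<le> y"
  shows "u x = v x"
proof -
  have "\<bar>u x - v x\<bar> \<le> 2 * \<bar>u y - v y\<bar> * exp (2 * LL * (1 / (m * a ^ (N - 1))) * (y - x))"
  proof (rule volterra_bound_left[where d = "\<lambda>x. u x - v x" and e = "\<lambda>x. q x - r x" and a = a and b = y
        and K = "\<lambda>x. ((1 - x) powr m - (1 - y) powr m) / m" and ?k1.0 = "\<lambda>x. 1 / P1 x"
        and ?k2.0 = "\<lambda>x. (1 - x) powr (m - 1)" and e' = "\<lambda>x. - (P2 x * (phi (u x) - phi (v x)))"])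
    show "continuous_on {a..y} (\<lambda>x. ((1 - x) powr m - (1 - y) powr m) / m)"
      using a m_bounds by (intro continuous_on_divide continuous_on_diff continuous_on_powr' continuous_on_const continuous_on_id) auto
    fix t assume t: "a < t" "t < y"
    show "((\<lambda>x. ((1 - x) powr m - (1 - y) powr m) / m) has_real_derivative - ((1 - t) powr (m - 1))) (at t)"
      using t a m_bounds by (auto intro!: derivative_eq_intros)
    show "\<bar>- (P2 t * (phi (u t) - phi (v t)))\<bar> \<le> LL * (1 - t) powr (m - 1) * \<bar>u t - v t\<bar>"
      using t a by (intro diff_solves(5) P2_le') auto
    have P: "a ^ (N - 1) * (1 - t) powr m \<le> P1 t" using t a by (intro P1_lower) auto
    have pos: "0 < a ^ (N - 1) * (1 - t) powr m" using t a by simp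
    have "((1 - t) powr m - (1 - y) powr m) / m \<le> (1 - t) powr m / m"
      using m_bounds by (intro divide_right_mono) auto
    hence "\<bar>1 / P1 t\<bar> * (((1 - t) powr m - (1 - y) powr m) / m) \<le> 1 / (a ^ (N - 1) * (1 - t) powr m) * ((1 - t) powr m / m)"
    proof (rule mult_mono[rotated])
      show "\<bar>1 / P1 t\<bar> \<le> 1 / (a ^ (N - 1) * (1 - t) powr m)" using P pos by (simp add: frac_le)
      have "(1 - y) powr m \<le> (1 - t) powr m" using t a m_bounds by (intro powr_mono2) auto
      thus "0 \<le> ((1 - t) powr m - (1 - y) powr m) / m" using m_bounds by simp
    qed (use pos in simp)
    also have "\<dots> = 1 / (m * a ^ (N - 1))" using t a by simp
    finally show "\<bar>1 / P1 t\<bar> * (((1 - t) powr m - (1 - y) powr m) / m) \<le> 1 / (m * a ^ (N - 1))" .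
  qed (use x eq a m_bounds LL_pos diff_solves in auto)
  thus ?thesis using eq by simp
qed

text \<open>Both ends are away from the singular points, so constant bounds on \<open>1 / P1\<close>
  and \<open>P2\<close> suffice.\<close>

lemma forward_unique:
  assumes a: "0 < a" "a < y" "y < 1" and eq: "u a = v a" "q a = r a" and x: "a \<le> x" "x \<le> y"
  shows "u x = v x"
proof -
  define k where "k = (1 - y) powr (m - 1)"
  define P where "P = a ^ (N - 1) * (1 - y) powr m"
  have k: "0 < k" and P: "0 < P" using a by (auto simp: k_def P_def)
  have "\<bar>u x - v x\<bar> \<le> 2 * \<bar>u a - v a\<bar> * exp (2 * LL * (1 / P * (k * (y - a))) * (x - a))"
  proof (rule volterra_bound[where d = "\<lambda>x. u x - v x" and e = "\<lambda>x. q x - r x" and a = a and b = y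
        and K = "\<lambda>x. k * (x - a)" and ?k1.0 = "\<lambda>x. 1 / P1 x"
        and ?k2.0 = "\<lambda>x. k" and e' = "\<lambda>x. - (P2 x * (phi (u x) - phi (v x)))"])
    fix t assume t: "a < t" "t < y"
    have "P2 t \<le> (1 - t) powr (m - 1)" using t a by (intro P2_le') auto
    also have "\<dots> \<le> k" unfolding k_def using t a m_bounds by (intro powr_mono2') auto
    finally show "\<bar>- (P2 t * (phi (u t) - phi (v t)))\<bar> \<le> LL * k * \<bar>u t - v t\<bar>"
      using t a by (intro diff_solves(5)) auto
    have "P \<le> a ^ (N - 1) * (1 - t) powr m"
      unfolding P_def using t a m_bounds by (intro mult_left_mono powr_mono2) auto
    also have "\<dots> \<le> P1 t" using t a by (intro P1_lower) auto
    finally have "\<bar>1 / P1 t\<bar> \<le> 1 / P" using P by (simp add: frac_le)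
    thus "\<bar>1 / P1 t\<bar> * (k * (t - a)) \<le> 1 / P * (k * (y - a))"
      using t a k P by (intro mult_mono) auto
    show "((\<lambda>x. k * (x - a)) has_real_derivative k) (at t)" by (auto intro!: derivative_eq_intros)
  qed (use x eq a k P LL_pos diff_solves in \<open>auto intro!: continuous_intros\<close>)
  thus ?thesis using eq by simp
qed

text \<open>At the centre \<open>1 / P1\<close> grows like \<open>t ^ (1 - N)\<close>, while the
  primitive of the bound on \<open>P2\<close> decays like \<open>t ^ N\<close>; their product is
  bounded.\<close>

lemma forward_unique_0:
  assumes a: "a = 0" "0 < y" "y \<le> 1 / 2" and eq: "u a = v a" "q a = r a" and x: "0 \<le> x" "x \<le> y"
  shows "u x = v x"
proof -
  have "\<bar>u x - v x\<bar> \<le> 2 * \<bar>u 0 - v 0\<bar> * exp (2 * LL * 4 * (x - 0))"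
  proof (rule volterra_bound[where d = "\<lambda>x. u x - v x" and e = "\<lambda>x. q x - r x" and a = 0 and b = y
        and K = "\<lambda>x. 2 * x ^ N / real N" and ?k1.0 = "\<lambda>x. 1 / P1 x"
        and ?k2.0 = "\<lambda>x. 2 * x ^ (N - 1)" and e' = "\<lambda>x. - (P2 x * (phi (u x) - phi (v x)))"])
    fix t assume t: "0 < t" "t < y"
    show "\<bar>- (P2 t * (phi (u t) - phi (v t)))\<bar> \<le> LL * (2 * t ^ (N - 1)) * \<bar>u t - v t\<bar>"
      using t a by (intro diff_solves(5) P_near_0) auto
    have tN: "t ^ N = t * t ^ (N - 1)" using N by (cases N) auto
    have "0 < t ^ (N - 1) / 2" using t by simp
    hence "1 / P1 t \<le> 1 / (t ^ (N - 1) / 2)" using P_near_0(2)[of t] t a by (intro frac_le) auto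
    hence "\<bar>1 / P1 t\<bar> \<le> 1 / (t ^ (N - 1) / 2)" using P1_pos[of t] t a by simp
    hence "\<bar>1 / P1 t\<bar> * (2 * t ^ N / real N) \<le> 1 / (t ^ (N - 1) / 2) * (2 * t ^ N / real N)"
      using t by (intro mult_right_mono) auto
    also have "\<dots> = 4 * (t / real N)" unfolding tN using t by simp
    also have "\<dots> \<le> 4 * 1" using t a N by (intro mult_left_mono) (auto simp: divide_le_eq)
    finally show "\<bar>1 / P1 t\<bar> * (2 * t ^ N / real N) \<le> 4" by simp
    show "((\<lambda>x. 2 * x ^ N / real N) has_real_derivative 2 * t ^ (N - 1)) (at t)"
      using N by (auto intro!: derivative_eq_intros)
  qed (use x eq a LL_pos diff_solves N in \<open>auto intro!: continuous_intros\<close>)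
  thus ?thesis using eq a by simp
qed

end

section \<open>The singular solution and its flux\<close>

abbreviation uinf :: "real \<Rightarrow> real" where "uinf \<equiv> u_inf N p"

text \<open>The product of \<open>P1\<close> with the derivative of \<open>uinf\<close>, simplified
  to a form that is continuous at \<open>1\<close>, where it vanishes.\<close>

definition qinf :: "real \<Rightarrow> real" where
  "qinf x = - (\<alpha> * b_inf N p) * (x powr (real N - 2 - \<alpha>) * (1 - x\<^sup>2) powr m)"

lemma uinf_pos: "0 < x \<Longrightarrow> 0 < uinf x"
  unfolding u_inf_def using b_inf_pos by simp

lemma uinf_antimono: "0 < x \<Longrightarrow> x \<le> y \<Longrightarrow> uinf y \<le> uinf x"
  unfolding u_inf_def using b_inf_pos alpha_pos by (intro mult_left_mono powr_mono2') auto

lemma phi_uinf: assumes "0 < x" shows "phi (uinf x) = b_inf N p * x powr (- \<alpha>) * (\<beta> / x\<^sup>2 - lam)"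
proof -
  have "uinf x powr (p - 1) = \<beta> * x powr (- (\<alpha> * (p - 1)))"
    unfolding u_inf_def using assms b_inf_pos by (simp add: powr_mult b_inf_powr powr_powr)
  also have "x powr (- (\<alpha> * (p - 1))) = 1 / x\<^sup>2" unfolding alpha_p using assms by (simp add: powr_minus_divide)
  finally have "uinf x powr p = (\<beta> / x\<^sup>2) * uinf x" using powr_p_eq[of "uinf x"] uinf_pos[OF assms] by simp
  thus ?thesis unfolding phi_def by (simp add: u_inf_def algebra_simps)
qed

lemma solves_uinf: assumes "0 < a" "a \<le> y" "y \<le> 1" shows "solves phi a y uinf qinf"
  unfolding solves_def
proof (intro conjI ballI)
  show "continuous_on {a..y} uinf"
    unfolding u_inf_def[abs_def] using assms
    by (intro continuous_on_mult continuous_on_const continuous_on_powr continuous_on_id) auto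
  have "0 \<le> 1 - x\<^sup>2" if "x \<in> {a..y}" for x using that assms by (auto intro: power_le_one)
  thus "continuous_on {a..y} qinf"
    unfolding qinf_def[abs_def] using assms m_bounds
    by (intro continuous_on_mult continuous_on_const continuous_on_powr' continuous_on_id continuous_on_diff continuous_on_power) auto
  fix x assume "x \<in> {a<..<y}"
  hence x: "0 < x" "x < 1" using assms by auto
  note s = one_minus_square_pos[of x]
  have xN: "x ^ (N - 1) = x powr (real N - 1)" using x N by (simp add: of_nat_diff flip: powr_realpow)
  have "(uinf has_real_derivative b_inf N p * (- \<alpha> * x powr (- \<alpha> - 1))) (at x)"
    unfolding u_inf_def[abs_def] using x by (auto intro!: derivative_eq_intros)
  also have "b_inf N p * (- \<alpha> * x powr (- \<alpha> - 1)) = qinf x / P1 x"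
  proof -
    have "x powr (real N - 2 - \<alpha>) / x powr (real N - 1) = x powr (real N - 2 - \<alpha> - (real N - 1))"
      by (rule powr_diff[symmetric])
    also have "real N - 2 - \<alpha> - (real N - 1) = - \<alpha> - 1" by simp
    finally have "x powr (real N - 2 - \<alpha>) / x powr (real N - 1) = x powr (- \<alpha> - 1)" .
    thus ?thesis unfolding qinf_def P1_def xN using s x by (simp add: field_simps)
  qed
  finally show "(uinf has_real_derivative qinf x / P1 x) (at x)" .
  define k where "k = real N - 2 - \<alpha>"
  have "(qinf has_real_derivative - (\<alpha> * b_inf N p) * ((k * x powr (k - 1)) * (1 - x\<^sup>2) powr m
     + (m * (1 - x\<^sup>2) powr (m - 1) * (- (2 * x))) * x powr k)) (at x)"
    unfolding qinf_def[abs_def] k_def[symmetric] using s x by (auto intro!: derivative_eq_intros)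
  also have "(k * x powr (k - 1)) * (1 - x\<^sup>2) powr m + (m * (1 - x\<^sup>2) powr (m - 1) * (- (2 * x))) * x powr k
     = x powr (k - 1) * (1 - x\<^sup>2) powr (m - 1) * (k * (1 - x\<^sup>2) - 2 * m * x\<^sup>2)"
    using s x by (simp add: powr_diff field_simps power2_eq_square)
  also have "- (\<alpha> * b_inf N p) * (x powr (k - 1) * (1 - x\<^sup>2) powr (m - 1) * (k * (1 - x\<^sup>2) - 2 * m * x\<^sup>2))
     = - (b_inf N p * x powr (k - 1) * (1 - x\<^sup>2) powr (m - 1) * (\<alpha> * (k * (1 - x\<^sup>2) - 2 * m * x\<^sup>2)))"
    by simp
  \<comment> \<open>This rests on \<open>k + 2 * m = \<alpha> + 1\<close>.\<close>
  also have "\<alpha> * (k * (1 - x\<^sup>2) - 2 * m * x\<^sup>2) = \<beta> - lam * x\<^sup>2"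
    by (simp add: k_def \<beta>_def lam_def m_def field_simps)
  also have "b_inf N p * x powr (k - 1) * (1 - x\<^sup>2) powr (m - 1) * (\<beta> - lam * x\<^sup>2) = P2 x * phi (uinf x)"
  proof -
    have "x powr (real N - 1) * x powr (- \<alpha>) = x\<^sup>2 * x powr (k - 1)"
    proof -
      have "x powr (real N - 1) * x powr (- \<alpha>) = x powr (real N - 1 + - \<alpha>)" by (rule powr_add[symmetric])
      also have "real N - 1 + - \<alpha> = 2 + (k - 1)" by (simp add: k_def)
      also have "x powr (2 + (k - 1)) = x powr 2 * x powr (k - 1)" by (rule powr_add)
      finally show ?thesis using x by simp
    qed
    moreover have "P2 x * phi (uinf x) = (x powr (real N - 1) * x powr (- \<alpha>)) *
        ((1 - x\<^sup>2) powr (m - 1) * b_inf N p * (\<beta> / x\<^sup>2 - lam))"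
      unfolding phi_uinf[OF x(1)] P2_def xN by (simp add: mult_ac)
    ultimately have "P2 x * phi (uinf x) = x powr (k - 1) * (1 - x\<^sup>2) powr (m - 1) * b_inf N p * (x\<^sup>2 * (\<beta> / x\<^sup>2 - lam))"
      by (simp add: mult_ac)
    moreover have "x\<^sup>2 * (\<beta> / x\<^sup>2 - lam) = \<beta> - lam * x\<^sup>2" using x by (simp add: right_diff_distrib mult.commute)
    ultimately show ?thesis by (simp add: mult_ac)
  qed
  finally show "(qinf has_real_derivative - (P2 x * phi (uinf x))) (at x)" .
qed

section \<open>The family of shooting solutions and its dependence on the central value\<close>

definition sol :: "real \<Rightarrow> (real \<Rightarrow> real) \<times> (real \<Rightarrow> real)" where
  "sol c = (SOME s. reg 1 c (fst s) (snd s))"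
definition U :: "real \<Rightarrow> real \<Rightarrow> real" where "U c = fst (sol c)"
definition Q :: "real \<Rightarrow> real \<Rightarrow> real" where "Q c = snd (sol c)"

lemma reg_U: assumes "c0 \<le> c" shows "reg 1 c (U c) (Q c)"
proof -
  obtain u q where "reg 1 c (fst (u, q)) (snd (u, q))" using regular_solution_exists[OF assms] by auto
  thus ?thesis unfolding U_def Q_def sol_def by (rule someI)
qed

lemma U_bounds: "c0 \<le> c \<Longrightarrow> 0 \<le> x \<Longrightarrow> x \<le> 1 \<Longrightarrow> 0 < U c x" "c0 \<le> c \<Longrightarrow> 0 \<le> x \<Longrightarrow> x \<le> 1 \<Longrightarrow> U c x \<le> c"
  using reg_bounds[OF reg_U] by auto

text \<open>All values involved lie in \<open>{0..M}\<close> because \<open>U c x \<le> c\<close>,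
  so one Lipschitz constant of \<open>phi\<close> works for all parameters up to
  \<open>M\<close>.\<close>

lemma U_lipschitz:
  obtains K where "0 < K" "\<And>c d x. c \<in> {c0..M} \<Longrightarrow> d \<in> {c0..M} \<Longrightarrow> x \<in> {0..1} \<Longrightarrow>
    \<bar>U c x - U d x\<bar> \<le> K * \<bar>c - d\<bar> \<and> \<bar>Q c x - Q d x\<bar> \<le> K * \<bar>c - d\<bar>"
proof -
  define L where "L = p * (max M 1) powr (p - 1) + lam"
  have L: "0 < L" unfolding L_def using p_gt_1 lam_pos by (intro add_nonneg_pos) auto
  define E where "E = 2 * exp (2 * L / m\<^sup>2)"
  have E: "0 < E" by (simp add: E_def)
  have *: "\<bar>U c x - U d x\<bar> \<le> E * \<bar>c - d\<bar> \<and> \<bar>Q c x - Q d x\<bar> \<le> L / m * (E * \<bar>c - d\<bar>)"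
    if c: "c \<in> {c0..M}" "d \<in> {c0..M}" and x: "x \<in> {0..1}" for c d x
  proof -
    have r: "reg 1 c (U c) (Q c)" "reg 1 d (U d) (Q d)" using reg_U c by auto
    have lip: "\<bar>phi (U c x) - phi (U d x)\<bar> \<le> L * \<bar>U c x - U d x\<bar>" if "0 < x" "x < 1" for x
      unfolding L_def using U_bounds[of c x] U_bounds[of d x] c that by (intro phi_lipschitz) auto
    show ?thesis
      using solves_diff_bound[OF regD(3)[OF r(1)] regD(5)[OF r(1)] regD(3)[OF r(2)] regD(5)[OF r(2)] L lip, of x] x
      by (simp add: regD(4)[OF r(1)] regD(4)[OF r(2)] E_def mult_ac)
  qed
  show thesis
  proof (rule that[of "max E (L / m * E)"])
    fix c d x assume "c \<in> {c0..M}" "d \<in> {c0..M}" "x \<in> {0..1::real}"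
    note * = *[OF this]
    have "E * \<bar>c - d\<bar> \<le> max E (L / m * E) * \<bar>c - d\<bar>" "L / m * E * \<bar>c - d\<bar> \<le> max E (L / m * E) * \<bar>c - d\<bar>"
      by (intro mult_right_mono; simp)+
    with * show "\<bar>U c x - U d x\<bar> \<le> max E (L / m * E) * \<bar>c - d\<bar> \<and> \<bar>Q c x - Q d x\<bar> \<le> max E (L / m * E) * \<bar>c - d\<bar>"
      by (simp add: mult.assoc)
  qed (use E in simp)
qed

lemma joint_continuity:
  fixes F :: "real \<Rightarrow> real \<Rightarrow> real"
  assumes S: "\<And>c. c0 \<le> c \<Longrightarrow> continuous_on {0..1} (F c)"
    and lip: "\<And>M. \<exists>K>0. \<forall>c\<in>{c0..M}. \<forall>d\<in>{c0..M}. \<forall>x\<in>{0..1}. \<bar>F c x - F d x\<bar> \<le> K * \<bar>c - d\<bar>"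
  shows "continuous_on ({c0..} \<times> {0..1}) (\<lambda>(c, x). F c x)"
  unfolding continuous_on_iff
proof (intro ballI allI impI)
  fix z :: "real \<times> real" and e :: real assume z: "z \<in> {c0..} \<times> {0..1}" and e: "0 < e"
  obtain c x where zc: "z = (c, x)" by (cases z)
  have c: "c0 \<le> c" and x: "x \<in> {0..1}" using z zc by auto
  obtain K where K: "0 < K" "\<And>c' d y. c' \<in> {c0..c+1} \<Longrightarrow> d \<in> {c0..c+1} \<Longrightarrow> y \<in> {0..1} \<Longrightarrow> \<bar>F c' y - F d y\<bar> \<le> K * \<bar>c' - d\<bar>"
    using lip[of "c + 1"] by blast
  obtain d where d: "0 < d" "\<And>y. y \<in> {0..1} \<Longrightarrow> dist y x < d \<Longrightarrow> dist (F c y) (F c x) < e / 2"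
    using S[OF c] x e unfolding continuous_on_iff by (metis half_gt_zero)
  show "\<exists>d>0. \<forall>w\<in>{c0..} \<times> {0..1}. dist w z < d \<longrightarrow> dist (case w of (c, x) \<Rightarrow> F c x) (case z of (c, x) \<Rightarrow> F c x) < e"
  proof (intro exI[of _ "min d (min 1 (e / (2 * K)))"] conjI ballI impI)
    fix w assume w: "w \<in> {c0..} \<times> {0..1}" "dist w z < min d (min 1 (e / (2 * K)))"
    obtain c' y where wc: "w = (c', y)" by (cases w)
    have "dist c' c \<le> dist w z" "dist y x \<le> dist w z"
      using dist_fst_le[of w z] dist_snd_le[of w z] by (simp_all add: wc zc)
    hence cd: "\<bar>c' - c\<bar> < 1" "\<bar>c' - c\<bar> < e / (2 * K)" "dist y x < d" using w by (auto simp: dist_real_def)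
    have "\<bar>F c' y - F c y\<bar> \<le> K * \<bar>c' - c\<bar>" using K(2)[of c' c y] cd w c wc by auto
    also have "\<dots> < e / 2" using cd K(1) by (simp add: field_simps)
    finally have "\<bar>F c' y - F c y\<bar> < e / 2" .
    moreover have "\<bar>F c y - F c x\<bar> < e / 2" using d(2)[of y] cd w wc by (auto simp: dist_real_def)
    ultimately have "\<bar>F c' y - F c x\<bar> < e" by linarith
    thus "dist (case w of (c, x) \<Rightarrow> F c x) (case z of (c, x) \<Rightarrow> F c x) < e"
      by (simp add: wc zc dist_real_def)
  qed (use d K e in simp)
qed

lemma U_cont: "continuous_on ({c0..} \<times> {0..1}) (\<lambda>(c, x). U c x)"
  and Q_cont: "continuous_on ({c0..} \<times> {0..1}) (\<lambda>(c, x). Q c x)"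
proof -
  have "\<exists>K>0. \<forall>c\<in>{c0..M}. \<forall>d\<in>{c0..M}. \<forall>x\<in>{0..1}. \<bar>U c x - U d x\<bar> \<le> K * \<bar>c - d\<bar> \<and> \<bar>Q c x - Q d x\<bar> \<le> K * \<bar>c - d\<bar>" for M
    by (rule U_lipschitz[of M]) blast
  thus "continuous_on ({c0..} \<times> {0..1}) (\<lambda>(c, x). U c x)" "continuous_on ({c0..} \<times> {0..1}) (\<lambda>(c, x). Q c x)"
    by (intro joint_continuity solvesD(1,2)[OF regD(3)[OF reg_U]]; blast)+
qed

definition vv :: "real \<Rightarrow> real \<Rightarrow> real" where "vv c x = U c x - uinf x"
text \<open>On \<open>(0, 1)\<close> this is \<open>P1\<close> times the derivative of
  \<open>vv c\<close>; unlike that derivative it remains continuous at \<open>1\<close>.\<close>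

definition ee :: "real \<Rightarrow> real \<Rightarrow> real" where "ee c x = Q c x - qinf x"

lemma vv_cont: "continuous_on ({c0..} \<times> {0<..1}) (\<lambda>(c, x). vv c x)"
  and ee_cont: "continuous_on ({c0..} \<times> {0<..1}) (\<lambda>(c, x). ee c x)"
proof -
  have sub: "{c0..} \<times> {0<..1} \<subseteq> {c0..} \<times> {0..1::real}" by auto
  have sq: "0 \<le> 1 - x\<^sup>2" if "x \<in> {0<..1}" for x :: real using that by (auto intro: power_le_one)
  have "continuous_on ({c0..} \<times> {0<..1}) (\<lambda>z. uinf (snd z))"
    unfolding u_inf_def by (intro continuous_on_mult continuous_on_const continuous_on_powr continuous_on_snd continuous_on_id) auto
  thus "continuous_on ({c0..} \<times> {0<..1}) (\<lambda>(c, x). vv c x)"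
    using continuous_on_subset[OF U_cont sub] unfolding vv_def split_beta by (intro continuous_on_diff)
  have "continuous_on ({c0..} \<times> {0<..1}) (\<lambda>z. qinf (snd z))"
    unfolding qinf_def using m_bounds sq
    by (intro continuous_on_mult continuous_on_const continuous_on_powr' continuous_on_diff continuous_on_power continuous_on_snd continuous_on_id)
      auto
  thus "continuous_on ({c0..} \<times> {0<..1}) (\<lambda>(c, x). ee c x)"
    using continuous_on_subset[OF Q_cont sub] unfolding ee_def split_beta by (intro continuous_on_diff)
qed

lemma vv_deriv: "c0 \<le> c \<Longrightarrow> 0 < x \<Longrightarrow> x < 1 \<Longrightarrow> (vv c has_real_derivative ee c x / P1 x) (at x)"
  unfolding vv_def[abs_def] ee_def
  using DERIV_diff[OF regD(7)[OF reg_U, of c x] solvesD(3)[OF solves_uinf[of "x/2" 1], of x]]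
  by (simp add: diff_divide_distrib)

text \<open>The point where \<open>uinf\<close> takes the value \<open>M\<close>. To its left
  \<open>uinf\<close> exceeds \<open>M\<close>, hence every solution with central value at most
  \<open>M\<close>.\<close>

definition xz :: "real \<Rightarrow> real" where "xz M = (b_inf N p / M) powr (1 / \<alpha>)"

lemma vv_neg_near_0:
  assumes "c0 \<le> c" "c \<le> M" "0 < x" "x < xz M" "x \<le> 1" shows "vv c x < 0"
proof -
  have M: "0 < M" using assms c0_pos by simp
  have "x powr \<alpha> < xz M powr \<alpha>" using assms alpha_pos by (intro powr_less_mono2) auto
  also have "\<dots> = b_inf N p / M" unfolding xz_def using alpha_pos b_inf_pos M by (simp add: powr_powr)
  finally have "M < uinf x" unfolding u_inf_def using M assms by (simp add: field_simps powr_minus_divide)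
  thus ?thesis using U_bounds(2)[of c x] assms by (simp add: vv_def)
qed

lemma xz_pos: "0 < M \<Longrightarrow> 0 < xz M" unfolding xz_def using b_inf_pos by simp

text \<open>Equal value and flux at \<open>y\<close> would make \<open>U c\<close> coincide with
  \<open>uinf\<close> on all of \<open>{a..y}\<close>, but at \<open>a\<close>, chosen below
  \<open>xz c\<close>, the singular solution is strictly larger. The case \<open>y = 1\<close> is
  essential for the behaviour of zeros at the end point.\<close>

lemma vv_ee_not_both_zero:
  assumes c: "c0 \<le> c" and y: "0 < y" "y \<le> 1" and "vv c y = 0" "ee c y = 0"
  shows False
proof -
  have cp: "0 < c" using c c0_pos by simp
  define a where "a = min (y / 2) (xz c / 2)"
  have a: "0 < a" "a < y" "a < xz c" using y xz_pos[OF cp] by (auto simp: a_def)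
  have s: "solves phi a y (U c) (Q c)"
    using a y by (intro solves_subset[OF regD(3)[OF reg_U[OF c]]]) auto
  have "U c a = uinf a"
  proof (rule backward_unique[OF s solves_uinf, of "max c (uinf a)"])
    fix x assume x: "a < x" "x < y"
    show "U c x \<in> {0..max c (uinf a)}" using U_bounds[OF c, of x] x a y by auto
    show "uinf x \<in> {0..max c (uinf a)}" using uinf_pos[of x] uinf_antimono[of a x] x a by auto
  qed (use a y cp assms(4,5) in \<open>auto simp: vv_def ee_def\<close>)
  moreover have "vv c a < 0" using a y c by (intro vv_neg_near_0[of c c]) auto
  ultimately show False by (simp add: vv_def)
qed

end

section \<open>Counting zeros\<close>

text \<open>A certificate for a number of zeros consisting of finitely many strict inequalities,
  starting with a negative value. Unlike the zeros themselves it is visibly stable under small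
  changes of \<open>v\<close>.\<close>

primrec alternates :: "(real \<Rightarrow> real) \<Rightarrow> nat \<Rightarrow> real \<Rightarrow> bool" where
  "alternates v 0 x \<longleftrightarrow> 0 < x \<and> v x < 0"
| "alternates v (Suc j) x \<longleftrightarrow> (-1) ^ Suc j * v x < 0 \<and> (\<exists>y<x. alternates v j y)"

lemma alternates_sign: "alternates v j x \<Longrightarrow> (-1) ^ j * v x < 0"
  by (cases j) auto

lemma alternates_pos: "alternates v j x \<Longrightarrow> 0 < x"
  by (induction j arbitrary: x) force+

lemma opposite_signs_zero:
  fixes v :: "real \<Rightarrow> real"
  assumes "x < y" "continuous_on {x..y} v" "v x * v y < 0"
  obtains z where "x < z" "z < y" "v z = 0"
proof -
  have ne: "v x \<noteq> 0" "v y \<noteq> 0" using assms(3) by auto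
  obtain z where z: "x \<le> z" "z \<le> y" "v z = 0"
  proof (cases "v x < 0")
    case True
    hence "0 < v y" using assms(3) by (simp add: mult_less_0_iff)
    thus thesis using True IVT'[of v x 0 y] assms that by force
  next
    case False
    hence "v y < 0" using assms(3) ne by (simp add: mult_less_0_iff)
    thus thesis using False IVT2'[of v y 0 x] assms that by force
  qed
  thus thesis using that ne by (metis less_eq_real_def)
qed

lemma same_sign_no_zero:
  fixes v :: "real \<Rightarrow> real"
  assumes "x \<le> y" "continuous_on {x..y} v" "\<And>z. x \<le> z \<Longrightarrow> z \<le> y \<Longrightarrow> v z \<noteq> 0"
  shows "0 < v x * v y"
proof (rule ccontr)
  assume "\<not> 0 < v x * v y"
  moreover have "v x \<noteq> 0" "v y \<noteq> 0" using assms by auto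
  ultimately have n: "v x * v y < 0" by (simp add: not_less less_le)
  have "x \<noteq> y" using n by (auto simp: mult_less_0_iff)
  then obtain z where "x < z" "z < y" "v z = 0" using opposite_signs_zero[OF _ assms(2) n] assms(1) by force
  thus False using assms(3)[of z] by simp
qed

text \<open>The intermediate value theorem gives a zero between consecutive points of the
  pattern.\<close>

lemma alternates_imp_card:
  assumes "alternates v j x" "x < 1" and v: "continuous_on {0<..<1} v" and fin: "finite {x\<in>{0<..<1}. v x = 0}"
  shows "j \<le> card ({z\<in>{0<..<1}. v z = 0} \<inter> {..<x})"
  using assms(1,2)
proof (induction j arbitrary: x)
  case (Suc j)
  then obtain y where y: "y < x" "alternates v j y" by auto
  have s1: "(-1) ^ j * v y < 0" by (rule alternates_sign[OF y(2)])
  have s2: "(-1) ^ Suc j * v x < 0" using Suc.prems by simp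
  have y0: "0 < y" by (rule alternates_pos[OF y(2)])
  have "v y * v x < 0"
  proof -
    have "0 < ((-1) ^ j * v y) * ((-1) ^ Suc j * v x)" by (rule mult_neg_neg[OF s1 s2])
    also have "\<dots> = - (((-1) ^ j * (-1) ^ j) * (v y * v x))" by simp
    also have "(-1) ^ j * (-1) ^ j = (1::real)" by (simp flip: power_mult_distrib)
    finally show ?thesis by simp
  qed
  moreover have "continuous_on {y..x} v" by (rule continuous_on_subset[OF v]) (use y0 Suc.prems in auto)
  ultimately obtain z where z: "y < z" "z < x" "v z = 0" using opposite_signs_zero y(1) by blast
  have "card ({z\<in>{0<..<1}. v z = 0} \<inter> {..<y}) < card ({z\<in>{0<..<1}. v z = 0} \<inter> {..<x})"
  proof (rule psubset_card_mono)
    show "finite ({z\<in>{0<..<1}. v z = 0} \<inter> {..<x})" using fin by simp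
    have "z \<in> {z\<in>{0<..<1}. v z = 0} \<inter> {..<x}" "z \<notin> {z\<in>{0<..<1}. v z = 0} \<inter> {..<y}"
      using z y0 Suc.prems by auto
    thus "{z\<in>{0<..<1}. v z = 0} \<inter> {..<y} \<subset> {z\<in>{0<..<1}. v z = 0} \<inter> {..<x}" using y(1) by auto
  qed
  moreover have "j \<le> card ({z\<in>{0<..<1}. v z = 0} \<inter> {..<y})" using Suc.IH[OF y(2)] y(1) Suc.prems by simp
  ultimately show ?case by simp
qed simp

text \<open>Induction on the number of zeros: drop the last zero \<open>z\<close> before
  \<open>x\<close>, apply the hypothesis just to the left of \<open>z\<close>, and use that the sign
  changes at \<open>z\<close> and then persists up to \<open>x\<close>.\<close>

lemma card_imp_alternates:
  assumes v: "continuous_on {0<..<1} v" and fin: "finite {z\<in>{0<..<1}. v z = 0}"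
    and neg: "0 < \<xi>" "\<And>x. 0 < x \<Longrightarrow> x < \<xi> \<Longrightarrow> v x < 0"
    and chg: "\<And>z. 0 < z \<Longrightarrow> z < 1 \<Longrightarrow> v z = 0 \<Longrightarrow> \<exists>\<eta>>0. \<forall>h\<in>{0<..<\<eta>}. \<forall>k\<in>{0<..<\<eta>}. v (z - h) * v (z + k) < 0"
    and x: "0 < x" "x < 1" "v x \<noteq> 0"
  shows "alternates v (card ({z\<in>{0<..<1}. v z = 0} \<inter> {..<x})) x"
proof -
  define S where "S = {z\<in>{0<..<1}. v z = 0}"
  have main: "alternates v j x" if "j = card (S \<inter> {..<x})" "0 < x" "x < 1" "v x \<noteq> 0" for j x
    using that
  proof (induction j arbitrary: x)
    case 0
    hence "S \<inter> {..<x} = {}" using fin by (simp add: S_def)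
    hence nz: "v z \<noteq> 0" if "0 < z" "z \<le> x" for z using that 0 by (cases "z = x") (auto simp: S_def)
    define y where "y = min x (\<xi> / 2)"
    have y: "0 < y" "y \<le> x" "v y < 0" using 0 neg by (auto simp: y_def)
    have "0 < v y * v x"
      by (rule same_sign_no_zero[OF y(2) continuous_on_subset[OF v]]) (use y 0 nz in auto)
    thus ?case using y 0 by (simp add: zero_less_mult_iff)
  next
    case (Suc j)
    have finx: "finite (S \<inter> {..<x})" using fin by (simp add: S_def)
    have ne: "S \<inter> {..<x} \<noteq> {}" using Suc.prems(1) by (metis card.empty nat.distinct(1))
    define z where "z = Max (S \<inter> {..<x})"
    have zS: "z \<in> S" "z < x" using Max_in[OF finx ne] by (auto simp: z_def)
    have z01: "0 < z" "z < 1" "v z = 0" using zS by (auto simp: S_def)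
    have zmax: "w \<le> z" if "w \<in> S" "w < x" for w using Max_ge[OF finx] that by (auto simp: z_def)
    obtain \<eta> where \<eta>: "0 < \<eta>" "\<forall>h\<in>{0<..<\<eta>}. \<forall>k\<in>{0<..<\<eta>}. v (z - h) * v (z + k) < 0"
      using chg[OF z01] by blast
    \<comment> \<open>The zero preceding \<open>z\<close>, or \<open>0\<close> if there is none;
      \<open>z - h\<close> lies strictly between the two, so exactly \<open>z\<close> is lost from
      the count.\<close>
    define w where "w = Max (insert 0 (S \<inter> {..<z}))"
    have finz: "finite (insert 0 (S \<inter> {..<z}))" using fin by (simp add: S_def)
    have wz: "0 \<le> w" "w < z" using Max_in[OF finz] z01 Max_ge[OF finz, of 0] by (auto simp: w_def)
    have wmax: "s \<le> w" if "s \<in> S" "s < z" for s using Max_ge[OF finz, of s] that by (auto simp: w_def)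
    define h where "h = min (\<eta> / 2) ((z - w) / 2)"
    have h: "0 < h" "h < \<eta>" "w < z - h" using \<eta> wz by (auto simp: h_def min_def field_simps)
    define k where "k = min (\<eta> / 2) ((x - z) / 2)"
    have k: "0 < k" "k < \<eta>" "z + k < x" using \<eta> zS by (auto simp: k_def min_def field_simps)
    have t: "0 < z - h" "z - h < 1" using h wz z01 by auto
    have vt: "v (z - h) \<noteq> 0"
    proof
      assume "v (z - h) = 0"
      hence "z - h \<in> S" using t by (auto simp: S_def)
      thus False using wmax[of "z - h"] h by auto
    qed
    have "S \<inter> {..<z - h} = S \<inter> {..<x} - {z}" using wmax zmax h zS by force
    hence "card (S \<inter> {..<z - h}) = j" using Suc.prems(1) zS finx by simp
    from Suc.IH[OF this[symmetric] t vt] have alt: "alternates v j (z - h)" .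
    have "0 < v (z + k) * v x"
    proof (rule same_sign_no_zero[where v = v])
      show "continuous_on {z + k..x} v" by (rule continuous_on_subset[OF v]) (use z01 k Suc.prems in auto)
      fix s assume s: "z + k \<le> s" "s \<le> x"
      show "v s \<noteq> 0"
      proof (cases "s = x")
        case False
        thus ?thesis using zmax[of s] s k z01 Suc.prems by (auto simp: S_def)
      qed (use Suc.prems in simp)
    qed (use k in simp)
    moreover have "v (z - h) * v (z + k) < 0" using \<eta>(2) h k by auto
    ultimately have opp: "v (z - h) * v x < 0" by (auto simp: mult_less_0_iff zero_less_mult_iff)
    have "(-1) ^ Suc j * v x < 0"
    proof -
      have "((-1) ^ j * v (z - h)) * ((-1) ^ j * v x) = ((-1) ^ j * (-1) ^ j) * (v (z - h) * v x)" by simp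
      also have "(-1) ^ j * (-1) ^ j = (1::real)" by (simp flip: power_mult_distrib)
      finally have "((-1) ^ j * v (z - h)) * ((-1) ^ j * v x) < 0" using opp by (simp only: mult_1)
      thus ?thesis using alternates_sign[OF alt] by (simp add: mult_less_0_iff)
    qed
    moreover have "z - h < x" using h zS by simp
    ultimately show ?case using alt by auto
  qed
  show ?thesis using main[OF refl, of x] x by (simp add: S_def)
qed

lemma continuous_on_nonzero_nbhd:
  fixes F :: "'a::metric_space \<Rightarrow> real"
  assumes "continuous_on S F" "z \<in> S" "F z \<noteq> 0"
  obtains d where "0 < d" "\<And>w. w \<in> S \<Longrightarrow> dist w z < d \<Longrightarrow> 0 < F w * F z"
proof -
  obtain d where d: "0 < d" "\<And>w. w \<in> S \<Longrightarrow> dist w z < d \<Longrightarrow> dist (F w) (F z) < \<bar>F z\<bar>"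
    using assms unfolding continuous_on_iff by (metis zero_less_abs_iff)
  show thesis
  proof (rule that[OF d(1)])
    fix w assume "w \<in> S" "dist w z < d"
    from d(2)[OF this] show "0 < F w * F z"
      by (auto simp: dist_real_def zero_less_mult_iff abs_if split: if_splits)
  qed
qed

lemma box_in_ball: "\<bar>c' - c\<bar> < d / 2 \<Longrightarrow> \<bar>x - y\<bar> < d / 2 \<Longrightarrow> dist (c', x) (c, y) < (d::real)"
  using sqrt_sum_squares_le_sum_abs[of "c' - c" "x - y"] by (simp add: dist_Pair_Pair dist_real_def)

section \<open>Semicontinuity of the number of zeros in the parameter\<close>

context wave begin

text \<open>Two counts are kept, without and with the end point \<open>1\<close>:
  \<open>card (Z c)\<close> can only jump up under small changes of \<open>c\<close>,
  \<open>card (Zb c)\<close> only down.\<close>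

definition Z :: "real \<Rightarrow> real set" where "Z c = {x\<in>{0<..<1}. vv c x = 0}"
definition Zb :: "real \<Rightarrow> real set" where "Zb c = {x\<in>{0<..1}. vv c x = 0}"

lemma vv_cont_x: assumes "c0 \<le> c" shows "continuous_on {0<..1} (vv c)"
proof -
  have "continuous_on {0<..1} (\<lambda>x. case (c, x) of (c, x) \<Rightarrow> vv c x)"
    by (rule continuous_on_compose2[OF vv_cont]) (use assms in \<open>auto intro!: continuous_intros\<close>)
  thus ?thesis by simp
qed

lemma ee_cont_x: assumes "c0 \<le> c" shows "continuous_on {0<..1} (ee c)"
proof -
  have "continuous_on {0<..1} (\<lambda>x. case (c, x) of (c, x) \<Rightarrow> ee c x)"
    by (rule continuous_on_compose2[OF ee_cont]) (use assms in \<open>auto intro!: continuous_intros\<close>)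
  thus ?thesis by simp
qed

text \<open>Near \<open>(c, y)\<close> one of \<open>vv\<close> and \<open>ee\<close> stays nonzero.
  If it is \<open>ee\<close>, then two zeros of \<open>vv c'\<close> would produce a zero of
  \<open>ee c'\<close> between them by the mean value theorem. Nothing changes in this argument for
  \<open>y = 1\<close>.\<close>

lemma zeros_local:
  assumes c: "c0 \<le> c" and y: "0 < y" "y \<le> 1"
  obtains d where "0 < d"
    "\<And>c' x. vv c y \<noteq> 0 \<Longrightarrow> c0 \<le> c' \<Longrightarrow> \<bar>c' - c\<bar> < d \<Longrightarrow> 0 < x \<Longrightarrow> x \<le> 1 \<Longrightarrow> \<bar>x - y\<bar> < d \<Longrightarrow> vv c' x \<noteq> 0"
    "\<And>c' x x'. c0 \<le> c' \<Longrightarrow> \<bar>c' - c\<bar> < d \<Longrightarrow> 0 < x \<Longrightarrow> x \<le> 1 \<Longrightarrow> 0 < x' \<Longrightarrow> x' \<le> 1 \<Longrightarrow>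
      \<bar>x - y\<bar> < d \<Longrightarrow> \<bar>x' - y\<bar> < d \<Longrightarrow> vv c' x = 0 \<Longrightarrow> vv c' x' = 0 \<Longrightarrow> x = x'"
proof (cases "vv c y = 0")
  case False
  obtain d where d: "0 < d" "\<And>w. w \<in> {c0..} \<times> {0<..1} \<Longrightarrow> dist w (c, y) < d \<Longrightarrow>
      0 < (case w of (c, x) \<Rightarrow> vv c x) * (case (c, y) of (c, x) \<Rightarrow> vv c x)"
    using continuous_on_nonzero_nbhd[OF vv_cont, of "(c, y)"] False c y by auto
  have nz: "vv c' x \<noteq> 0" if "c0 \<le> c'" "\<bar>c' - c\<bar> < d / 2" "0 < x" "x \<le> 1" "\<bar>x - y\<bar> < d / 2" for c' x
    using d(2)[of "(c', x)"] box_in_ball[OF that(2,5)] that by auto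
  show thesis by (rule that[of "d / 2"]) (use d nz in auto)
next
  case True
  hence "ee c y \<noteq> 0" using vv_ee_not_both_zero[OF c y] by blast
  then obtain d where d: "0 < d" "\<And>w. w \<in> {c0..} \<times> {0<..1} \<Longrightarrow> dist w (c, y) < d \<Longrightarrow>
      0 < (case w of (c, x) \<Rightarrow> ee c x) * (case (c, y) of (c, x) \<Rightarrow> ee c x)"
    using continuous_on_nonzero_nbhd[OF ee_cont, of "(c, y)"] c y by auto
  have nz: "ee c' x \<noteq> 0" if "c0 \<le> c'" "\<bar>c' - c\<bar> < d / 2" "0 < x" "x \<le> 1" "\<bar>x - y\<bar> < d / 2" for c' x
    using d(2)[of "(c', x)"] box_in_ball[OF that(2,5)] that by auto
  have inj: False if h: "c0 \<le> c'" "\<bar>c' - c\<bar> < d / 2" "0 < x" "x' \<le> 1" "\<bar>x - y\<bar> < d / 2" "\<bar>x' - y\<bar> < d / 2"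
      "vv c' x = 0" "vv c' x' = 0" "x < x'" for c' x x'
  proof -
    have D: "(vv c' has_real_derivative ee c' t / P1 t) (at t)" if "x < t" "t < x'" for t
      using h that by (intro vv_deriv) auto
    have "continuous_on {x..x'} (vv c')" by (rule continuous_on_subset[OF vv_cont_x]) (use h in auto)
    moreover have "vv c' differentiable (at t)" if "x < t" "t < x'" for t
      using D[OF that] real_differentiable_def by blast
    ultimately obtain l t where t: "x < t" "t < x'" "(vv c' has_real_derivative l) (at t)" "vv c' x' - vv c' x = (x' - x) * l"
      using MVT[OF h(9), of "vv c'"] by blast
    have "ee c' t / P1 t = 0" using DERIV_unique[OF t(3) D[OF t(1,2)]] t(4) h by auto
    hence "ee c' t = 0" using P1_pos[of t] h t by auto
    moreover have "\<bar>t - y\<bar> < d / 2" using h(5,6) t(1,2) by linarith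
    ultimately show False using nz[of c' t] h t by auto
  qed
  show thesis
  proof (rule that[of "d / 2"])
    fix c' x x' assume "c0 \<le> c'" "\<bar>c' - c\<bar> < d / 2" "0 < x" "x \<le> 1" "0 < x'" "x' \<le> 1"
      "\<bar>x - y\<bar> < d / 2" "\<bar>x' - y\<bar> < d / 2" "vv c' x = 0" "vv c' x' = 0"
    thus "x = x'" using inj[of c' x x'] inj[of c' x' x] by (cases x x' rule: linorder_cases) auto
  qed (use d True in auto)
qed

text \<open>Cover \<open>{\<xi>..1}\<close> by finitely many of the neighbourhoods from
  \<open>zeros_local\<close>. Each zero for \<open>c'\<close> lies in the neighbourhood of some
  centre, which must be a zero for \<open>c\<close>, and no neighbourhood holds two.\<close>

lemma Zb_usc:
  assumes c: "c0 \<le> c"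
  obtains d where "0 < d" "\<And>c'. c0 \<le> c' \<Longrightarrow> \<bar>c' - c\<bar> < d \<Longrightarrow> finite (Zb c') \<and> card (Zb c') \<le> card (Zb c)"
proof -
  \<comment> \<open>No solution with central value at most \<open>c + 1\<close> meets
    \<open>uinf\<close> to the left of \<open>\<xi>\<close>, which confines the zeros to a compact
    set.\<close>
  define \<xi> where "\<xi> = min 1 (xz (c + 1))"
  have \<xi>: "0 < \<xi>" "\<xi> \<le> 1" using xz_pos[of "c + 1"] c c0_pos by (auto simp: \<xi>_def)
  define good where "good y d \<longleftrightarrow> 0 < d \<and>
     (\<forall>c' x. vv c y \<noteq> 0 \<and> c0 \<le> c' \<and> \<bar>c' - c\<bar> < d \<and> 0 < x \<and> x \<le> 1 \<and> \<bar>x - y\<bar> < d \<longrightarrow> vv c' x \<noteq> 0) \<and>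
     (\<forall>c' x x'. c0 \<le> c' \<and> \<bar>c' - c\<bar> < d \<and> 0 < x \<and> x \<le> 1 \<and> 0 < x' \<and> x' \<le> 1 \<and>
      \<bar>x - y\<bar> < d \<and> \<bar>x' - y\<bar> < d \<and> vv c' x = 0 \<and> vv c' x' = 0 \<longrightarrow> x = x')" for y d
  have "\<exists>d. good y d" if y: "0 < y" "y \<le> 1" for y
    unfolding good_def by (rule zeros_local[OF c y]) blast
  hence "\<forall>y\<in>{0<..1}. \<exists>d. good y d" by simp
  then obtain D where "\<forall>y\<in>{0<..1}. good y (D y)" using bchoice[of "{0<..1}" good] by blast
  hence good: "good y (D y)" if "0 < y" "y \<le> 1" for y using that by simp
  have D1: "0 < D y" if "0 < y" "y \<le> 1" for y
    using good[OF that] unfolding good_def by blast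
  have D2: "vv c' x \<noteq> 0" if y: "0 < y" "y \<le> 1" and h: "vv c y \<noteq> 0" "c0 \<le> c'" "\<bar>c' - c\<bar> < D y" "0 < x" "x \<le> 1" "\<bar>x - y\<bar> < D y"
    for y c' x using good[OF y] h unfolding good_def by blast
  have D3: "x = x'" if y: "0 < y" "y \<le> 1" and h: "c0 \<le> c'" "\<bar>c' - c\<bar> < D y" "0 < x" "x \<le> 1" "0 < x'" "x' \<le> 1"
      "\<bar>x - y\<bar> < D y" "\<bar>x' - y\<bar> < D y" "vv c' x = 0" "vv c' x' = 0" for y c' x x'
    using good[OF y] h unfolding good_def by blast
  have cov: "y \<in> ball y (D y)" if "y \<in> {\<xi>..1}" for y using D1[of y] that \<xi> by simp
  have "compact {\<xi>..1}" by simp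
  then obtain Y where Y: "Y \<subseteq> {\<xi>..1}" "finite Y" "{\<xi>..1} \<subseteq> (\<Union>y\<in>Y. ball y (D y))"
    by (rule compactE_image[of "{\<xi>..1}" "{\<xi>..1}" "\<lambda>y. ball y (D y)"]) (use cov in blast)+
  \<comment> \<open>The inserted \<open>1\<close> keeps \<open>c'\<close> below
    \<open>c + 1\<close>, as the choice of \<open>\<xi>\<close> requires.\<close>
  define d where "d = Min (insert 1 (D ` Y))"
  have finD: "finite (insert 1 (D ` Y))" using Y by simp
  have d: "d \<le> 1" "\<And>y. y \<in> Y \<Longrightarrow> d \<le> D y" unfolding d_def using Min_le[OF finD] by auto
  have "\<forall>x\<in>insert 1 (D ` Y). 0 < x" using D1 Y(1) \<xi> by fastforce
  hence d0: "0 < d" unfolding d_def using Min_in[OF finD] by blast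
  have main: "\<exists>f. inj_on f (Zb c') \<and> f ` Zb c' \<subseteq> {y\<in>Y. vv c y = 0}" if c': "c0 \<le> c'" "\<bar>c' - c\<bar> < d" for c'
  proof -
    have cov: "\<exists>y\<in>Y. \<bar>x - y\<bar> < D y" if x: "x \<in> Zb c'" for x
    proof -
      have x1: "0 < x" "x \<le> 1" "vv c' x = 0" using x by (auto simp: Zb_def)
      have "\<xi> \<le> x" using vv_neg_near_0[of c' "c + 1" x] x1 c' d by (force simp: \<xi>_def)
      thus ?thesis using subsetD[OF Y(3), of x] x1 by (auto simp: dist_real_def abs_minus_commute)
    qed
    then obtain f where f: "\<And>x. x \<in> Zb c' \<Longrightarrow> f x \<in> Y \<and> \<bar>x - f x\<bar> < D (f x)" by metis
    have Y1: "0 < y" "y \<le> 1" "\<bar>c' - c\<bar> < D y" if "y \<in> Y" for y using that Y(1) \<xi> d(2)[OF that] c' by auto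
    have z: "0 < x" "x \<le> 1" "vv c' x = 0" if "x \<in> Zb c'" for x using that by (auto simp: Zb_def)
    have "inj_on f (Zb c')"
    proof (rule inj_onI)
      fix x x' assume x: "x \<in> Zb c'" "x' \<in> Zb c'" "f x = f x'"
      show "x = x'"
        by (rule D3[of "f x" c' x x']) (use f[OF x(1)] f[OF x(2)] x(3) Y1[of "f x"] z[OF x(1)] z[OF x(2)] c' in auto)
    qed
    moreover have "vv c (f x) = 0" if x: "x \<in> Zb c'" for x
      using D2[of "f x" c' x] f[OF x] Y1[of "f x"] z[OF x] c' by auto
    ultimately show ?thesis using f by (intro exI[of _ f]) auto
  qed
  have finY: "finite {y\<in>Y. vv c y = 0}" using Y by simp
  have finc: "finite (Zb c')" if c': "c0 \<le> c'" "\<bar>c' - c\<bar> < d" for c'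
    using main[OF c'] finY by (meson finite_imageD finite_subset)
  have "{y\<in>Y. vv c y = 0} \<subseteq> Zb c" using Y(1) \<xi> by (auto simp: Zb_def)
  hence cY: "card {y\<in>Y. vv c y = 0} \<le> card (Zb c)" using finc[OF c] d0 by (intro card_mono) auto
  show thesis
  proof (rule that[OF d0])
    fix c' assume c': "c0 \<le> c'" "\<bar>c' - c\<bar> < d"
    have "card (Zb c') \<le> card {y\<in>Y. vv c y = 0}" using main[OF c'] finY by (meson card_inj_on_le)
    thus "finite (Zb c') \<and> card (Zb c') \<le> card (Zb c)" using finc[OF c'] cY by simp
  qed
qed

lemma Zb_finite: "c0 \<le> c \<Longrightarrow> finite (Zb c)"
  by (rule Zb_usc[of c]) auto

lemma Z_finite: "c0 \<le> c \<Longrightarrow> finite (Z c)"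
  by (rule finite_subset[OF _ Zb_finite[of c]]) (auto simp: Z_def Zb_def)

lemma card_Zb: assumes "c0 \<le> c" shows "card (Zb c) = card (Z c) + (if vv c 1 = 0 then 1 else 0)"
proof -
  have "Zb c = (if vv c 1 = 0 then insert 1 (Z c) else Z c)"
    by (auto simp: Zb_def Z_def less_le)
  moreover have "1 \<notin> Z c" by (simp add: Z_def)
  ultimately show ?thesis using Z_finite[OF assms] by simp
qed

text \<open>Every zero is simple, because value and flux do not vanish together.\<close>

lemma vv_sign_change:
  assumes c: "c0 \<le> c" and z: "0 < z" "z < 1" "vv c z = 0"
  shows "\<exists>\<eta>>0. \<forall>h\<in>{0<..<\<eta>}. \<forall>k\<in>{0<..<\<eta>}. vv c (z - h) * vv c (z + k) < 0"
proof -
  define l where "l = ee c z / P1 z"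
  have D: "(vv c has_real_derivative l) (at z)" unfolding l_def by (rule vv_deriv[OF c z(1,2)])
  have "l \<noteq> 0" using vv_ee_not_both_zero[OF c z(1) _ z(3)] P1_pos[OF z(1,2)] z by (auto simp: l_def)
  then consider "0 < l" | "l < 0" by linarith
  thus ?thesis
  proof cases
    case 1
    obtain d1 where d1: "0 < d1" "\<forall>h>0. h < d1 \<longrightarrow> vv c z < vv c (z + h)" using DERIV_pos_inc_right[OF D 1] by blast
    obtain d2 where d2: "0 < d2" "\<forall>h>0. h < d2 \<longrightarrow> vv c (z - h) < vv c z" using DERIV_pos_inc_left[OF D 1] by blast
    show ?thesis using d1 d2 z(3) by (intro exI[of _ "min d1 d2"]) (auto intro!: mult_neg_pos)
  next
    case 2
    obtain d1 where d1: "0 < d1" "\<forall>h>0. h < d1 \<longrightarrow> vv c (z + h) < vv c z" using DERIV_neg_dec_right[OF D 2] by blast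
    obtain d2 where d2: "0 < d2" "\<forall>h>0. h < d2 \<longrightarrow> vv c z < vv c (z - h)" using DERIV_neg_dec_left[OF D 2] by blast
    show ?thesis using d1 d2 z(3) by (intro exI[of _ "min d1 d2"]) (auto intro!: mult_pos_neg)
  qed
qed

text \<open>To the right of the last zero the sign pattern has its full length.\<close>

lemma alternates_near_1:
  assumes c: "c0 \<le> c"
  obtains t where "0 < t" "t < 1" "\<And>x. t < x \<Longrightarrow> x < 1 \<Longrightarrow> alternates (vv c) (card (Z c)) x"
proof -
  \<comment> \<open>The inserted \<open>1/2\<close> makes the maximum meaningful when there are no
    zeros.\<close>
  define t where "t = Max (insert (1/2) (Z c))"
  have fin: "finite (insert (1/2) (Z c))" using Z_finite[OF c] by simp
  have t: "1/2 \<le> t" "t < 1" using Max_ge[OF fin, of "1/2"] Max_in[OF fin] by (auto simp: t_def Z_def)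
  have tm: "z \<le> t" if "z \<in> Z c" for z using Max_ge[OF fin, of z] that by (simp add: t_def)
  show thesis
  proof (rule that[of t])
    fix x assume x: "t < x" "x < 1"
    have nz: "vv c x \<noteq> 0" using tm[of x] x t by (auto simp: Z_def)
    have cp: "0 < c" using c c0_pos by simp
    have "alternates (vv c) (card ({z\<in>{0<..<1}. vv c z = 0} \<inter> {..<x})) x"
    proof (rule card_imp_alternates)
      show "continuous_on {0<..<1} (vv c)" by (rule continuous_on_subset[OF vv_cont_x[OF c]]) auto
      show "finite {z\<in>{0<..<1}. vv c z = 0}" using Z_finite[OF c] by (simp add: Z_def)
      show "0 < min 1 (xz c)" using xz_pos[OF cp] by simp
    qed (use x t nz vv_neg_near_0[OF c order_refl] vv_sign_change[OF c] in auto)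
    moreover have "{z\<in>{0<..<1}. vv c z = 0} \<inter> {..<x} = Z c" using tm x by (force simp: Z_def)
    ultimately show "alternates (vv c) (card (Z c)) x" by simp
  qed (use t in auto)
qed

lemma alternates_open:
  assumes c: "c0 \<le> c" and "alternates (vv c) j x" "x < 1"
  shows "\<exists>d>0. \<forall>c'\<ge>c0. \<bar>c' - c\<bar> < d \<longrightarrow> alternates (vv c') j x"
proof -
  have sgn: "\<exists>d>0. \<forall>c'\<ge>c0. \<bar>c' - c\<bar> < d \<longrightarrow> (-1) ^ j * vv c' x < 0"
    if h: "(-1) ^ j * vv c x < 0" "0 < x" "x < 1" for j x
  proof -
    have "vv c x \<noteq> 0" using h by auto
    then obtain d where d: "0 < d" "\<And>w. w \<in> {c0..} \<times> {0<..1} \<Longrightarrow> dist w (c, x) < d \<Longrightarrow>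
        0 < (case w of (c, x) \<Rightarrow> vv c x) * (case (c, x) of (c, x) \<Rightarrow> vv c x)"
      using continuous_on_nonzero_nbhd[OF vv_cont, of "(c, x)"] c h by auto
    have "(-1) ^ j * vv c' x < 0" if "c0 \<le> c'" "\<bar>c' - c\<bar> < d / 2" for c'
    proof -
      have "0 < vv c' x * vv c x"
        using d(2)[of "(c', x)"] box_in_ball[OF that(2), of x x] d(1) that \<open>0 < x\<close> \<open>x < 1\<close> by auto
      thus ?thesis using \<open>(-1) ^ j * vv c x < 0\<close> by (auto simp: mult_less_0_iff zero_less_mult_iff)
    qed
    thus ?thesis using d(1) by (intro exI[of _ "d / 2"]) auto
  qed
  show ?thesis using assms(2,3)
  proof (induction j arbitrary: x)
    case 0
    thus ?case using sgn[of 0 x] by auto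
  next
    case (Suc j)
    then obtain y where y: "y < x" "alternates (vv c) j y" by auto
    obtain d1 where d1: "0 < d1" "\<forall>c'\<ge>c0. \<bar>c' - c\<bar> < d1 \<longrightarrow> alternates (vv c') j y"
      using Suc.IH[OF y(2)] y Suc.prems by auto
    have "0 < x" using alternates_pos[OF y(2)] y by simp
    then obtain d2 where d2: "0 < d2" "\<forall>c'\<ge>c0. \<bar>c' - c\<bar> < d2 \<longrightarrow> (-1) ^ Suc j * vv c' x < 0"
      using sgn[of "Suc j" x] Suc.prems by auto
    show ?case
    proof (intro exI[of _ "min d1 d2"] conjI allI impI)
      fix c' assume "c0 \<le> c'" "\<bar>c' - c\<bar> < min d1 d2"
      thus "alternates (vv c') (Suc j) x" using d1(2) d2(2) y(1) by auto
    qed (use d1 d2 in auto)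
  qed
qed

text \<open>The pattern of full length persists for nearby parameters, and it forces at least as
  many zeros.\<close>

lemma Z_lsc:
  assumes c: "c0 \<le> c"
  obtains d where "0 < d" "\<And>c'. c0 \<le> c' \<Longrightarrow> \<bar>c' - c\<bar> < d \<Longrightarrow> card (Z c) \<le> card (Z c')"
proof -
  obtain t where t: "t < 1" "\<And>x. t < x \<Longrightarrow> x < 1 \<Longrightarrow> alternates (vv c) (card (Z c)) x"
    using alternates_near_1[OF c] by blast
  define x where "x = (t + 1) / 2"
  have x: "t < x" "x < 1" using t by (auto simp: x_def)
  obtain d where d: "0 < d" "\<forall>c'\<ge>c0. \<bar>c' - c\<bar> < d \<longrightarrow> alternates (vv c') (card (Z c)) x"
    using alternates_open[OF c t(2)[OF x] x(2)] by blast
  show thesis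
  proof (rule that[OF d(1)])
    fix c' assume c': "c0 \<le> c'" "\<bar>c' - c\<bar> < d"
    have "card (Z c) \<le> card ({z\<in>{0<..<1}. vv c' z = 0} \<inter> {..<x})"
    proof (rule alternates_imp_card[OF _ x(2)])
      show "continuous_on {0<..<1} (vv c')" by (rule continuous_on_subset[OF vv_cont_x[OF c'(1)]]) auto
    qed (use d c' Z_finite[OF c'(1)] in \<open>auto simp: Z_def\<close>)
    also have "\<dots> \<le> card (Z c')" using Z_finite[OF c'(1)] by (intro card_mono) (auto simp: Z_def)
    finally show "card (Z c) \<le> card (Z c')" .
  qed
qed

text \<open>The flux of \<open>uinf\<close> vanishes at \<open>1\<close>, so
  \<open>Q c 1 = ee c 1\<close>. Just before \<open>1\<close> the function
  \<open>(-1) ^ card (Z c) * vv c\<close> is negative; to reach \<open>0\<close> at \<open>1\<close>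
  its flux must be positive there. The sign is read off from nearby points, since
  \<open>vv c\<close> need not be differentiable at \<open>1\<close>.\<close>

lemma Q_sign_at_1:
  assumes c: "c0 \<le> c" and v1: "vv c 1 = 0"
  shows "0 < (-1) ^ card (Z c) * Q c 1"
proof -
  define s where "s = (-1::real) ^ card (Z c)"
  have Qe: "Q c 1 = ee c 1" by (simp add: ee_def qinf_def)
  have ne: "ee c 1 \<noteq> 0" using vv_ee_not_both_zero[OF c _ _ v1] by auto
  obtain t where t: "0 < t" "t < 1" "\<And>x. t < x \<Longrightarrow> x < 1 \<Longrightarrow> alternates (vv c) (card (Z c)) x"
    using alternates_near_1[OF c] by blast
  obtain d where d: "0 < d" "\<And>w. w \<in> {0<..1} \<Longrightarrow> dist w 1 < d \<Longrightarrow> 0 < ee c w * ee c 1"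
    using continuous_on_nonzero_nbhd[OF ee_cont_x[OF c], of 1] ne by auto
  have s: "s = 1 \<or> s = -1" by (simp add: s_def minus_one_power_iff)
  show ?thesis
  proof (rule ccontr)
    assume "\<not> 0 < (-1) ^ card (Z c) * Q c 1"
    hence neg: "s * ee c 1 < 0" using ne s by (auto simp: s_def[symmetric] Qe)
    define x where "x = max ((t + 1) / 2) (1 - d / 2)"
    have x: "t < x" "x < 1" "1 - d < x" "0 < x" using t d by (auto simp: x_def max_def)
    have "s * vv c 1 < s * vv c x"
    proof (rule DERIV_neg_imp_decreasing_open[OF x(2)])
      show "continuous_on {x..1} (\<lambda>x. s * vv c x)"
        by (intro continuous_intros continuous_on_subset[OF vv_cont_x[OF c]]) (use x in auto)
      fix y assume y: "x < y" "y < 1"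
      have "0 < ee c y * ee c 1" using d(2)[of y] x y by (auto simp: dist_real_def)
      hence "s * ee c y < 0" using neg s by (auto simp: zero_less_mult_iff)
      hence "s * (ee c y / P1 y) < 0" using P1_pos[of y] x y by (simp add: divide_less_0_iff)
      moreover have "((\<lambda>x. s * vv c x) has_real_derivative s * (ee c y / P1 y)) (at y)"
        using x y by (intro DERIV_cmult vv_deriv[OF c]) auto
      ultimately show "\<exists>D. ((\<lambda>x. s * vv c x) has_real_derivative D) (at y) \<and> D < 0" by blast
    qed
    moreover have "s * vv c x < 0" using alternates_sign[OF t(3)[OF x(1,2)]] by (simp add: s_def)
    ultimately show False using v1 by simp
  qed
qed

section \<open>Oscillation for large central values\<close>

text \<open>The loss of \<open>HH\<close> from \<open>reg_HH_quant\<close> at the point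
  \<open>X0 c\<close>; it does not depend on \<open>c\<close>.\<close>

definition hmin :: real where "hmin = \<delta> * \<alpha> * eps powr \<alpha> / 32"
definition wmin :: real where "wmin = sqrt (2 * hmin / \<beta>)"
text \<open>The positive zero of \<open>w powr (p + 1) / (p + 1) - \<beta> * w\<^sup>2 / 2\<close>;
  nonpositive energy \<open>HH\<close> keeps \<open>ww\<close> below it.\<close>

definition wmax :: real where "wmax = (\<beta> * (p + 1) / 2) powr (1 / (p - 1))"
text \<open>The end of the inner region of \<open>reg_near_0\<close>; it tends to \<open>0\<close>
  as \<open>c\<close> grows.\<close>

definition X0 :: "real \<Rightarrow> real" where "X0 c = sqrt (eps / c powr (p - 1))"
text \<open>The force \<open>\<beta> * w - w powr p\<close> divided by \<open>w powr p\<close>. It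
  vanishes exactly at \<open>b_inf N p\<close>, and its decrease in \<open>w\<close> gives the
  quadratic Riccati term its positive sign.\<close>

definition kk :: "real \<Rightarrow> real" where "kk w = \<beta> * w powr (1 - p) - 1"
text \<open>Half of the smaller of the lower bounds, for \<open>w\<close> in
  \<open>{wmin..wmax}\<close>, on the constant and the quadratic coefficient of the Riccati
  equation. The other half absorbs the linear term.\<close>

definition rate :: real where "rate = min (wmin powr p) (\<beta> * (p - 1) * wmax powr (- p)) / 2"

lemma hmin_pos: "0 < hmin"
  unfolding hmin_def using delta_bounds alpha_pos eps_pos by simp

lemma wmin_pos: "0 < wmin"
  unfolding wmin_def using hmin_pos beta_pos by simp

lemma wmax_pos: "0 < wmax"
  unfolding wmax_def using p_gt_1 beta_pos by simp

lemma rate_pos: "0 < rate"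
  unfolding rate_def using wmin_pos wmax_pos beta_pos p_gt_1 by simp

text \<open>Oscillation condition: the product of the two outer Riccati coefficients is
  \<open>\<beta> * (p - 1)\<close>, and a value of at least \<open>1\<close> beats a friction of
  size at most \<open>1\<close>.\<close>

lemma beta_p: "1 \<le> \<beta> * (p - 1)"
proof -
  have "\<beta> * (p - 1) = (\<alpha> * (p - 1)) * (real N - 2 - \<alpha>)" by (simp add: \<beta>_def)
  also have "\<dots> = 2 * (real N - 2 - \<alpha>)" unfolding alpha_p ..
  finally show ?thesis using alpha_upper N by simp
qed

lemma X0_pos: "0 < c \<Longrightarrow> 0 < X0 c" unfolding X0_def using eps_pos by simp

text \<open>The central value drops out, because \<open>\<alpha> * (p - 1) = 2\<close> makes
  \<open>X0 c powr (2 * \<alpha>)\<close> proportional to \<open>1 / c\<^sup>2\<close>.\<close>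

lemma HH_after_X0:
  assumes c: "c0 \<le> c" and x: "X0 c \<le> x" "x < 1" and X: "X0 c \<le> 1 / 2"
  shows "HH (U c) (Q c) x \<le> - hmin"
proof -
  have cp: "0 < c" using c c0_pos by simp
  note X0 = X0_pos[OF cp]
  have sq: "(X0 c)\<^sup>2 = eps / c powr (p - 1)" unfolding X0_def using eps_pos by simp
  have "HH (U c) (Q c) x \<le> HH (U c) (Q c) (X0 c)" by (rule reg_HH_antimono[OF reg_U[OF c] X0 x])
  also have "\<dots> \<le> - (\<delta> * \<alpha> * c\<^sup>2 / 32 * X0 c powr (2 * \<alpha>))"
    by (rule reg_HH_quant[OF reg_U[OF c] c X0 _ X]) (use X cp in \<open>auto simp: sq\<close>)
  also have "X0 c powr (2 * \<alpha>) = (X0 c powr 2) powr \<alpha>" by (simp only: powr_powr)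
  also have "X0 c powr 2 = (X0 c)\<^sup>2" using X0 by simp
  also have "((X0 c)\<^sup>2) powr \<alpha> = eps powr \<alpha> / c powr (\<alpha> * (p - 1))"
    unfolding sq using eps_pos cp by (simp add: powr_divide powr_powr mult.commute)
  also have "c powr (\<alpha> * (p - 1)) = c\<^sup>2" unfolding alpha_p using cp by simp
  also have "- (\<delta> * \<alpha> * c\<^sup>2 / 32 * (eps powr \<alpha> / c\<^sup>2)) = - hmin" using cp by (simp add: hmin_def)
  finally show ?thesis .
qed

lemma ww_range:
  assumes x: "0 < x" "x < 1" and u: "0 < u x" and H: "HH u q x \<le> - hmin"
  shows "wmin \<le> ww u x" "ww u x \<le> wmax"
proof -
  show "wmin \<le> ww u x" unfolding wmin_def by (rule ww_lower_bound[OF x u H hmin_pos])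
  hence w: "0 < ww u x" using wmin_pos by simp
  have "0 \<le> (1 - x\<^sup>2) * (WW u q x)\<^sup>2 / 2" using one_minus_square_pos[of x] x by simp
  hence "ww u x powr (p + 1) / (p + 1) \<le> \<beta> * (ww u x)\<^sup>2 / 2" using H hmin_pos unfolding HH_def by linarith
  moreover have "ww u x powr (p + 1) = ww u x powr (p - 1) * (ww u x)\<^sup>2"
  proof -
    have "ww u x powr (p - 1 + 2) = ww u x powr (p - 1) * ww u x powr 2" by (rule powr_add)
    thus ?thesis using w by (simp add: algebra_simps)
  qed
  ultimately have "ww u x powr (p - 1) * (ww u x)\<^sup>2 \<le> \<beta> * (p + 1) / 2 * (ww u x)\<^sup>2"
    using p_gt_1 by (simp add: field_simps)
  hence "ww u x powr (p - 1) \<le> \<beta> * (p + 1) / 2" by (rule mult_right_le_imp_le) (use w in simp)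
  hence "(ww u x powr (p - 1)) powr (1 / (p - 1)) \<le> wmax"
    unfolding wmax_def using p_gt_1 by (intro powr_mono2) auto
  thus "ww u x \<le> wmax" using w p_gt_1 by (simp add: powr_powr)
qed

lemma kk_zero_iff: assumes "0 < w" shows "kk w = 0 \<longleftrightarrow> w = b_inf N p"
proof
  assume "kk w = 0"
  hence "\<beta> = w powr (p - 1)" using assms by (simp add: kk_def powr_diff field_simps)
  hence "(b_inf N p powr (p - 1)) powr (1 / (p - 1)) = (w powr (p - 1)) powr (1 / (p - 1))" using b_inf_powr by simp
  thus "w = b_inf N p" using assms b_inf_pos p_gt_1 by (simp add: powr_powr)
next
  assume "w = b_inf N p"
  thus "kk w = 0" using assms b_inf_powr beta_pos
    by (simp add: kk_def powr_diff field_simps)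
qed

lemma vv_zero_iff:
  assumes "0 < x" shows "vv c x = 0 \<longleftrightarrow> ww (U c) x = b_inf N p"
  unfolding vv_def u_inf_def ww_def using assms by (simp add: powr_minus field_simps)

text \<open>By the inequality of arithmetic and geometric means \<open>A + B * y\<^sup>2\<close> is
  at least \<open>2 * \<bar>y\<bar>\<close>, as \<open>1 \<le> A * B\<close>; half of it therefore
  dominates the linear term.\<close>

lemma riccati_lower_bound:
  fixes y :: real
  assumes w: "wmin \<le> w" "w \<le> wmax" and a: "\<bar>a\<bar> \<le> 1" and t: "1 \<le> t"
  shows "rate * (1 + y\<^sup>2) \<le> - a * y + w powr p * t + \<beta> * (p - 1) * w powr (- p) * y\<^sup>2"
proof -
  have w0: "0 < w" using w wmin_pos by simp
  define A where "A = w powr p"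
  define B where "B = \<beta> * (p - 1) * w powr (- p)"
  have A: "0 < A" using w0 by (simp add: A_def)
  have B: "0 < B" unfolding B_def using w0 beta_pos p_gt_1 by simp
  have "w powr p * w powr (- p) = 1" using w0 by (simp add: powr_minus)
  hence AB: "A * B = \<beta> * (p - 1)" unfolding A_def B_def by (simp add: mult_ac)
  have "(2 * \<bar>y\<bar>)\<^sup>2 \<le> 4 * (A * B) * y\<^sup>2" unfolding AB
    using mult_right_mono[OF beta_p, of "y\<^sup>2"] by (simp add: power_mult_distrib)
  also have "\<dots> \<le> (A + B * y\<^sup>2)\<^sup>2"
    using sum_squares_ge_zero[of "A - B * y\<^sup>2" 0] by (simp add: power2_eq_square algebra_simps)
  finally have "2 * \<bar>y\<bar> \<le> A + B * y\<^sup>2" by (rule power2_le_imp_le) (use A B in simp)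
  moreover have "- \<bar>y\<bar> \<le> - a * y"
  proof -
    have "\<bar>a * y\<bar> \<le> 1 * \<bar>y\<bar>" unfolding abs_mult using a by (intro mult_right_mono) auto
    thus ?thesis by linarith
  qed
  moreover have "A \<le> A * t" using A t by simp
  ultimately have "(A + B * y\<^sup>2) / 2 \<le> - a * y + A * t + B * y\<^sup>2" by argo
  moreover have "rate * (1 + y\<^sup>2) \<le> (A + B * y\<^sup>2) / 2"
  proof -
    have "wmin powr p \<le> A" unfolding A_def using w wmin_pos p_gt_1 by (intro powr_mono2) auto
    hence 1: "rate \<le> A / 2" unfolding rate_def by simp
    have "wmax powr (- p) \<le> w powr (- p)" using w w0 p_gt_1 by (intro powr_mono2') auto
    hence "\<beta> * (p - 1) * wmax powr (- p) \<le> B" unfolding B_def using beta_p by (intro mult_left_mono) auto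
    hence 2: "rate \<le> B / 2" unfolding rate_def by simp
    have "rate * (1 + y\<^sup>2) = rate + rate * y\<^sup>2" by (simp add: distrib_left)
    moreover have "(A + B * y\<^sup>2) / 2 = A / 2 + B / 2 * y\<^sup>2" by (simp add: add_divide_distrib)
    moreover have "rate * y\<^sup>2 \<le> B / 2 * y\<^sup>2" by (rule mult_right_mono[OF 2]) simp
    ultimately show ?thesis using 1 by linarith
  qed
  ultimately show ?thesis unfolding A_def B_def by linarith
qed

text \<open>With \<open>w = \<rho>\<^sup>\<alpha> u\<close> and \<open>W = \<rho> w'\<close>, the quotient \<open>y = W / (\<beta> w\<^sup>1\<^sup>-\<^sup>p - 1)\<close> satisfies a Riccati equation in
  \<open>ln \<rho>\<close> whose right-hand side is at least a constant multiple of \<open>1 + y\<^sup>2\<close>; hence \<open>arctan y\<close> would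
  exceed its range if \<open>w\<close> avoided the value \<open>b\<^sub>\<infinity>\<close> for too long.\<close>

lemma zero_in_log_interval:
  assumes c: "c0 \<le> c" and X: "X0 c \<le> x1" "x1 < x2" "x2 \<le> 1 / 2" and len: "pi / rate \<le> ln (x2 / x1)"
  obtains z where "x1 \<le> z" "z \<le> x2" "vv c z = 0"
proof (rule ccontr)
  note elim = that
  assume "\<not> thesis"
  hence nz: "vv c x \<noteq> 0" if "x1 \<le> x" "x \<le> x2" for x using that elim by blast
  have cp: "0 < c" using c c0_pos by simp
  have x1: "0 < x1" using X X0_pos[OF cp] by simp
  define w where "w = ww (U c)"
  define W where "W = WW (U c) (Q c)"
  define y where "y x = W x / kk (w x)" for x
  have arc: "arctan (y x1) - rate * ln x1 \<le> arctan (y x2) - rate * ln x2"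
  proof (rule DERIV_nonneg_imp_nondecreasing[where f = "\<lambda>x. arctan (y x) - rate * ln x", OF less_imp_le[OF X(2)]])
    fix x assume x: "x1 \<le> x" "x \<le> x2"
    hence x01: "0 < x" "x < 1" using x1 X by auto
    have u: "0 < U c x" using U_bounds(1)[OF c, of x] x01 by simp
    have H: "HH (U c) (Q c) x \<le> - hmin" using x X by (intro HH_after_X0[OF c]) auto
    note wr = ww_range[of x "U c", OF x01 u H, folded w_def]
    have w0: "0 < w x" using wr wmin_pos by simp
    have k: "kk (w x) \<noteq> 0" using nz[OF x] vv_zero_iff[OF x01(1), of c] kk_zero_iff[OF w0] by (simp add: w_def)
    have s: "1 / 2 \<le> 1 - x\<^sup>2" using x01 x X power_mono[of x "1/2" 2] by (simp add: power2_eq_square)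
    \<comment> \<open>The coefficients of the equation in \<open>ln x\<close>: for
      \<open>x \<le> 1/2\<close> and \<open>0 < \<delta> < 1\<close> the friction \<open>a\<close>
      has absolute value at most \<open>1\<close>.\<close>
    define a where "a = (\<delta> - x\<^sup>2) / (1 - x\<^sup>2)"
    define t where "t = 1 / (1 - x\<^sup>2)"
    have d: "(U c has_real_derivative Q c x / P1 x) (at x)" using regD(7)[OF reg_U[OF c]] x01 by simp
    have dq: "(Q c has_real_derivative - (P2 x * phi (U c x))) (at x)" using regD(8)[OF reg_U[OF c]] x01 by simp
    have w': "(w has_real_derivative W x / x) (at x)" unfolding w_def W_def by (rule ww_deriv[where u = "U c" and q = "Q c", OF x01 d])
    have W': "(W has_real_derivative (- ((\<delta> - x\<^sup>2) * W x) - (w x powr p - \<beta> * w x)) / (x * (1 - x\<^sup>2))) (at x)"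
      unfolding w_def W_def by (rule WW_deriv[where u = "U c" and q = "Q c", OF x01 u d dq])
    have wk: "w x powr p - \<beta> * w x = - (w x powr p * kk (w x))"
    proof -
      have "w x powr p * w x powr (1 - p) = w x" using w0 by (simp flip: powr_add)
      thus ?thesis unfolding kk_def by (simp add: algebra_simps)
    qed
    have k': "((\<lambda>x. kk (w x)) has_real_derivative \<beta> * ((1 - p) * w x powr (- p)) * (W x / x)) (at x)"
    proof -
      have "(kk has_real_derivative \<beta> * ((1 - p) * w x powr (- p))) (at (w x))"
        unfolding kk_def[abs_def] using w0 by (auto intro!: derivative_eq_intros)
      from DERIV_chain2[OF this w'] show ?thesis .
    qed
    define D where "D = ((- ((\<delta> - x\<^sup>2) * W x) + w x powr p * kk (w x)) / (x * (1 - x\<^sup>2)) * kk (w x)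
         - W x * (\<beta> * ((1 - p) * w x powr (- p)) * (W x / x))) / (kk (w x) * kk (w x))"
    have y': "(y has_real_derivative D) (at x)"
      unfolding y_def[abs_def] D_def using DERIV_divide[OF W' k' k] unfolding wk by simp
    have "D = (- a * y x + w x powr p * t + \<beta> * (p - 1) * w x powr (- p) * (y x)\<^sup>2) / x"
    proof -
      have s0: "1 - x\<^sup>2 \<noteq> 0" using s by simp
      have "(- ((\<delta> - x\<^sup>2) * W x) + w x powr p * kk (w x)) / (x * (1 - x\<^sup>2)) * kk (w x) / (kk (w x) * kk (w x))
          = (- a * y x + w x powr p * t) / x"
        unfolding a_def t_def y_def using k x01 s0 by (simp add: divide_simps)
      moreover have "W x * (\<beta> * ((1 - p) * w x powr (- p)) * (W x / x)) / (kk (w x) * kk (w x))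
          = - (\<beta> * (p - 1) * w x powr (- p) * (y x)\<^sup>2 / x)"
        unfolding y_def using k x01 by (simp add: power2_eq_square divide_simps) (simp add: algebra_simps)
      ultimately show ?thesis unfolding D_def diff_divide_distrib by (simp add: add_divide_distrib)
    qed
    moreover have "rate * (1 + (y x)\<^sup>2) \<le> - a * y x + w x powr p * t + \<beta> * (p - 1) * w x powr (- p) * (y x)\<^sup>2"
    proof (rule riccati_lower_bound[OF wr])
      show "1 \<le> t" unfolding t_def using s by (simp add: field_simps)
      have "\<delta> - x\<^sup>2 \<le> 1 - x\<^sup>2" "- (1 - x\<^sup>2) \<le> \<delta> - x\<^sup>2" using delta_bounds s by auto
      thus "\<bar>a\<bar> \<le> 1" unfolding a_def using s by (simp add: abs_le_iff divide_le_eq le_divide_eq)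
    qed
    ultimately have "rate * (1 + (y x)\<^sup>2) / x \<le> D" using x01 by (simp add: divide_right_mono)
    hence "rate / x \<le> D / (1 + (y x)\<^sup>2)"
      using x01 by (simp add: le_divide_eq add_pos_nonneg)
    moreover have "((\<lambda>x. arctan (y x) - rate * ln x) has_real_derivative D / (1 + (y x)\<^sup>2) - rate / x) (at x)"
      using y' x01 by (auto intro!: derivative_eq_intros simp: field_simps)
    ultimately show "\<exists>l. ((\<lambda>x. arctan (y x) - rate * ln x) has_real_derivative l) (at x) \<and> 0 \<le> l"
      by (intro exI conjI) auto
  qed
  have "pi \<le> rate * ln (x2 / x1)" using len rate_pos by (simp add: field_simps)
  also have "\<dots> = rate * ln x2 - rate * ln x1" using x1 X by (simp add: ln_div algebra_simps)
  also have "\<dots> \<le> arctan (y x2) - arctan (y x1)" using arc by simp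
  also have "\<dots> < pi" using arctan_bounded[of "y x1"] arctan_bounded[of "y x2"] by linarith
  finally show False by simp
qed

text \<open>The interval length needed in \<open>ln x\<close> is \<open>pi / rate\<close>,
  independent of \<open>c\<close>, while \<open>X0 c\<close> tends to \<open>0\<close>; so any
  number of disjoint intervals of this length fits between \<open>X0 c\<close> and
  \<open>1/2\<close>.\<close>

lemma Z_card_unbounded:
  obtains C where "c0 \<le> C" "\<And>c. C \<le> c \<Longrightarrow> k \<le> card (Z c)"
proof -
  define s where "s = exp (- (pi / rate))"
  have s: "0 < s" "s < 1" using rate_pos by (auto simp: s_def)
  define \<eta> where "\<eta> = s ^ (2 * k) / 2"
  have \<eta>: "0 < \<eta>" "\<eta> \<le> 1 / 2" using s by (auto simp: \<eta>_def power_le_one)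
  \<comment> \<open>Chosen to give \<open>X0 c \<le> \<eta>\<close> for \<open>c \<ge> C\<close>, so
    that all \<open>k\<close> intervals lie to the right of \<open>X0 c\<close>.\<close>
  define C where "C = max c0 ((eps / \<eta>\<^sup>2) powr (1 / (p - 1)))"
  show thesis
  proof (rule that[of C])
    fix c assume c: "C \<le> c"
    have cc: "c0 \<le> c" and cp: "0 < c" using c c0_pos by (auto simp: C_def)
    have "((eps / \<eta>\<^sup>2) powr (1 / (p - 1))) powr (p - 1) \<le> c powr (p - 1)"
      using c p_gt_1 by (intro powr_mono2) (auto simp: C_def)
    hence "eps / \<eta>\<^sup>2 \<le> c powr (p - 1)" using eps_pos \<eta> p_gt_1 by (simp add: powr_powr)
    hence "eps / c powr (p - 1) \<le> \<eta>\<^sup>2" using cp \<eta> by (simp add: field_simps)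
    hence X: "X0 c \<le> \<eta>" unfolding X0_def using \<eta> by (intro real_le_lsqrt) auto
    have ex: "\<exists>z. s ^ (2 * i + 1) / 2 \<le> z \<and> z \<le> s ^ (2 * i) / 2 \<and> vv c z = 0" if i: "i < k" for i
    proof -
      have "s ^ (2 * k) \<le> s ^ (2 * i + 1)" using s i by (intro power_decreasing) auto
      hence 1: "X0 c \<le> s ^ (2 * i + 1) / 2" using X by (simp add: \<eta>_def)
      have 2: "s ^ (2 * i + 1) / 2 < s ^ (2 * i) / 2" using s by simp
      have 3: "s ^ (2 * i) / 2 \<le> 1 / 2" using s by (simp add: power_le_one)
      have "(s ^ (2 * i) / 2) / (s ^ (2 * i + 1) / 2) = exp (pi / rate)"
      proof -
        have "(s ^ (2 * i) / 2) / (s ^ (2 * i + 1) / 2) = 1 / s" using s by simp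
        also have "\<dots> = exp (pi / rate)" by (simp add: s_def exp_minus inverse_eq_divide)
        finally show ?thesis .
      qed
      hence 4: "pi / rate \<le> ln ((s ^ (2 * i) / 2) / (s ^ (2 * i + 1) / 2))" by simp
      show ?thesis by (rule zero_in_log_interval[OF cc 1 2 3 4]) blast
    qed
    hence "\<forall>i\<in>{..<k}. \<exists>z. s ^ (2 * i + 1) / 2 \<le> z \<and> z \<le> s ^ (2 * i) / 2 \<and> vv c z = 0" by simp
    then obtain f where f: "\<And>i. i < k \<Longrightarrow> s ^ (2 * i + 1) / 2 \<le> f i" "\<And>i. i < k \<Longrightarrow> f i \<le> s ^ (2 * i) / 2"
       "\<And>i. i < k \<Longrightarrow> vv c (f i) = 0"
      using bchoice[of "{..<k}" "\<lambda>i z. s ^ (2 * i + 1) / 2 \<le> z \<and> z \<le> s ^ (2 * i) / 2 \<and> vv c z = 0"]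
      unfolding Ball_def lessThan_iff by blast
    have less: "f j < f i" if "i < j" "j < k" for i j
    proof -
      have "s ^ (2 * j) < s ^ (2 * i + 1)" using s that by (intro power_strict_decreasing) auto
      thus ?thesis using f(1)[of i] f(2)[of j] that by simp
    qed
    have "inj_on f {..<k}"
    proof (rule inj_onI)
      fix i j assume "i \<in> {..<k}" "j \<in> {..<k}" "f i = f j"
      thus "i = j" using less[of i j] less[of j i] by (cases i j rule: linorder_cases) auto
    qed
    moreover have "f ` {..<k} \<subseteq> Z c"
    proof (rule image_subsetI)
      fix i assume i: "i \<in> {..<k}"
      have "0 < s ^ (2 * i + 1) / 2" "s ^ (2 * i) / 2 < 1" using s power_le_one[of s "2 * i"] by auto
      thus "f i \<in> Z c" using f[of i] i by (auto simp: Z_def)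
    qed
    ultimately show "k \<le> card (Z c)" using card_inj_on_le[of f "{..<k}" "Z c"] Z_finite[OF cc] by simp
  qed (simp add: C_def)
qed

section \<open>Shooting\<close>

text \<open>\<open>U\<close> is obtained by choice, so its agreement with the constant solution is a
  matter of uniqueness: the difference bound is zero for equal central values.\<close>

lemma U_c0: assumes "0 \<le> x" "x \<le> 1" shows "U c0 x = c0"
proof -
  have phi0: "phi c0 = 0" unfolding phi_def using powr_p_eq[of c0] c0_pos by (simp add: c0_powr)
  have s: "solves phi 0 1 (\<lambda>_. c0) (\<lambda>_. 0)"
    unfolding solves_def by (auto simp: phi0)
  note r = reg_U[OF order_refl]
  define L where "L = p * c0 powr (p - 1) + lam"
  have L: "0 < L" unfolding L_def using p_gt_1 lam_pos by (intro add_nonneg_pos) auto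
  have lip: "\<bar>phi (U c0 x) - phi c0\<bar> \<le> L * \<bar>U c0 x - c0\<bar>" if "0 < x" "x < 1" for x
    unfolding L_def using U_bounds[OF order_refl, of x] that c0_pos by (intro phi_lipschitz) auto
  have "\<bar>U c0 x - c0\<bar> \<le> 2 * \<bar>U c0 0 - c0\<bar> * exp (2 * L / m\<^sup>2)"
    by (rule solves_diff_bound(1)[OF regD(3)[OF r] regD(5)[OF r] s refl L lip assms])
  thus ?thesis by (simp add: regD(4)[OF r])
qed

text \<open>Equivalent to \<open>\<beta> < lam\<close>, that is to
  \<open>N - 3 < 2 * \<alpha>\<close>; it places the single crossing of \<open>c0\<close> and
  \<open>uinf\<close> inside \<open>(0, 1)\<close>.\<close>

lemma b_less_c0: "b_inf N p < c0"
proof -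
  have "\<beta> < lam" unfolding \<beta>_def lam_def using alpha_pos alpha_lower by (intro mult_strict_left_mono) auto
  hence lt: "\<beta> powr (1 / (p - 1)) < lam powr (1 / (p - 1))" using beta_pos p_gt_1 by (intro powr_less_mono2) auto
  have "b_inf N p = (b_inf N p powr (p - 1)) powr (1 / (p - 1))" using b_inf_pos p_gt_1 by (simp add: powr_powr)
  thus ?thesis using lt unfolding c0_def b_inf_powr by simp
qed

lemma const_eq_uinf_iff: "0 < x \<Longrightarrow> c0 = uinf x \<longleftrightarrow> x = (b_inf N p / c0) powr (1 / \<alpha>)"
proof -
  assume x: "0 < x"
  have "c0 = uinf x \<longleftrightarrow> x powr \<alpha> = b_inf N p / c0"
    unfolding u_inf_def using x c0_pos by (auto simp: powr_minus field_simps)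
  also have "\<dots> \<longleftrightarrow> x = (b_inf N p / c0) powr (1 / \<alpha>)"
  proof
    assume "x powr \<alpha> = b_inf N p / c0"
    hence "(x powr \<alpha>) powr (1 / \<alpha>) = (b_inf N p / c0) powr (1 / \<alpha>)" by simp
    thus "x = (b_inf N p / c0) powr (1 / \<alpha>)" using x alpha_pos by (simp add: powr_powr)
  next
    assume "x = (b_inf N p / c0) powr (1 / \<alpha>)"
    thus "x powr \<alpha> = b_inf N p / c0" using alpha_pos b_inf_pos c0_pos by (simp add: powr_powr)
  qed
  finally show "c0 = uinf x \<longleftrightarrow> x = (b_inf N p / c0) powr (1 / \<alpha>)" .
qed

lemma const_zeros: "{x\<in>{0<..<1}. c0 - uinf x = 0} = {(b_inf N p / c0) powr (1 / \<alpha>)}"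
proof -
  have "(b_inf N p / c0) powr (1 / \<alpha>) < 1 powr (1 / \<alpha>)"
    using b_less_c0 b_inf_pos c0_pos alpha_pos by (intro powr_less_mono2) auto
  moreover have "0 < (b_inf N p / c0) powr (1 / \<alpha>)" using b_inf_pos c0_pos by simp
  ultimately show ?thesis using const_eq_uinf_iff by auto
qed

lemma card_Z_c0: "card (Z c0) = 1"
proof -
  have "Z c0 = {x\<in>{0<..<1}. c0 - uinf x = 0}" 
    unfolding Z_def vv_def by (intro Collect_cong conj_cong refl) (simp add: U_c0)
  thus ?thesis unfolding const_zeros by simp
qed

lemma Q1_cont: "c0 \<le> a \<Longrightarrow> continuous_on {a..b} (\<lambda>c. Q c 1)"
proof -
  assume a: "c0 \<le> a"
  have "continuous_on {a..b} (\<lambda>c. case (c, 1) of (c, x) \<Rightarrow> Q c x)"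
    by (rule continuous_on_compose2[OF Q_cont]) (use a in \<open>auto intro!: continuous_intros\<close>)
  thus ?thesis by simp
qed

text \<open>The last conclusion puts the parameter beyond all those with at most \<open>k\<close>
  zeros; this is what makes the central values diverge.\<close>

lemma shooting:
  assumes k: "1 \<le> k"
  obtains c where "c0 \<le> c" "card (Z c) = Suc k" "Q c 1 = 0" "\<And>d. c0 \<le> d \<Longrightarrow> card (Z d) \<le> k \<Longrightarrow> d \<le> c"
proof -
  define A where "A = {c. c0 \<le> c \<and> card (Z c) \<le> k}"
  obtain C1 where C1: "c0 \<le> C1" "\<And>c. C1 \<le> c \<Longrightarrow> Suc k \<le> card (Z c)" using Z_card_unbounded[of "Suc k"] by blast
  obtain C2 where C2: "c0 \<le> C2" "\<And>c. C2 \<le> c \<Longrightarrow> Suc (Suc k) \<le> card (Z c)" using Z_card_unbounded[of "Suc (Suc k)"] by blast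
  have c0A: "c0 \<in> A" using k by (simp add: A_def card_Z_c0)
  have bA: "bdd_above A"
  proof (rule bdd_aboveI)
    fix c assume "c \<in> A" thus "c \<le> C1" using C1(2)[of c] by (force simp: A_def)
  qed
  define a where "a = Sup A"
  have ac: "c0 \<le> a" unfolding a_def by (rule cSup_upper[OF c0A bA])
  have above: "Suc k \<le> card (Z c)" if "a < c" for c
  proof (rule ccontr)
    assume "\<not> Suc k \<le> card (Z c)"
    hence "c \<in> A" using that ac by (simp add: A_def)
    hence "c \<le> a" unfolding a_def by (rule cSup_upper[OF _ bA])
    thus False using that by simp
  qed
  \<comment> \<open>The supremum is attained, by lower semicontinuity of the count without the end
    point.\<close>
  have Za: "card (Z a) \<le> k"
  proof (rule ccontr)
    assume n: "\<not> card (Z a) \<le> k"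
    obtain d where d: "0 < d" "\<And>c'. c0 \<le> c' \<Longrightarrow> \<bar>c' - a\<bar> < d \<Longrightarrow> card (Z a) \<le> card (Z c')" using Z_lsc[OF ac] by blast
    obtain c where c: "c \<in> A" "a - d < c" using less_cSupD[of A "a - d"] c0A d(1) by (auto simp: a_def)
    have "c \<le> a" unfolding a_def by (rule cSup_upper[OF c(1) bA])
    thus False using d(2)[of c] c n by (auto simp: A_def)
  qed
  obtain da where da: "0 < da" "\<And>c'. c0 \<le> c' \<Longrightarrow> \<bar>c' - a\<bar> < da \<Longrightarrow> finite (Zb c') \<and> card (Zb c') \<le> card (Zb a)"
    using Zb_usc[OF ac] by blast
  have ZZb: "card (Z c) \<le> card (Zb c)" if "c0 \<le> c" for c using card_Zb[OF that] by simp
  \<comment> \<open>Parameters just above \<open>a\<close> have at least \<open>k + 1\<close> zeros,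
    so by upper semicontinuity \<open>Zb a\<close> does too. As \<open>Z a\<close> has at most
    \<open>k\<close>, there are exactly \<open>k\<close> inside and one at \<open>1\<close>.\<close>
  have "Suc k \<le> card (Zb a)"
    using above[of "a + da / 2"] da(2)[of "a + da / 2"] ZZb[of "a + da / 2"] da(1) ac by force
  hence va: "vv a 1 = 0" "card (Z a) = k" "card (Zb a) = Suc k"
    using card_Zb[OF ac] Za by (auto split: if_splits)
  define B where "B = {c. a < c \<and> Suc (Suc k) \<le> card (Z c)}"
  have "max C2 (a + 1) \<in> B" using C2(2)[of "max C2 (a + 1)"] by (simp add: B_def)
  hence neB: "B \<noteq> {}" by blast
  have bB: "bdd_below B" by (rule bdd_belowI[of _ a]) (auto simp: B_def)
  define b where "b = Inf B"
  \<comment> \<open>Upper semicontinuity at \<open>a\<close> also caps the count at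
    \<open>k + 1\<close> near \<open>a\<close>, so \<open>b\<close> lies strictly above
    \<open>a\<close>.\<close>
  have low: "a + da \<le> c" if "c \<in> B" for c
  proof (rule ccontr)
    assume "\<not> a + da \<le> c"
    hence "card (Zb c) \<le> Suc k" using da(2)[of c] that ac va by (auto simp: B_def)
    thus False using ZZb[of c] that ac by (auto simp: B_def)
  qed
  have ab: "a < b" using cInf_greatest[OF neB low] da(1) by (simp add: b_def)
  have bc: "c0 \<le> b" using ab ac by simp
  have mid: "card (Z c) = Suc k" if "a < c" "c < b" for c
  proof -
    have "c \<notin> B" using that cInf_lower[OF _ bB, of c] by (auto simp: b_def)
    thus ?thesis using above[OF that(1)] that by (auto simp: B_def)
  qed
  \<comment> \<open>By lower semicontinuity a larger count at \<open>b\<close> would already occur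
    to the left of \<open>b\<close>.\<close>
  have Zb1: "card (Z b) = Suc k"
  proof (rule ccontr)
    assume "card (Z b) \<noteq> Suc k"
    hence n: "Suc (Suc k) \<le> card (Z b)" using above[OF ab] by simp
    obtain d where d: "0 < d" "\<And>c'. c0 \<le> c' \<Longrightarrow> \<bar>c' - b\<bar> < d \<Longrightarrow> card (Z b) \<le> card (Z c')" using Z_lsc[OF bc] by blast
    define c where "c = max ((a + b) / 2) (b - d / 2)"
    have "a < c" "c < b" "\<bar>c - b\<bar> < d" using ab d(1) by (auto simp: c_def max_def field_simps abs_if)
    thus False using d(2)[of c] mid[of c] n ac by simp
  qed
  \<comment> \<open>Members of \<open>B\<close> close to \<open>b\<close> force at least
    \<open>k + 2\<close> elements in \<open>Zb b\<close>; the surplus over \<open>Z b\<close> is the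
    zero at \<open>1\<close>.\<close>
  have "vv b 1 = 0"
  proof -
    obtain d where d: "0 < d" "\<And>c'. c0 \<le> c' \<Longrightarrow> \<bar>c' - b\<bar> < d \<Longrightarrow> finite (Zb c') \<and> card (Zb c') \<le> card (Zb b)"
      using Zb_usc[OF bc] by blast
    obtain c where c: "c \<in> B" "c < b + d" using cInf_lessD[OF neB, of "b + d"] d(1) by (auto simp: b_def)
    have "b \<le> c" unfolding b_def by (rule cInf_lower[OF c(1) bB])
    hence "Suc (Suc k) \<le> card (Zb b)" using d(2)[of c] c ZZb[of c] bc by (force simp: B_def)
    thus ?thesis using card_Zb[OF bc] Zb1 by (auto split: if_splits)
  qed
  note Qb = Q_sign_at_1[OF bc this, unfolded Zb1]
  note Qa = Q_sign_at_1[OF ac va(1), unfolded va(2)]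
  define s where "s = (-1::real) ^ k"
  have s: "0 < s * Q a 1" "s * Q b 1 < 0" using Qa Qb by (auto simp: s_def)
  have "continuous_on {a..b} (\<lambda>c. s * Q c 1)" by (intro continuous_intros Q1_cont ac)
  then obtain c where c: "a \<le> c" "c \<le> b" "s * Q c 1 = 0"
    using IVT2'[of "\<lambda>c. s * Q c 1" b 0 a] s ab by auto
  have "c \<noteq> a" "c \<noteq> b" using c s by auto
  hence c1: "a < c" "c < b" using c by auto
  show thesis
  proof (rule that[of c])
    show "Q c 1 = 0" using c by (simp add: s_def)
    show "card (Z c) = Suc k" by (rule mid[OF c1])
    fix d assume "c0 \<le> d" "card (Z d) \<le> k"
    thus "d \<le> c" using above[of d] c1 by (force simp: not_le[symmetric])
  qed (use c1 ac in simp)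
qed

text \<open>Upper semicontinuity on a compact set of parameters, with a crude sum over a finite
  cover as bound.\<close>

lemma Z_card_bounded:
  obtains K where "\<And>c. c \<in> {c0..M} \<Longrightarrow> card (Z c) \<le> K"
proof -
  define good where "good c d \<longleftrightarrow> 0 < d \<and> (\<forall>c'. c0 \<le> c' \<and> \<bar>c' - c\<bar> < d \<longrightarrow> card (Z c') \<le> card (Zb c))" for c d
  have "\<exists>d. good c d" if c: "c0 \<le> c" for c
  proof -
    obtain d where d: "0 < d" "\<And>c'. c0 \<le> c' \<Longrightarrow> \<bar>c' - c\<bar> < d \<Longrightarrow> finite (Zb c') \<and> card (Zb c') \<le> card (Zb c)"
      using Zb_usc[OF c] by blast
    have "card (Z c') \<le> card (Zb c)" if "c0 \<le> c'" "\<bar>c' - c\<bar> < d" for c'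
      using d(2)[OF that] card_Zb[OF that(1)] by simp
    thus ?thesis using d(1) unfolding good_def by blast
  qed
  hence "\<forall>c\<in>{c0..M}. \<exists>d. good c d" by simp
  then obtain D where D: "\<forall>c\<in>{c0..M}. good c (D c)" using bchoice[of "{c0..M}" good] by blast
  have cov: "c \<in> ball c (D c)" if "c \<in> {c0..M}" for c using D that by (auto simp: good_def)
  have "compact {c0..M}" by simp
  then obtain Y where Y: "Y \<subseteq> {c0..M}" "finite Y" "{c0..M} \<subseteq> (\<Union>c\<in>Y. ball c (D c))"
    by (rule compactE_image[of "{c0..M}" "{c0..M}" "\<lambda>c. ball c (D c)"]) (use cov in blast)+
  show thesis
  proof (rule that[of "\<Sum>c\<in>Y. card (Zb c)"])
    fix c assume c: "c \<in> {c0..M}"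
    then obtain y where y: "y \<in> Y" "c \<in> ball y (D y)" using Y(3) by blast
    have "card (Z c) \<le> card (Zb y)" using D Y(1) y c by (auto simp: good_def dist_real_def abs_minus_commute)
    also have "\<dots> \<le> (\<Sum>c\<in>Y. card (Zb c))" by (rule member_le_sum[OF y(1)]) (use Y in auto)
    finally show "card (Z c) \<le> (\<Sum>c\<in>Y. card (Zb c))" .
  qed
qed

end

section \<open>Analyticity\<close>

lemma holomorphic_real_derivative:
  assumes F: "F holomorphic_on ball 0 r" and t: "\<bar>t\<bar> < r"
  shows "((\<lambda>s. Re (F (of_real s))) has_real_derivative Re (deriv F (of_real t))) (at t)"
proof -
  have "(F has_field_derivative deriv F (of_real t)) (at (of_real t))"
    using F t by (intro holomorphic_derivI[of _ "ball 0 r"]) auto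
  hence "((\<lambda>s. F (of_real s)) has_vector_derivative deriv F (of_real t)) (at t)"
    by (intro has_vector_derivative_real_field)
  from bounded_linear.has_vector_derivative[OF bounded_linear_Re this]
  show ?thesis by (simp add: has_real_derivative_iff_has_vector_derivative)
qed

text \<open>\<open>fuchs_local\<close> with the principal branch of the power, read on the real
  axis, where conjugation symmetry makes all values real.\<close>

lemma fuchs_real:
  fixes A B C D :: "complex \<Rightarrow> complex" and u0 y0 p \<mu> r0 :: real and j :: nat
  assumes r0: "0 < r0" and \<mu>: "0 < \<mu>" and u0: "0 < u0"
    and hol: "A holomorphic_on ball 0 r0" "B holomorphic_on ball 0 r0" "C holomorphic_on ball 0 r0"
      "D holomorphic_on ball 0 r0"
    and sym: "\<And>s. A (cnj s) = cnj (A s)" "\<And>s. B (cnj s) = cnj (B s)"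
      "\<And>s. C (cnj s) = cnj (C s)" "\<And>s. D (cnj s) = cnj (D s)"
  shows "\<exists>r F f \<zeta> \<zeta>'. 0 < r \<and> r \<le> r0 \<and> F holomorphic_on ball 0 r \<and> f 0 = u0 \<and>
    (\<forall>s. \<bar>s\<bar> < r \<longrightarrow> F (of_real s) = of_real (f s) \<and> 0 < f s \<and>
      (f has_real_derivative y0 + s ^ j * \<zeta> s) (at s) \<and> (\<zeta> has_real_derivative \<zeta>' s) (at s) \<and>
      s * \<zeta>' s + \<mu> * \<zeta> s =
       Re (A (of_real s)) * f s + Re (B (of_real s)) * f s powr p + Re (C (of_real s)) + Re (D (of_real s)) * (s * \<zeta> s))"
proof -
  define g where "g w = w powr of_real p" for w :: complex
  \<comment> \<open>A radius of at most \<open>u0\<close> keeps the disc around \<open>u0\<close> in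
    the right half-plane, away from the branch cut and with positive real part.\<close>
  define r1 where "r1 = min r0 u0"
  have r1: "0 < r1" "r1 \<le> r0" "r1 \<le> u0" using r0 u0 by (auto simp: r1_def)
  have Re_pos: "0 < Re w" if "w \<in> ball (of_real u0) r1" for w :: complex
    using abs_Re_le_cmod[of "of_real u0 - w"] that r1 by (simp add: dist_norm)
  have nn: "w \<notin> \<real>\<^sub>\<le>\<^sub>0" if "w \<in> ball (of_real u0) r1" for w :: complex
    using Re_pos[OF that] by (auto simp: complex_nonpos_Reals_iff)
  have holg: "g holomorphic_on ball (of_real u0) r1"
    unfolding g_def[abs_def] by (intro holomorphic_intros) (rule nn)
  have symg: "g (cnj w) = cnj (g w)" if "w \<in> ball (of_real u0) r1" for w
    unfolding g_def using Re_pos[OF that] by (subst cnj_powr) auto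
  have sub: "ball (0::complex) r1 \<subseteq> ball 0 r0" using r1 by auto
  obtain r u z where u: "0 < r" "r \<le> r1" "u holomorphic_on ball 0 r" "z holomorphic_on ball 0 r" "u 0 = of_real u0"
    "\<And>s. s \<in> ball 0 r \<Longrightarrow> u s \<in> ball (of_real u0) r1"
    "\<And>s. s \<in> ball 0 r \<Longrightarrow> (u has_field_derivative of_real y0 + s ^ j * z s) (at s)"
    "\<And>s. s \<in> ball 0 r \<Longrightarrow>
       s * deriv z s + of_real \<mu> * z s = A s * u s + B s * g (u s) + C s + D s * (s * z s)"
    "\<And>s. s \<in> ball 0 r \<Longrightarrow> u (cnj s) = cnj (u s)" "\<And>s. s \<in> ball 0 r \<Longrightarrow> z (cnj s) = cnj (z s)"
    by (rule fuchs_local[OF r1(1) \<mu> holomorphic_on_subset[OF hol(1) sub] holomorphic_on_subset[OF hol(2) sub]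
        holomorphic_on_subset[OF hol(3) sub] holomorphic_on_subset[OF hol(4) sub] holg, of "of_real y0" j])
       (auto simp: sym symg)
  have real: "u (of_real s) = of_real (Re (u (of_real s)))" "z (of_real s) = of_real (Re (z (of_real s)))" if "\<bar>s\<bar> < r" for s
    using u(9,10)[of "of_real s"] that by (simp_all add: complex_eq_iff)
  show ?thesis
  proof (rule exI[of _ r], rule exI[of _ u], rule exI[of _ "\<lambda>s. Re (u (of_real s))"],
      rule exI[of _ "\<lambda>s. Re (z (of_real s))"], rule exI[of _ "\<lambda>s. Re (deriv z (of_real s))"], intro conjI allI impI)
    fix s assume s: "\<bar>s\<bar> < r"
    hence sb: "of_real s \<in> ball (0::complex) r" by simp
    show "0 < Re (u (of_real s))" by (rule Re_pos[OF u(6)[OF sb]])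
    show "u (of_real s) = of_real (Re (u (of_real s)))" by (rule real(1)[OF s])
    have "deriv u (of_real s) = of_real y0 + of_real s ^ j * z (of_real s)"
      by (rule DERIV_imp_deriv[OF u(7)[OF sb]])
    also have "Re \<dots> = y0 + s ^ j * Re (z (of_real s))" by (simp flip: of_real_power)
    finally show "((\<lambda>s. Re (u (of_real s))) has_real_derivative y0 + s ^ j * Re (z (of_real s))) (at s)"
      using holomorphic_real_derivative[OF u(3) s] by simp
    show "((\<lambda>s. Re (z (of_real s))) has_real_derivative Re (deriv z (of_real s))) (at s)"
      by (rule holomorphic_real_derivative[OF u(4) s])
    have "g (u (of_real s)) = of_real (Re (u (of_real s)) powr p)"
      using real(1)[OF s] Re_pos[OF u(6)[OF sb]] unfolding g_def by (metis less_imp_le powr_of_real)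
    hence "of_real s * deriv z (of_real s) + of_real \<mu> * of_real (Re (z (of_real s))) =
       A (of_real s) * of_real (Re (u (of_real s))) + B (of_real s) * of_real (Re (u (of_real s)) powr p)
       + C (of_real s) + D (of_real s) * of_real (s * Re (z (of_real s)))"
      using u(8)[OF sb] real[OF s] by simp
    from arg_cong[OF this, of Re]
    show "s * Re (deriv z (of_real s)) + \<mu> * Re (z (of_real s)) =
       Re (A (of_real s)) * Re (u (of_real s)) + Re (B (of_real s)) * Re (u (of_real s)) powr p
       + Re (C (of_real s)) + Re (D (of_real s)) * (s * Re (z (of_real s)))"
      by simp
  qed (use u r1 in auto)
qed

section \<open>Local analytic solutions at the centre, at interior points and at
  \<open>1\<close>\<close>

context wave begin

text \<open>Everything is in the local coordinate \<open>\<rho> - x\<close>; \<open>F\<close> is the holomorphic extension of \<open>f\<close>.\<close>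

definition analytic_solution_at ::
  "real \<Rightarrow> real \<Rightarrow> (complex \<Rightarrow> complex) \<Rightarrow> (real \<Rightarrow> real) \<Rightarrow> (real \<Rightarrow> real) \<Rightarrow> (real \<Rightarrow> real) \<Rightarrow> bool" where
  "analytic_solution_at x r F f f1 f2 \<longleftrightarrow> 0 < r \<and> F holomorphic_on ball 0 r \<and>
     (\<forall>s. \<bar>s\<bar> < r \<longrightarrow> F (of_real s) = of_real (f s) \<and> 0 < f s \<and>
        (f has_real_derivative f1 s) (at s) \<and> (f1 has_real_derivative f2 s) (at s) \<and>
        (x + s \<noteq> 0 \<longrightarrow> (1 - (x + s)\<^sup>2) * f2 s + ((real N - 1) / (x + s) - 2 * (\<alpha> + 1) * (x + s)) * f1 s + phi (f s) = 0))"

text \<open>With \<open>u' = s * \<zeta>\<close> the singular term \<open>(N - 1) / s * u'\<close>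
  becomes regular, and the equation takes the form of \<open>fuchs_real\<close> with
  \<open>\<mu> = N\<close>.\<close>

lemma analytic_solution_0:
  assumes u0: "0 < u0"
  obtains r F f f1 f2 where "analytic_solution_at 0 r F f f1 f2" "f 0 = u0" "f1 0 = 0"
proof -
  define k where "k = 2 * (\<alpha> + 1) - (real N - 1)"
  have sq: "1 - s\<^sup>2 \<noteq> 0" if "s \<in> ball 0 1" for s :: complex
  proof
    assume "1 - s\<^sup>2 = 0"
    hence "s\<^sup>2 = 1" by (metis eq_iff_diff_eq_0)
    hence "s = 1 \<or> s = -1" by (simp only: power2_eq_1_iff)
    thus False using that by auto
  qed
  have hol: "(\<lambda>s. of_real lam / (1 - s\<^sup>2)) holomorphic_on ball 0 1" "(\<lambda>s. - 1 / (1 - s\<^sup>2)) holomorphic_on ball 0 1"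
      "(\<lambda>_. 0) holomorphic_on ball (0::complex) 1" "(\<lambda>s. of_real k * s / (1 - s\<^sup>2)) holomorphic_on ball 0 1"
    by (intro holomorphic_intros sq; assumption)+
  have N0: "0 < real N" using N by simp
  have sym: "of_real lam / (1 - (cnj s)\<^sup>2) = cnj (of_real lam / (1 - s\<^sup>2))" "- 1 / (1 - (cnj s)\<^sup>2) = cnj (- 1 / (1 - s\<^sup>2))"
      "0 = cnj 0" "of_real k * cnj s / (1 - (cnj s)\<^sup>2) = cnj (of_real k * s / (1 - s\<^sup>2))" for s
    by simp_all
  obtain r F f \<zeta> \<zeta>' where f: "0 < r" "r \<le> 1" "F holomorphic_on ball 0 r" "f 0 = u0"
    and fs: "\<forall>s. \<bar>s\<bar> < r \<longrightarrow> F (of_real s) = of_real (f s) \<and> 0 < f s \<and>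
      (f has_real_derivative 0 + s ^ 1 * \<zeta> s) (at s) \<and> (\<zeta> has_real_derivative \<zeta>' s) (at s) \<and>
      s * \<zeta>' s + real N * \<zeta> s = Re (of_real lam / (1 - (of_real s)\<^sup>2)) * f s + Re (- 1 / (1 - (of_real s)\<^sup>2)) * f s powr p + Re 0
       + Re (of_real k * of_real s / (1 - (of_real s)\<^sup>2)) * (s * \<zeta> s)"
    using fuchs_real[where A = "\<lambda>s. of_real lam / (1 - s\<^sup>2)" and B = "\<lambda>s. - 1 / (1 - s\<^sup>2)" and C = "\<lambda>_. 0"
      and D = "\<lambda>s. of_real k * s / (1 - s\<^sup>2)" and ?y0.0 = 0 and j = 1 and p = p, OF zero_less_one N0 u0 hol sym]
    by (elim exE conjE)
  show thesis
  proof (rule that[of r F f "\<lambda>s. s * \<zeta> s" "\<lambda>s. \<zeta> s + s * \<zeta>' s"])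
    show "analytic_solution_at 0 r F f (\<lambda>s. s * \<zeta> s) (\<lambda>s. \<zeta> s + s * \<zeta>' s)"
      unfolding analytic_solution_at_def
    proof (intro conjI allI impI)
      fix s assume s: "\<bar>s\<bar> < r"
      note fx = fs[rule_format, OF s]
      show "(f has_real_derivative s * \<zeta> s) (at s)" using fx by simp
      show "((\<lambda>s. s * \<zeta> s) has_real_derivative \<zeta> s + s * \<zeta>' s) (at s)"
        using fx by (auto intro!: derivative_eq_intros)
      assume s0: "0 + s \<noteq> 0"
      have q: "1 - s\<^sup>2 \<noteq> 0" using s f(2) abs_square_less_1[of s] by simp
      define d where "d = 1 - s\<^sup>2"
      have d: "1 - (of_real s)\<^sup>2 = (of_real d :: complex)" by (simp add: d_def)
      have e: "s * \<zeta>' s + real N * \<zeta> s = lam / d * f s + (- 1 / d) * f s powr p + k * s / d * (s * \<zeta> s)"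
        using fx unfolding d by simp
      have "d * (s * \<zeta>' s + real N * \<zeta> s) = lam * f s - f s powr p + k * s * (s * \<zeta> s)"
        unfolding e using q by (simp add: d_def[symmetric] distrib_left right_diff_distrib)
      hence "(1 - s\<^sup>2) * (s * \<zeta>' s + real N * \<zeta> s) = lam * f s - f s powr p + k * s * (s * \<zeta> s)"
        unfolding d_def .
      moreover have "((real N - 1) / s - 2 * (\<alpha> + 1) * s) * (s * \<zeta> s) = (real N - 1) * \<zeta> s - 2 * (\<alpha> + 1) * s\<^sup>2 * \<zeta> s"
        using s0 by (simp add: field_simps power2_eq_square)
      ultimately show "(1 - (0 + s)\<^sup>2) * (\<zeta> s + s * \<zeta>' s) + ((real N - 1) / (0 + s) - 2 * (\<alpha> + 1) * (0 + s)) * (s * \<zeta> s) + phi (f s) = 0"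
        by (simp add: phi_def k_def algebra_simps power2_eq_square)
    qed (use f fs in auto)
  qed (use f in auto)
qed

text \<open>With \<open>u' = y0 + s * \<zeta>\<close> the second derivative is
  \<open>s * \<zeta>' + \<zeta>\<close>, so a regular point is the case \<open>\<mu> = 1\<close>;
  both initial data are free.\<close>

lemma analytic_solution_interior:
  assumes u0: "0 < u0" and x: "0 < x" "x < 1"
  obtains r F f f1 f2 where "analytic_solution_at x r F f f1 f2" "f 0 = u0" "f1 0 = y0"
proof -
  define r0 where "r0 = min x (1 - x)"
  have r0: "0 < r0" using x by (simp add: r0_def)
  have nz: "of_real x + s \<noteq> 0" "1 - (of_real x + s)\<^sup>2 \<noteq> 0" if s: "s \<in> ball 0 r0" for s :: complex
  proof -
    have n: "norm s < x" "norm s < 1 - x" using s by (auto simp: r0_def)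
    show "of_real x + s \<noteq> 0"
    proof
      assume "of_real x + s = 0"
      hence "s = - of_real x" by (simp add: eq_neg_iff_add_eq_0 add.commute)
      thus False using n x by simp
    qed
    show "1 - (of_real x + s)\<^sup>2 \<noteq> 0"
    proof
      assume "1 - (of_real x + s)\<^sup>2 = 0"
      hence "(of_real x + s)\<^sup>2 = 1" by (metis eq_iff_diff_eq_0)
      hence "of_real x + s = 1 \<or> of_real x + s = -1" by (simp only: power2_eq_1_iff)
      hence "s = 1 - of_real x \<or> s = - 1 - of_real x" by (metis add_diff_cancel_left')
      hence "s = of_real (1 - x) \<or> s = of_real (- 1 - x)" by simp
      hence "norm s = \<bar>1 - x\<bar> \<or> norm s = \<bar>- 1 - x\<bar>" by (metis norm_of_real)
      thus False using n x by auto
    qed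
  qed
  define a where "a s = - ((of_real (real N - 1)) / (of_real x + s) - of_real (2 * (\<alpha> + 1)) * (of_real x + s)) / (1 - (of_real x + s)\<^sup>2)" for s :: complex
  have hola: "a holomorphic_on ball 0 r0"
    unfolding a_def[abs_def] by (intro holomorphic_intros nz; assumption)
  have hol: "(\<lambda>s. of_real lam / (1 - (of_real x + s)\<^sup>2)) holomorphic_on ball 0 r0" "(\<lambda>s. - 1 / (1 - (of_real x + s)\<^sup>2)) holomorphic_on ball 0 r0"
     "(\<lambda>s. a s * of_real y0) holomorphic_on ball 0 r0"
    by (intro holomorphic_intros nz hola; assumption)+
  have sym: "of_real lam / (1 - (of_real x + cnj s)\<^sup>2) = cnj (of_real lam / (1 - (of_real x + s)\<^sup>2))"
      "- 1 / (1 - (of_real x + cnj s)\<^sup>2) = cnj (- 1 / (1 - (of_real x + s)\<^sup>2))"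
      "a (cnj s) * of_real y0 = cnj (a s * of_real y0)" "a (cnj s) = cnj (a s)" for s
    by (simp_all add: a_def)
  obtain r F f \<zeta> \<zeta>' where f: "0 < r" "r \<le> r0" "F holomorphic_on ball 0 r" "f 0 = u0"
    and fs: "\<forall>s. \<bar>s\<bar> < r \<longrightarrow> F (of_real s) = of_real (f s) \<and> 0 < f s \<and>
      (f has_real_derivative y0 + s ^ 1 * \<zeta> s) (at s) \<and> (\<zeta> has_real_derivative \<zeta>' s) (at s) \<and>
      s * \<zeta>' s + 1 * \<zeta> s = Re (of_real lam / (1 - (of_real x + of_real s)\<^sup>2)) * f s + Re (- 1 / (1 - (of_real x + of_real s)\<^sup>2)) * f s powr p
       + Re (a (of_real s) * of_real y0) + Re (a (of_real s)) * (s * \<zeta> s)"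
    using fuchs_real[where A = "\<lambda>s. of_real lam / (1 - (of_real x + s)\<^sup>2)" and B = "\<lambda>s. - 1 / (1 - (of_real x + s)\<^sup>2)"
      and C = "\<lambda>s. a s * of_real y0" and D = a and ?y0.0 = y0 and j = 1 and p = p, OF r0 zero_less_one u0 hol hola sym]
    by (elim exE conjE)
  show thesis
  proof (rule that[of r F f "\<lambda>s. y0 + s * \<zeta> s" "\<lambda>s. \<zeta> s + s * \<zeta>' s"])
    show "analytic_solution_at x r F f (\<lambda>s. y0 + s * \<zeta> s) (\<lambda>s. \<zeta> s + s * \<zeta>' s)"
      unfolding analytic_solution_at_def
    proof (intro conjI allI impI)
      fix s assume s: "\<bar>s\<bar> < r"
      note fx = fs[rule_format, OF s]
      show "(f has_real_derivative y0 + s * \<zeta> s) (at s)" using fx by simp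
      show "((\<lambda>s. y0 + s * \<zeta> s) has_real_derivative \<zeta> s + s * \<zeta>' s) (at s)"
        using fx by (auto intro!: derivative_eq_intros)
      assume s0: "x + s \<noteq> 0"
      define X where "X = x + s"
      have X: "0 < X" "X < 1" using s f(2) by (auto simp: X_def r0_def)
      have q: "1 - X\<^sup>2 \<noteq> 0" using one_minus_square_pos[of X] X by simp
      define A where "A = - ((real N - 1) / X - 2 * (\<alpha> + 1) * X) / (1 - X\<^sup>2)"
      have cX: "of_real x + of_real s = (of_real X :: complex)" by (simp add: X_def)
      have ra: "a (of_real s) = of_real A" unfolding a_def cX A_def by simp
      define d where "d = 1 - X\<^sup>2"
      have d: "1 - (of_real X)\<^sup>2 = (of_real d :: complex)" by (simp add: d_def)
      have e: "s * \<zeta>' s + \<zeta> s = lam / d * f s + (- 1 / d) * f s powr p + A * y0 + A * (s * \<zeta> s)"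
        using fx unfolding ra cX d by simp
      have "(1 - X\<^sup>2) * (s * \<zeta>' s + \<zeta> s) = lam * f s - f s powr p + (1 - X\<^sup>2) * A * (y0 + s * \<zeta> s)"
        unfolding e d_def[symmetric] using q[folded d_def] by (simp add: distrib_left right_diff_distrib mult_ac)
      also have "(1 - X\<^sup>2) * A = - ((real N - 1) / X - 2 * (\<alpha> + 1) * X)" unfolding A_def using q by simp
      finally show "(1 - (x + s)\<^sup>2) * (\<zeta> s + s * \<zeta>' s) + ((real N - 1) / (x + s) - 2 * (\<alpha> + 1) * (x + s)) * (y0 + s * \<zeta> s) + phi (f s) = 0"
        unfolding X_def[symmetric] phi_def by (simp add: algebra_simps)
    qed (use f fs in auto)
  qed (use f in auto)
qed

text \<open>Here \<open>\<zeta> = u'\<close>, and \<open>1 - (1 + s)\<^sup>2 = - s * (2 + s)\<close>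
  supplies the factor \<open>s\<close>; the coefficient of \<open>u'\<close> leaves
  \<open>\<mu> = m\<close>. Only the value at \<open>1\<close> can be prescribed.\<close>

lemma analytic_solution_1:
  assumes u0: "0 < u0"
  obtains r F f f1 f2 where "analytic_solution_at 1 r F f f1 f2" "f 0 = u0"
proof -
  define k where "k = real N - 1"
  \<comment> \<open>\<open>d0\<close> and \<open>d1\<close> are the coefficients of the linear
    numerator that remains when the value \<open>m\<close> at \<open>s = 0\<close> is split off from
    the coefficient of \<open>u'\<close>.\<close>
  define d0 where "d0 = (\<alpha> + 1) + 3 * k / 2"
  define d1 where "d1 = (\<alpha> + 1) + k / 2"
  define D where "D s = - (of_real d0 + of_real d1 * s) / ((1 + s) * (2 + s))" for s :: complex
  have nz: "1 + s \<noteq> 0" "2 + s \<noteq> 0" if s: "s \<in> ball 0 1" for s :: complex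
  proof -
    show "1 + s \<noteq> 0"
    proof
      assume "1 + s = 0"
      hence "s = - 1" by (simp add: eq_neg_iff_add_eq_0 add.commute)
      thus False using s by simp
    qed
    show "2 + s \<noteq> 0"
    proof
      assume "2 + s = 0"
      hence "s = - 2" by (simp add: eq_neg_iff_add_eq_0 add.commute)
      thus False using s by simp
    qed
  qed
  have holD: "D holomorphic_on ball 0 1"
    unfolding D_def[abs_def] using nz by (intro holomorphic_intros) auto
  have hol: "(\<lambda>s. - of_real lam / (2 + s)) holomorphic_on ball 0 1" "(\<lambda>s. 1 / (2 + s)) holomorphic_on ball 0 1"
     "(\<lambda>_. 0) holomorphic_on ball (0::complex) 1"
    by (intro holomorphic_intros nz; assumption)+
  have sym: "- of_real lam / (2 + cnj s) = cnj (- of_real lam / (2 + s))" "1 / (2 + cnj s) = cnj (1 / (2 + s))"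
      "0 = cnj 0" "D (cnj s) = cnj (D s)" for s
    by (simp_all add: D_def)
  obtain r F f \<zeta> \<zeta>' where f: "0 < r" "r \<le> 1" "F holomorphic_on ball 0 r" "f 0 = u0"
    and fs: "\<forall>s. \<bar>s\<bar> < r \<longrightarrow> F (of_real s) = of_real (f s) \<and> 0 < f s \<and>
      (f has_real_derivative 0 + s ^ 0 * \<zeta> s) (at s) \<and> (\<zeta> has_real_derivative \<zeta>' s) (at s) \<and>
      s * \<zeta>' s + m * \<zeta> s = Re (- of_real lam / (2 + of_real s)) * f s + Re (1 / (2 + of_real s)) * f s powr p
       + Re 0 + Re (D (of_real s)) * (s * \<zeta> s)"
    using fuchs_real[where A = "\<lambda>s. - of_real lam / (2 + s)" and B = "\<lambda>s. 1 / (2 + s)" and C = "\<lambda>_. 0" and D = D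
      and ?y0.0 = 0 and j = 0 and p = p, OF zero_less_one m_bounds(1) u0 hol holD sym]
    by (elim exE conjE)
  show thesis
  proof (rule that[of r F f \<zeta> \<zeta>'])
    show "analytic_solution_at 1 r F f \<zeta> \<zeta>'"
      unfolding analytic_solution_at_def
    proof (intro conjI allI impI)
      fix s assume s: "\<bar>s\<bar> < r"
      note fx = fs[rule_format, OF s]
      show "(f has_real_derivative \<zeta> s) (at s)" using fx by simp
      assume s0: "1 + s \<noteq> 0"
      have q: "1 + s \<noteq> 0" "2 + s \<noteq> 0" using s f(2) by auto
      define E where "E = - (d0 + d1 * s) / ((1 + s) * (2 + s))"
      have rD: "D (of_real s) = of_real E" by (simp add: D_def E_def)
      define d where "d = 2 + s"
      have d: "2 + of_real s = (of_real d :: complex)" by (simp add: d_def)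
      have "s * \<zeta>' s = - m * \<zeta> s + (- lam / d) * f s + (1 / d) * f s powr p + E * (s * \<zeta> s)"
        using fx unfolding rD d by simp
      hence e: "s * \<zeta>' s = - m * \<zeta> s + (- lam / (2 + s)) * f s + (1 / (2 + s)) * f s powr p
          + - (d0 + d1 * s) / ((1 + s) * (2 + s)) * (s * \<zeta> s)"
        unfolding d_def E_def .
      have "(1 - (1 + s)\<^sup>2) * \<zeta>' s = - (2 + s) * (s * \<zeta>' s)" by (simp add: power2_eq_square algebra_simps)
      also have "\<dots> = lam * f s - f s powr p + (m * (2 + s) + (d0 + d1 * s) * s / (1 + s)) * \<zeta> s"
        unfolding e using q by (simp add: divide_simps) (simp add: algebra_simps)
      also have "m * (2 + s) + (d0 + d1 * s) * s / (1 + s) = - (k / (1 + s) - 2 * (\<alpha> + 1) * (1 + s))"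
        using q by (simp add: m_def d0_def d1_def k_def divide_simps) (simp add: algebra_simps)
      finally show "(1 - (1 + s)\<^sup>2) * \<zeta>' s + ((real N - 1) / (1 + s) - 2 * (\<alpha> + 1) * (1 + s)) * \<zeta> s + phi (f s) = 0"
        by (simp add: phi_def k_def algebra_simps)
    qed (use f fs in auto)
  qed (use f in auto)
qed

lemma analytic_solutionD:
  assumes "analytic_solution_at x r F f f1 f2"
  shows "0 < r" "F holomorphic_on ball 0 r" "\<bar>s\<bar> < r \<Longrightarrow> F (of_real s) = of_real (f s)" "\<bar>s\<bar> < r \<Longrightarrow> 0 < f s"
    "\<bar>s\<bar> < r \<Longrightarrow> (f has_real_derivative f1 s) (at s)" "\<bar>s\<bar> < r \<Longrightarrow> (f1 has_real_derivative f2 s) (at s)"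
    "\<bar>s\<bar> < r \<Longrightarrow> x + s \<noteq> 0 \<Longrightarrow>
       (1 - (x + s)\<^sup>2) * f2 s + ((real N - 1) / (x + s) - 2 * (\<alpha> + 1) * (x + s)) * f1 s + phi (f s) = 0"
  using assms unfolding analytic_solution_at_def by auto

lemma analytic_solution_shrink:
  assumes "analytic_solution_at x r F f f1 f2" "0 < r'" "r' \<le> r"
  shows "analytic_solution_at x r' F f f1 f2"
proof -
  have "F holomorphic_on ball 0 r'"
    by (rule holomorphic_on_subset[OF analytic_solutionD(2)[OF assms(1)]]) (use assms in auto)
  thus ?thesis using assms unfolding analytic_solution_at_def by auto
qed

lemma shifted_derivs:
  assumes "analytic_solution_at x r F f f1 f2" "\<bar>\<rho> - x\<bar> < r"
  shows "((\<lambda>\<rho>. f (\<rho> - x)) has_real_derivative f1 (\<rho> - x)) (at \<rho>)"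
    "((\<lambda>\<rho>. f1 (\<rho> - x)) has_real_derivative f2 (\<rho> - x)) (at \<rho>)"
proof -
  have d: "((\<lambda>\<rho>. \<rho> - x) has_real_derivative 1) (at \<rho>)" by (auto intro!: derivative_eq_intros)
  show "((\<lambda>\<rho>. f (\<rho> - x)) has_real_derivative f1 (\<rho> - x)) (at \<rho>)"
    "((\<lambda>\<rho>. f1 (\<rho> - x)) has_real_derivative f2 (\<rho> - x)) (at \<rho>)"
    using DERIV_chain2[where f = f and g = "\<lambda>\<rho>. \<rho> - x" and x = \<rho>, OF analytic_solutionD(5)[OF assms] d]
      DERIV_chain2[where f = f1 and g = "\<lambda>\<rho>. \<rho> - x" and x = \<rho>, OF analytic_solutionD(6)[OF assms] d]
    by simp_all
qed

section \<open>Identification of the shooting solutions with local analytic solutions\<close>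

lemma P1_cont: "continuous_on {0..1} P1"
proof -
  have "\<forall>x\<in>{0..1}. 0 \<le> 1 - (x::real)\<^sup>2" by (auto intro: power_le_one)
  thus ?thesis unfolding P1_def[abs_def] using m_bounds
    by (intro continuous_on_mult continuous_on_power continuous_on_id continuous_on_powr' continuous_on_diff continuous_on_const) auto
qed

lemma analytic_solves:
  assumes an: "analytic_solution_at x r F f f1 f2" and a: "0 \<le> a" "y \<le> 1" "x - r < a" "y < x + r"
  shows "solves phi a y (\<lambda>\<rho>. f (\<rho> - x)) (\<lambda>\<rho>. P1 \<rho> * f1 (\<rho> - x))"
  unfolding solves_def
proof (intro conjI ballI)
  have n: "\<bar>\<rho> - x\<bar> < r" if "\<rho> \<in> {a..y}" for \<rho> using that a by auto
  note d = shifted_derivs[OF an n]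
  show "continuous_on {a..y} (\<lambda>\<rho>. f (\<rho> - x))"
    by (rule DERIV_continuous_on, rule has_field_derivative_at_within[OF d(1)])
  have "continuous_on {a..y} (\<lambda>\<rho>. f1 (\<rho> - x))"
    by (rule DERIV_continuous_on, rule has_field_derivative_at_within[OF d(2)])
  thus "continuous_on {a..y} (\<lambda>\<rho>. P1 \<rho> * f1 (\<rho> - x))"
    using a by (intro continuous_on_mult continuous_on_subset[OF P1_cont]) auto
  fix \<rho> assume \<rho>: "\<rho> \<in> {a<..<y}"
  hence r01: "0 < \<rho>" "\<rho> < 1" and r: "\<rho> \<in> {a..y}" using a by auto
  note P = P1_pos[OF r01]
  have S: "1 - \<rho>\<^sup>2 \<noteq> 0" using one_minus_square_pos[of \<rho>] r01 by simp
  show "((\<lambda>\<rho>. f (\<rho> - x)) has_real_derivative P1 \<rho> * f1 (\<rho> - x) / P1 \<rho>) (at \<rho>)"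
    using d(1)[OF r] P by simp
  have eq: "(1 - \<rho>\<^sup>2) * f2 (\<rho> - x) = - ((real N - 1) / \<rho> - 2 * (\<alpha> + 1) * \<rho>) * f1 (\<rho> - x) - phi (f (\<rho> - x))"
    using analytic_solutionD(7)[OF an n[OF r]] r01 by (simp add: algebra_simps)
  have "((\<lambda>\<rho>. P1 \<rho> * f1 (\<rho> - x)) has_real_derivative
     P1 \<rho> * f2 (\<rho> - x) + (P1 \<rho> * ((real N - 1) / \<rho> - 2 * m * \<rho> / (1 - \<rho>\<^sup>2))) * f1 (\<rho> - x)) (at \<rho>)"
    by (rule DERIV_mult'[OF P1_deriv[OF r01] d(2)[OF r]])
  also have "P1 \<rho> * f2 (\<rho> - x) + (P1 \<rho> * ((real N - 1) / \<rho> - 2 * m * \<rho> / (1 - \<rho>\<^sup>2))) * f1 (\<rho> - x)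
     = P1 \<rho> / (1 - \<rho>\<^sup>2) * ((1 - \<rho>\<^sup>2) * f2 (\<rho> - x) + ((real N - 1) / \<rho> * (1 - \<rho>\<^sup>2) - 2 * m * \<rho>) * f1 (\<rho> - x))"
  proof -
    have "P1 \<rho> / S * (S * z + (e * S - k) * w) = P1 \<rho> * z + (P1 \<rho> * (e - k / S)) * w" if "S \<noteq> 0" for S z e k w :: real
      using that by (simp add: field_simps)
    from this[OF S, of "f2 (\<rho> - x)" "(real N - 1) / \<rho>" "2 * m * \<rho>" "f1 (\<rho> - x)"] show ?thesis by simp
  qed
  also have "(real N - 1) / \<rho> * (1 - \<rho>\<^sup>2) - 2 * m * \<rho> = (real N - 1) / \<rho> - 2 * (\<alpha> + 1) * \<rho>"
    using r01 by (simp add: m_def field_simps power2_eq_square)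
  also have "(1 - \<rho>\<^sup>2) * f2 (\<rho> - x) + ((real N - 1) / \<rho> - 2 * (\<alpha> + 1) * \<rho>) * f1 (\<rho> - x) = - phi (f (\<rho> - x))"
    unfolding eq by (simp add: algebra_simps)
  finally show "((\<lambda>\<rho>. P1 \<rho> * f1 (\<rho> - x)) has_real_derivative - (P2 \<rho> * phi (f (\<rho> - x)))) (at \<rho>)"
    by (simp add: P2_eq[OF r01])
qed

text \<open>The analytic solution with the data of \<open>U c\<close> at \<open>x\<close> is
  identified with \<open>U c\<close> by uniqueness: to the right at \<open>0\<close>, to both sides
  inside, to the left at \<open>1\<close>. The hypothesis on \<open>Q c 1\<close> serves the last
  case.\<close>

lemma U_locally_analytic:
  assumes c: "c0 \<le> c" and Q1: "Q c 1 = 0" and x: "0 \<le> x" "x \<le> 1"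
  obtains r F f f1 f2 where "analytic_solution_at x r F f f1 f2"
    "\<forall>\<rho>\<in>{0..1}. \<bar>\<rho> - x\<bar> < r \<longrightarrow> U c \<rho> = f (\<rho> - x)"
proof -
  note r = reg_U[OF c]
  have cp: "0 < c" using c c0_pos by simp
  have ux: "0 < U c x" by (rule U_bounds(1)[OF c x])
  have bounded: "\<exists>M>0. \<forall>\<rho>. a < \<rho> \<and> \<rho> < y \<longrightarrow> U c \<rho> \<in> {0..M} \<and> f (\<rho> - x) \<in> {0..M}"
    if an: "analytic_solution_at x r F f f1 f2" and a: "0 \<le> a" "y \<le> 1" "x - r < a" "y < x + r" for r F f f1 f2 a y
  proof -
    obtain B where B: "0 < B" "\<And>\<rho>. \<rho> \<in> {a..y} \<Longrightarrow> \<bar>f (\<rho> - x)\<bar> \<le> B"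
      using continuous_on_Icc_bounded[OF solvesD(1)[OF analytic_solves[OF an a]]] by blast
    show ?thesis
    proof (intro exI[of _ "max B c"] conjI allI impI)
      fix \<rho> assume "a < \<rho> \<and> \<rho> < y"
      hence \<rho>: "a < \<rho>" "\<rho> < y" by auto
      show "U c \<rho> \<in> {0..max B c}" using U_bounds[OF c, of \<rho>] \<rho> a by auto
      have "\<bar>\<rho> - x\<bar> < r" using \<rho> a by auto
      from analytic_solutionD(4)[OF an this] B(2)[of \<rho>] \<rho> show "f (\<rho> - x) \<in> {0..max B c}" by auto
    qed (use B in simp)
  qed
  have sU: "solves phi a y (U c) (Q c)" if "0 \<le> a" "y \<le> 1" for a y
    by (rule solves_subset[OF regD(3)[OF r] that])
  consider "x = 0" | "0 < x" "x < 1" | "x = 1" using x by linarith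
  thus thesis
  proof cases
    case 1
    obtain r F f f1 f2 where an: "analytic_solution_at 0 r F f f1 f2" "f 0 = c" "f1 0 = 0"
      using analytic_solution_0[OF cp] by blast
    have an1: "analytic_solution_at x r F f f1 f2" using an(1) 1 by simp
    define y where "y = min (r / 2) (1 / 2)"
    have y: "0 < y" "y \<le> 1 / 2" "y < r" using analytic_solutionD(1)[OF an1] by (auto simp: y_def)
    have "\<exists>M>0. \<forall>\<rho>. 0 < \<rho> \<and> \<rho> < y \<longrightarrow> U c \<rho> \<in> {0..M} \<and> f (\<rho> - x) \<in> {0..M}"
      by (rule bounded[OF an1]) (use y 1 in auto)
    then obtain M where M: "0 < M" "\<And>\<rho>. 0 < \<rho> \<Longrightarrow> \<rho> < y \<Longrightarrow> U c \<rho> \<in> {0..M}" "\<And>\<rho>. 0 < \<rho> \<Longrightarrow> \<rho> < y \<Longrightarrow> f (\<rho> - x) \<in> {0..M}"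
      by blast
    have right: "U c \<rho> = f (\<rho> - x)" if "0 \<le> \<rho>" "\<rho> \<le> y" for \<rho>
    proof (rule forward_unique_0[OF sU analytic_solves[OF an1] M])
      show "U c 0 = f (0 - x)" "Q c 0 = P1 0 * f1 (0 - x)" using 1 an regD(4,5)[OF r] by auto
    qed (use y 1 that in auto)
    show thesis
    proof (rule that[OF analytic_solution_shrink[OF an1, of y]])
      show "\<forall>\<rho>\<in>{0..1}. \<bar>\<rho> - x\<bar> < y \<longrightarrow> U c \<rho> = f (\<rho> - x)" using right 1 by auto
    qed (use y in auto)
  next
    case 2
    obtain r F f f1 f2 where an: "analytic_solution_at x r F f f1 f2" "f 0 = U c x" "f1 0 = Q c x / P1 x"
      using analytic_solution_interior[OF ux 2] by blast
    define h where "h = min (r / 2) (min (x / 2) ((1 - x) / 2))"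
    have "0 < h" "h \<le> r / 2" "h \<le> x / 2" "h \<le> (1 - x) / 2"
      using analytic_solutionD(1)[OF an(1)] 2 by (auto simp: h_def min_def)
    hence h: "0 < h" "h < r" "h < x" "h < 1 - x" using analytic_solutionD(1)[OF an(1)] 2 by auto
    have eqx: "U c x = f (x - x)" "Q c x = P1 x * f1 (x - x)" using an P1_pos[OF 2] by auto
    have "\<exists>M>0. \<forall>\<rho>. x < \<rho> \<and> \<rho> < x + h \<longrightarrow> U c \<rho> \<in> {0..M} \<and> f (\<rho> - x) \<in> {0..M}"
      by (rule bounded[OF an(1)]) (use h 2 in auto)
    then obtain M where M: "0 < M" "\<And>\<rho>. x < \<rho> \<Longrightarrow> \<rho> < x + h \<Longrightarrow> U c \<rho> \<in> {0..M}" "\<And>\<rho>. x < \<rho> \<Longrightarrow> \<rho> < x + h \<Longrightarrow> f (\<rho> - x) \<in> {0..M}"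
      by blast
    have right: "U c \<rho> = f (\<rho> - x)" if "x \<le> \<rho>" "\<rho> \<le> x + h" for \<rho>
      by (rule forward_unique[OF sU analytic_solves[OF an(1)] M _ _ _ eqx]) (use h 2 that in auto)
    have "\<exists>M>0. \<forall>\<rho>. x - h < \<rho> \<and> \<rho> < x \<longrightarrow> U c \<rho> \<in> {0..M} \<and> f (\<rho> - x) \<in> {0..M}"
      by (rule bounded[OF an(1)]) (use h 2 in auto)
    then obtain M where M: "0 < M" "\<And>\<rho>. x - h < \<rho> \<Longrightarrow> \<rho> < x \<Longrightarrow> U c \<rho> \<in> {0..M}" "\<And>\<rho>. x - h < \<rho> \<Longrightarrow> \<rho> < x \<Longrightarrow> f (\<rho> - x) \<in> {0..M}"
      by blast
    have left: "U c \<rho> = f (\<rho> - x)" if "x - h \<le> \<rho>" "\<rho> \<le> x" for \<rho>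
      by (rule backward_unique[OF sU analytic_solves[OF an(1)] M _ _ eqx]) (use h 2 that in auto)
    show thesis
    proof (rule that[OF analytic_solution_shrink[OF an(1), of h]])
      have "U c \<rho> = f (\<rho> - x)" if "\<bar>\<rho> - x\<bar> < h" for \<rho>
        using left[of \<rho>] right[of \<rho>] that by (cases "\<rho> \<le> x") auto
      thus "\<forall>\<rho>\<in>{0..1}. \<bar>\<rho> - x\<bar> < h \<longrightarrow> U c \<rho> = f (\<rho> - x)" by simp
    qed (use h in auto)
  next
    case 3
    obtain r F f f1 f2 where an: "analytic_solution_at 1 r F f f1 f2" "f 0 = U c x"
      by (rule analytic_solution_1[OF ux])
    have an1: "analytic_solution_at x r F f f1 f2" using an(1) 3 by simp
    define h where "h = min (r / 2) (1 / 2)"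
    have h: "0 < h" "h < r" "h \<le> 1 / 2" using analytic_solutionD(1)[OF an1] by (auto simp: h_def)
    \<comment> \<open>\<open>P1 1 = 0\<close> gives the analytic solution flux zero at
      \<open>1\<close>, which matches \<open>Q c 1 = 0\<close>.\<close>
    have eqx: "U c 1 = f (1 - x)" "Q c 1 = P1 1 * f1 (1 - x)" using an(2) Q1 3 by (simp_all add: P1_def)
    have "\<exists>M>0. \<forall>\<rho>. 1 - h < \<rho> \<and> \<rho> < 1 \<longrightarrow> U c \<rho> \<in> {0..M} \<and> f (\<rho> - x) \<in> {0..M}"
      by (rule bounded[OF an1]) (use h 3 in auto)
    then obtain M where M: "0 < M" "\<And>\<rho>. 1 - h < \<rho> \<Longrightarrow> \<rho> < 1 \<Longrightarrow> U c \<rho> \<in> {0..M}" "\<And>\<rho>. 1 - h < \<rho> \<Longrightarrow> \<rho> < 1 \<Longrightarrow> f (\<rho> - x) \<in> {0..M}"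
      by blast
    have left: "U c \<rho> = f (\<rho> - x)" if "1 - h \<le> \<rho>" "\<rho> \<le> 1" for \<rho>
      by (rule backward_unique[OF sU analytic_solves[OF an1] M _ _ eqx]) (use h 3 that in auto)
    show thesis
    proof (rule that[OF analytic_solution_shrink[OF an1, of h]])
      show "\<forall>\<rho>\<in>{0..1}. \<bar>\<rho> - x\<bar> < h \<longrightarrow> U c \<rho> = f (\<rho> - x)" using left 3 by auto
    qed (use h in auto)
  qed
qed

text \<open>The centre \<open>x0\<close> may differ from \<open>x\<close>: to the right of
  \<open>1\<close> the solution is given only through the expansion at \<open>1\<close>.\<close>

definition locally_analytic_solution :: "(real \<Rightarrow> real) \<Rightarrow> real set \<Rightarrow> bool" where
  "locally_analytic_solution u S \<longleftrightarrow> (\<forall>x\<in>S. \<exists>x0 r F f f1 f2. analytic_solution_at x0 r F f f1 f2 \<and> \<bar>x - x0\<bar> < r \<and>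
     (\<forall>\<rho>\<in>S. \<bar>\<rho> - x0\<bar> < r \<longrightarrow> u \<rho> = f (\<rho> - x0)))"

lemma locally_analytic_solutionE:
  assumes "locally_analytic_solution u S" "x \<in> S"
  obtains x0 r F f f1 f2 where "analytic_solution_at x0 r F f f1 f2" "\<bar>x - x0\<bar> < r"
     "\<forall>\<rho>\<in>S. \<bar>\<rho> - x0\<bar> < r \<longrightarrow> u \<rho> = f (\<rho> - x0)"
  using assms unfolding locally_analytic_solution_def by blast

lemma locally_analytic_solution_pos:
  assumes "locally_analytic_solution u S" "x \<in> S" shows "0 < u x"
proof (rule locally_analytic_solutionE[OF assms])
  fix x0 r F f f1 f2 assume an: "analytic_solution_at x0 r F f f1 f2" "\<bar>x - x0\<bar> < r"
    and u: "\<forall>\<rho>\<in>S. \<bar>\<rho> - x0\<bar> < r \<longrightarrow> u \<rho> = f (\<rho> - x0)"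
  show "0 < u x" using analytic_solutionD(4)[OF an] u assms(2) an(2) by simp
qed

text \<open>The holomorphic extension is expanded anew at \<open>x\<close>; the real parts of its
  Taylor coefficients give the real series.\<close>

lemma locally_analytic_solution_analytic:
  assumes "locally_analytic_solution u S"
  shows "real_analytic_on u S"
  unfolding real_analytic_on_def
proof
  fix x assume x: "x \<in> S"
  obtain x0 r F f f1 f2 where an: "analytic_solution_at x0 r F f f1 f2" "\<bar>x - x0\<bar> < r"
     "\<forall>\<rho>\<in>S. \<bar>\<rho> - x0\<bar> < r \<longrightarrow> u \<rho> = f (\<rho> - x0)"
    by (rule locally_analytic_solutionE[OF assms x])
  define d where "d = r - \<bar>x - x0\<bar>"
  define z where "z = complex_of_real (x - x0)"
  define a where "a k = Re ((deriv ^^ k) F z / fact k)" for k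
  have sub: "ball z d \<subseteq> ball 0 r"
  proof
    fix w assume "w \<in> ball z d"
    hence "norm (w - z) < d" by (simp add: dist_norm norm_minus_commute)
    moreover have "norm z = \<bar>x - x0\<bar>" unfolding z_def by (rule norm_of_real)
    ultimately show "w \<in> ball 0 r" using norm_triangle_ineq[of "w - z" z] by (simp add: d_def)
  qed
  have hol: "F holomorphic_on ball z d" by (rule holomorphic_on_subset[OF analytic_solutionD(2)[OF an(1)] sub])
  show "\<exists>a r. r > 0 \<and> (\<forall>y\<in>S. \<bar>y - x\<bar> < r \<longrightarrow> (\<lambda>k. a k * (y - x) ^ k) sums u y)"
  proof (intro exI[of _ a] exI[of _ d] conjI ballI impI)
    fix y assume y: "y \<in> S" "\<bar>y - x\<bar> < d"
    have yz: "of_real (y - x0) - z = of_real (y - x)" by (simp add: z_def)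
    have yb: "of_real (y - x0) \<in> ball z d"
      using y(2) yz by (metis dist_commute dist_norm mem_ball norm_of_real)
    have ys: "\<bar>y - x0\<bar> < r" using y by (simp add: d_def)
    have "(\<lambda>k. Re ((deriv ^^ k) F z / fact k * (of_real (y - x0) - z) ^ k)) sums Re (F (of_real (y - x0)))"
      by (rule sums_Re[OF holomorphic_power_series[OF hol yb]])
    also have "(\<lambda>k. Re ((deriv ^^ k) F z / fact k * (of_real (y - x0) - z) ^ k)) = (\<lambda>k. a k * (y - x) ^ k)"
    proof
      have "Re (w * of_real t) = Re w * t" for w t by simp
      thus "Re ((deriv ^^ k) F z / fact k * (of_real (y - x0) - z) ^ k) = a k * (y - x) ^ k" for k
        unfolding yz a_def of_real_power[symmetric] .
    qed
    also have "Re (F (of_real (y - x0))) = u y" using analytic_solutionD(3)[OF an(1) ys] an(3) y(1) ys by simp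
    finally show "(\<lambda>k. a k * (y - x) ^ k) sums u y" .
  qed (use an(2) in \<open>simp add: d_def\<close>)
qed

lemma locally_analytic_solution_solves:
  assumes u: "locally_analytic_solution u S" and S: "open T" "T \<subseteq> S" "0 \<notin> T"
  shows "is_solution_on N p u T"
  unfolding is_solution_on_def
proof (rule exI[of _ "deriv u"], rule exI[of _ "deriv (deriv u)"], rule ballI)
  fix x assume x: "x \<in> T"
  hence xS: "x \<in> S" using S(2) by blast
  obtain x0 r F f f1 f2 where an: "analytic_solution_at x0 r F f f1 f2" "\<bar>x - x0\<bar> < r"
     "\<forall>\<rho>\<in>S. \<bar>\<rho> - x0\<bar> < r \<longrightarrow> u \<rho> = f (\<rho> - x0)"
    by (rule locally_analytic_solutionE[OF u xS])
  define V where "V = T \<inter> {x0 - r<..<x0 + r}"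
  have V: "open V" "x \<in> V" using S x an(2) by (auto simp: V_def)
  have Vr: "\<bar>y - x0\<bar> < r" if "y \<in> V" for y using that by (auto simp: V_def)
  have ue: "f (y - x0) = u y" if "y \<in> V" for y using an(3) Vr[OF that] that S(2) by (auto simp: V_def)
  have u1: "(u has_real_derivative f1 (y - x0)) (at y)" if "y \<in> V" for y
    by (rule has_field_derivative_transform_within_open[OF shifted_derivs(1)[OF an(1) Vr[OF that]] V(1) that ue])
  hence du: "f1 (y - x0) = deriv u y" if "y \<in> V" for y using DERIV_imp_deriv that by metis
  have u2: "(deriv u has_real_derivative f2 (x - x0)) (at x)"
    by (rule has_field_derivative_transform_within_open[OF shifted_derivs(2)[OF an(1,2)] V du])
  hence ddu: "deriv (deriv u) x = f2 (x - x0)" by (rule DERIV_imp_deriv)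
  have x0: "x0 + (x - x0) \<noteq> 0" using x S(3) by auto
  have pos: "0 < u x" using analytic_solutionD(4)[OF an(1,2)] ue[OF V(2)] by simp
  have "\<bar>u x\<bar> powr (p - 1) * u x = u x powr p" using pos powr_p_eq[of "u x"] by simp
  moreover have "(1 - x\<^sup>2) * f2 (x - x0) + ((real N - 1) / x - 2 * (\<alpha> + 1) * x) * f1 (x - x0) + phi (u x) = 0"
    using analytic_solutionD(7)[OF an(1,2) x0] ue[OF V(2)] by simp
  ultimately show "(u has_real_derivative deriv u x) (at x) \<and> (deriv u has_real_derivative deriv (deriv u) x) (at x) \<and>
     (1 - x\<^sup>2) * deriv (deriv u) x + ((real N - 1) / x - 2 * (\<alpha> + 1) * x) * deriv u x
       - \<alpha> * (\<alpha> + 1) * u x + \<bar>u x\<bar> powr (p - 1) * u x = 0"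
    using u1[OF V(2)] u2 du[OF V(2)] by (simp add: ddu phi_def lam_def)
qed

text \<open>Beyond \<open>1\<close> the analytic solution at \<open>1\<close> is used; it agrees
  with \<open>U c\<close> to the left of \<open>1\<close>, so the glued function is analytic
  across.\<close>

lemma global_solution:
  assumes c: "c0 \<le> c" and Q1: "Q c 1 = 0"
  obtains R u where "1 < R" "locally_analytic_solution u {0..<R}" "\<And>\<rho>. 0 \<le> \<rho> \<Longrightarrow> \<rho> \<le> 1 \<Longrightarrow> u \<rho> = U c \<rho>"
proof -
  obtain r F f f1 f2 where an: "analytic_solution_at 1 r F f f1 f2"
    "\<forall>\<rho>\<in>{0..1}. \<bar>\<rho> - 1\<bar> < r \<longrightarrow> U c \<rho> = f (\<rho> - 1)"
    by (rule U_locally_analytic[OF c Q1 zero_le_one order_refl])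
  define u where "u \<rho> = (if \<rho> \<le> 1 then U c \<rho> else f (\<rho> - 1))" for \<rho>
  show thesis
  proof (rule that[of "1 + r" u])
    show "1 < 1 + r" using analytic_solutionD(1)[OF an(1)] by simp
    show "locally_analytic_solution u {0..<1 + r}"
      unfolding locally_analytic_solution_def
    proof
      fix x assume x: "x \<in> {0..<1 + r}"
      show "\<exists>x0 r' F f f1 f2. analytic_solution_at x0 r' F f f1 f2 \<and> \<bar>x - x0\<bar> < r' \<and>
        (\<forall>\<rho>\<in>{0..<1 + r}. \<bar>\<rho> - x0\<bar> < r' \<longrightarrow> u \<rho> = f (\<rho> - x0))"
      proof (cases "x < 1")
        case False
        hence "\<bar>x - 1\<bar> < r" using x by auto
        moreover have "u \<rho> = f (\<rho> - 1)" if "\<rho> \<in> {0..<1 + r}" "\<bar>\<rho> - 1\<bar> < r" for \<rho>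
          using that an(2) by (auto simp: u_def)
        ultimately show ?thesis
          by - (rule exI[of _ 1], rule exI[of _ r], rule exI[of _ F], rule exI[of _ f], rule exI[of _ f1], rule exI[of _ f2],
             use an(1) in simp)
      next
        case True
        hence x01: "0 \<le> x" "x \<le> 1" using x by auto
        obtain r' G g g1 g2 where g: "analytic_solution_at x r' G g g1 g2"
          "\<forall>\<rho>\<in>{0..1}. \<bar>\<rho> - x\<bar> < r' \<longrightarrow> U c \<rho> = g (\<rho> - x)"
          by (rule U_locally_analytic[OF c Q1 x01])
        \<comment> \<open>Staying below \<open>1\<close> keeps \<open>u\<close> equal to
          \<open>U c\<close> on the whole neighbourhood.\<close>
        define h where "h = min r' (1 - x)"
        have h: "0 < h" "h \<le> r'" "h \<le> 1 - x" using analytic_solutionD(1)[OF g(1)] True by (auto simp: h_def)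
        have "u \<rho> = g (\<rho> - x)" if "\<rho> \<in> {0..<1 + r}" "\<bar>\<rho> - x\<bar> < h" for \<rho>
          using that g(2) h by (auto simp: u_def)
        moreover have "\<bar>x - x\<bar> < h" using h by simp
        ultimately show ?thesis
          by - (rule exI[of _ x], rule exI[of _ h], rule exI[of _ G], rule exI[of _ g], rule exI[of _ g1], rule exI[of _ g2],
             use analytic_solution_shrink[OF g(1) h(1,2)] in simp)
      qed
    qed
  qed (simp add: u_def)
qed

lemma Q_c0: "Q c0 1 = 0"
proof -
  have phi0: "phi c0 = 0" unfolding phi_def using powr_p_eq[of c0] c0_pos by (simp add: c0_powr)
  note r = reg_U[OF order_refl]
  have "\<bar>Q c0 1 - Q c0 0\<bar> \<le> 0 - 0"
  proof (rule abs_le_by_derivative[where f = "Q c0" and g = "\<lambda>_. 0" and g' = "\<lambda>_. 0"])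
    fix x :: real assume x: "0 < x" "x < 1"
    show "(Q c0 has_real_derivative - (P2 x * phi (U c0 x))) (at x)" using regD(8)[OF r] x by simp
    show "\<bar>- (P2 x * phi (U c0 x))\<bar> \<le> 0" using U_c0[of x] x phi0 by simp
  qed (use solvesD(2)[OF regD(3)[OF r]] in auto)
  thus ?thesis using regD(5)[OF r] by simp
qed

text \<open>\<open>n = 0\<close> is the constant solution, the others come from
  \<open>shooting\<close>. If \<open>n\<close> exceeds the maximal count on \<open>{c0..M}\<close>,
  every parameter up to \<open>M\<close> lies below \<open>C n\<close>.\<close>

lemma solution_family:
  obtains C where "\<And>n. c0 \<le> C n" "\<And>n. card (Z (C n)) = n + 1" "\<And>n. Q (C n) 1 = 0" "filterlim C at_top sequentially"
proof -
  have "\<exists>c. c0 \<le> c \<and> card (Z c) = n + 1 \<and> Q c 1 = 0 \<and> (1 \<le> n \<longrightarrow> (\<forall>d. c0 \<le> d \<and> card (Z d) \<le> n \<longrightarrow> d \<le> c))" for n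
  proof (cases "1 \<le> n")
    case True
    show ?thesis by (rule shooting[OF True]) (intro exI conjI; auto)
  next
    case False
    thus ?thesis using card_Z_c0 Q_c0 by (intro exI[of _ c0]) auto
  qed
  then obtain C where C: "\<And>n. c0 \<le> C n" "\<And>n. card (Z (C n)) = n + 1" "\<And>n. Q (C n) 1 = 0"
     "\<And>n d. 1 \<le> n \<Longrightarrow> c0 \<le> d \<Longrightarrow> card (Z d) \<le> n \<Longrightarrow> d \<le> C n"
    by metis
  have "filterlim C at_top sequentially"
    unfolding filterlim_at_top
  proof
    fix M
    obtain K where K: "\<And>c. c \<in> {c0..max M c0} \<Longrightarrow> card (Z c) \<le> K" using Z_card_bounded by blast
    have "M \<le> C n" if "max 1 K \<le> n" for n
      using C(4)[of n "max M c0"] K[of "max M c0"] that by auto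
    thus "\<forall>\<^sub>F n in sequentially. M \<le> C n" unfolding eventually_sequentially by blast
  qed
  thus thesis using that C by blast
qed

end

theorem theorem1p1:
  fixes N :: nat and p :: real
  assumes "N \<ge> 3"
    and "p > 1 + 4 / (real N - 2)"
    and "N \<ge> 4 \<Longrightarrow> p < 1 + 4 / (real N - 3)"
  shows "\<exists>(R :: nat \<Rightarrow> real) (u :: nat \<Rightarrow> real \<Rightarrow> real).
    (\<forall>n. R n > 1
      \<and> real_analytic_on (u n) {0..<R n}
      \<and> (\<forall>\<rho>\<in>{0..<R n}. u n \<rho> > 0)
      \<and> is_solution_on N p (u n) {0<..<R n}
      \<and> finite {\<rho>\<in>{0<..<1}. u n \<rho> - u_inf N p \<rho> = 0}
      \<and> card {\<rho>\<in>{0<..<1}. u n \<rho> - u_inf N p \<rho> = 0} = n + 1)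
    \<and> filterlim (\<lambda>n. u n 0) at_top sequentially"
proof -
  interpret wave N p by unfold_locales (use assms in auto)
  obtain C where C: "\<And>n. c0 \<le> C n" "\<And>n. card (Z (C n)) = n + 1" "\<And>n. Q (C n) 1 = 0"
    and lim: "filterlim C at_top sequentially"
    using solution_family by blast
  have "\<exists>R u. 1 < R \<and> locally_analytic_solution u {0..<R} \<and> (\<forall>\<rho>. 0 \<le> \<rho> \<and> \<rho> \<le> 1 \<longrightarrow> u \<rho> = U (C n) \<rho>)" for n
    by (rule global_solution[OF C(1)[of n] C(3)[of n]]) blast
  then obtain R u where Ru: "\<And>n. 1 < R n" "\<And>n. locally_analytic_solution (u n) {0..<R n}"
    "\<And>n \<rho>. 0 \<le> \<rho> \<Longrightarrow> \<rho> \<le> 1 \<Longrightarrow> u n \<rho> = U (C n) \<rho>"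
    by metis
  have zeros: "{\<rho>\<in>{0<..<1}. u n \<rho> - u_inf N p \<rho> = 0} = Z (C n)" for n
    unfolding Z_def vv_def by (intro Collect_cong conj_cong refl) (simp add: Ru(3))
  have "is_solution_on N p (u n) {0<..<R n}" for n
    by (rule locally_analytic_solution_solves[OF Ru(2)]) auto
  moreover have "(\<lambda>n. u n 0) = C"
    using Ru(3)[of 0] regD(4)[OF reg_U[OF C(1)]] by auto
  ultimately show ?thesis
    using Ru(1) locally_analytic_solution_analytic[OF Ru(2)] locally_analytic_solution_pos[OF Ru(2)]
      Z_finite[OF C(1)] C(2) lim
    by (intro exI[of _ R] exI[of _ u]) (simp only: zeros, simp)
qed

end
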